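(* There exist universal constants $F,A_0,C>0$ such that the following holds. Consider the data model and the estimator $\hat\beta$ (a solution of the linear program with regularisation parameter $\lambda$) described in the context, where for some $A>0$ $$\lambda=A\max\left\{\max_{l\in[L]}\left\{\sqrt{\frac{R_X^2(\sigma+R_X\|\beta^*\|_2)^2\log(2L|L_l|)}{h_l}}\right\},\max_{h\in[L]}\left\{L\sqrt{\frac{R_X^4\|\beta^*\|_2^2\log(2L|L_h|)}{N+\min_{g}\{n_{g,h}\}}}\right\}\right\}.$$ Assume that $\|\beta^*\|_0\le s$, that $\mathbb{E}[X]=0$ and $\|X\|_{\psi_2}\le R_X$ for some $R_X>0$, that the noise $\epsilon$ is sub-Gaussian with parameter $\sigma$, and that $\Sigma$ satisfies $Re(s,\Phi_\Sigma)$ for some constant $\Phi_\Sigma>0$. Additionally, suppose that for all $(g,h)\in[L]^2$ $$n_{g,h}+N\ge F\max\left\{\frac{R_X^4s^2}{\Phi_\Sigma^2},\frac{R_X^2s}{\Phi_\Sigma},A^2,\frac{A^2L^2R_X^2\|\beta^*\|_2^2}{(\sigma+R_X\|\beta^*\|_2)^2}\right\}\max\{\log(2L|L_g|),\log(2L|L_h|)\},$$ $$h_g\ge F\max\left\{A^2,\frac{A^2(\sigma+R_X\|\beta^*\|_2)^2}{R_X^2L^2\|\beta^*\|_2^2}\right\}\log(2L|L_g|).$$ Then, provided $A\ge A_0$, with probability at least $1-\frac{1}{L\min_{l\in[L]}\{|L_l|\}}$ it holds that $$\|\hat\beta-\beta^*\|_2^2\le C\,\frac{sA^2}{\Phi_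\Sigma^2}\max\left\{\max_{l\in[L]}\left\{\frac{R_X^2(\sigma+R_X\|\beta^*\|_2)^2\log(2L|L_l|)}{h_l}\right\},\max_{h\in[L]}\left\{\frac{L^2R_X^4\|\beta^*\|_2^2\log(2L|L_h|)}{N+\min_g\{n_{g,h}\}}\right\}\right\}.$$
   Context: Data model: $(X,Y)\in\mathbb{R}^p\times\mathbb{R}$ with $X\sim P_X$, $\Sigma=\mathbb{E}[XX^T]$, and $Y=X^T\beta^*+\epsilon$, where $\beta^*\in\mathbb{R}^p$, $\mathbb{E}[\epsilon|X]=0$, $\mathrm{Var}[\epsilon|X]=\sigma^2$. There are $K$ missingness patterns with observed sets $O_k\subseteq[p]$, $\cup_kO_k=[p]$. The labelled data consist, independently over $k\in[K]$, of $n_k$ i.i.d. copies of $(X_{O_k},Y)$; $\mathcal I_{\mathcal L}$ is the index set of labelled observations, and $\Xi(i)\in[K]$ is the pattern of observation $i$. There are also $N\ge0$ unlabelled i.i.d. copies of $X$, independent of the labelled data, with index set $\mathcal I_{\mathcal U}$. The modalities $L_1,\dots,L_L$ form the partition of $[p]$ with the smallest number $L$ of parts such that each $O_k$ is a union of parts; $\xi(j)=g$ if $j\in L_g$; $h_g=\sum_kn_k\mathbb{1}_{\{L_g\subseteq O_k\}}$ and $n_{g,h}=\sum_kn_k\mathbb{1}_{\{L_g\cup L_h\subseteq O_k\}}$. Estimator: it is assumed that $n_{g,h}+N>0$ for all $g,h$. For $i,j\in[p]$, $$\hat\gamma_j=\frac{1}{h_{\xi(j)}}\sum_{i\in\mathcal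 I_{\mathcal L}}(X_i)_jY_i\mathbb{1}_{\{j\in O_{\Xi(i)}\}},\quad\hat\Sigma_{ij}=\frac{1}{n_{\xi(i),\xi(j)}+N}\left(\sum_{k\in\mathcal I_{\mathcal U}}(X_k)_i(X_k)_j+\sum_{k\in\mathcal I_{\mathcal L}}(X_k)_i(X_k)_j\mathbb{1}_{\{\{i,j\}\subseteq O_{\Xi(k)}\}}\right),$$ and $\hat\beta\in\arg\min_{\beta\in\mathbb{R}^p}\{\|\beta\|_1:\|\hat\Sigma\beta-\hat\gamma\|_\infty\le\lambda\}$. Definitions: $\|Z\|_{\psi_2}=\inf\{c>0:\mathbb{E}e^{Z^2/c^2}\le2\}$ for scalar $Z$ and $\|X\|_{\psi_2}=\sup_{\|u\|_2=1}\|u^TX\|_{\psi_2}$ for vectors. The (mean-zero) noise $\epsilon$ is sub-Gaussian with parameter $\sigma$ if $\mathbb{E}e^{t\epsilon}\le e^{t^2\sigma^2/2}$ for all $t\in\mathbb{R}$. $\|x\|_0$ is the number of nonzero entries of $x$. For $A\in\mathbb{R}^{p\times p}$ and $s\in[0,p]$, $$\phi^2(A,s)=\inf_{S\subset[p],|S|\le s}\ \inf_{\delta\ne0:\|\delta_{S^c}\|_1\le\|\delta_S\|_1}\frac{\delta^TA\delta}{\|\delta_{M(\delta)}\|_2^2},\quad M(\delta)=S\cup\{i\in S^c:|\delta_i|\ge|\delta_{S^c}|_{(\min\{s,|S^c|\})}\},$$ where $|\delta_{S^c}|_{(j)}$ is the $j$th largest absolute value among the entries of $\delta_{S^c}$.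 $A$ satisfies $Re(s,\Phi)$ if $\phi^2(A,s)\ge\Phi$. *)

theory Defs
  imports "HOL-Probability.Probability"
begin

text \<open>
  Universal constants may not depend on the dimension or on the sample space, so neither of them is a
  type here.  A vector of dimension \<open>p\<close> is a function \<open>v :: nat \<Rightarrow> real\<close> of which only the entries
  \<open>v i\<close> with \<open>i < p\<close> matter, all indices start at 0, and the data are represented by their law on
  the canonical (product) sample space.
\<close>

abbreviation Rvec :: "nat set \<Rightarrow> (nat \<Rightarrow> real) measure" where
  "Rvec J \<equiv> PiM J (\<lambda>_. borel)"

definition dot :: "nat \<Rightarrow> (nat \<Rightarrow> real) \<Rightarrow> (nat \<Rightarrow> real) \<Rightarrow> real" where
  "dot p u v = (\<Sum>i<p. u i * v i)"

definition mult_mat :: "nat \<Rightarrow> (nat \<Rightarrow> nat \<Rightarrow> real) \<Rightarrow> (nat \<Rightarrow> real) \<Rightarrow> nat \<Rightarrow> real" where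
  "mult_mat p A v i = (\<Sum>j<p. A i j * v j)"

definition l0_norm :: "nat \<Rightarrow> (nat \<Rightarrow> real) \<Rightarrow> nat" where
  "l0_norm p v = card {i. i < p \<and> v i \<noteq> 0}"

definition l1_norm :: "nat \<Rightarrow> (nat \<Rightarrow> real) \<Rightarrow> real" where
  "l1_norm p v = (\<Sum>i<p. \<bar>v i\<bar>)"

abbreviation l2_norm :: "nat \<Rightarrow> (nat \<Rightarrow> real) \<Rightarrow> real" where
  "l2_norm p v \<equiv> L2_set v {..<p}"

definition linf_norm :: "nat \<Rightarrow> (nat \<Rightarrow> real) \<Rightarrow> real" where
  "linf_norm p v = (MAX i\<in>{..<p}. \<bar>v i\<bar>)"

text \<open>Values in \<open>ereal\<close>, so that the infimum of the empty set is \<open>\<infinity>\<close>.\<close>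

definition psi2_norm :: "'a measure \<Rightarrow> ('a \<Rightarrow> real) \<Rightarrow> ereal" where
  "psi2_norm M Z =
     (INF c\<in>{c::real. c > 0 \<and> (\<integral>\<^sup>+\<omega>. ennreal (exp ((Z \<omega>)\<^sup>2 / c\<^sup>2)) \<partial>M) \<le> 2}. ereal c)"

definition psi2_norm_vec :: "nat \<Rightarrow> 'a measure \<Rightarrow> ('a \<Rightarrow> nat \<Rightarrow> real) \<Rightarrow> ereal" where
  "psi2_norm_vec p M X = (SUP u\<in>{u. l2_norm p u = 1}. psi2_norm M (\<lambda>\<omega>. dot p u (X \<omega>)))"

definition sub_Gaussian :: "'a measure \<Rightarrow> ('a \<Rightarrow> real) \<Rightarrow> real \<Rightarrow> bool" where
  "sub_Gaussian M Z \<sigma> \<longleftrightarrow>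
     (\<forall>t::real. (\<integral>\<^sup>+\<omega>. ennreal (exp (t * Z \<omega>)) \<partial>M) \<le> ennreal (exp (t\<^sup>2 * \<sigma>\<^sup>2 / 2)))"

text \<open>The \<open>k\<close>th largest absolute value, for \<open>1 \<le> k \<le> card T\<close>, among the entries in \<open>T\<close>.\<close>

definition kth_largest_abs :: "nat \<Rightarrow> (nat \<Rightarrow> real) \<Rightarrow> nat set \<Rightarrow> real" where
  "kth_largest_abs k \<delta> T = rev (sort (map (\<lambda>i. \<bar>\<delta> i\<bar>) (sorted_list_of_set T))) ! (k - 1)"

text \<open>
  The index \<open>min s (card T)\<close> below is 0 only if \<open>T\<close> is empty, or if \<open>s = 0\<close>, in which case
  the infimum in \<open>phi_sq\<close> ranges over no \<open>\<delta>\<close> and equals \<open>\<infinity>\<close>.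
\<close>

definition M_set :: "nat \<Rightarrow> nat \<Rightarrow> nat set \<Rightarrow> (nat \<Rightarrow> real) \<Rightarrow> nat set" where
  "M_set p s S \<delta> =
     (let T = {..<p} - S in S \<union> {i \<in> T. \<bar>\<delta> i\<bar> \<ge> kth_largest_abs (min s (card T)) \<delta> T})"

definition phi_sq :: "nat \<Rightarrow> (nat \<Rightarrow> nat \<Rightarrow> real) \<Rightarrow> nat \<Rightarrow> ereal" where
  "phi_sq p A s =
     (INF S\<in>{S. S \<subseteq> {..<p} \<and> card S \<le> s}.
      INF \<delta>\<in>{\<delta>. (\<exists>i<p. \<delta> i \<noteq> 0) \<and> (\<Sum>i\<in>{..<p} - S. \<bar>\<delta> i\<bar>) \<le> (\<Sum>i\<in>S. \<bar>\<delta> i\<bar>)}.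
        ereal (dot p \<delta> (mult_mat p A \<delta>) / (L2_set \<delta> (M_set p s S \<delta>))\<^sup>2))"

definition Re_cond :: "nat \<Rightarrow> (nat \<Rightarrow> nat \<Rightarrow> real) \<Rightarrow> nat \<Rightarrow> real \<Rightarrow> bool" where
  "Re_cond p A s \<Phi> \<longleftrightarrow> phi_sq p A s \<ge> ereal \<Phi>"

text \<open>\<open>P\<close> is the joint law of \<open>(X, \<epsilon>)\<close>; thus \<open>fst\<close> is \<open>X\<close> and \<open>snd\<close> is \<open>\<epsilon>\<close>.\<close>

type_synonym model_law = "((nat \<Rightarrow> real) \<times> real) measure"

definition sigma_X :: "nat \<Rightarrow> model_law \<Rightarrow> model_law" where
  "sigma_X p P = vimage_algebra (space P) fst (Rvec {..<p})"

definition cond_var :: "'a measure \<Rightarrow> 'a measure \<Rightarrow> ('a \<Rightarrow> real) \<Rightarrow> 'a \<Rightarrow> real" where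
  "cond_var M F Z = real_cond_exp M F (\<lambda>\<omega>. (Z \<omega> - real_cond_exp M F Z \<omega>)\<^sup>2)"

definition linear_model :: "nat \<Rightarrow> model_law \<Rightarrow> real \<Rightarrow> bool" where
  "linear_model p P \<sigma> \<longleftrightarrow>
     prob_space P \<and> sets P = sets (Rvec {..<p} \<Otimes>\<^sub>M borel) \<and> \<sigma> \<ge> 0 \<and>
     (\<forall>j<p. integrable P (\<lambda>\<omega>. (fst \<omega> j)\<^sup>2)) \<and> integrable P (\<lambda>\<omega>. (snd \<omega>)\<^sup>2) \<and>
     (AE \<omega> in P. real_cond_exp P (sigma_X p P) snd \<omega> = 0) \<and>
     (AE \<omega> in P. cond_var P (sigma_X p P) snd \<omega> = \<sigma>\<^sup>2)"

definition second_moment :: "model_law \<Rightarrow> nat \<Rightarrow> nat \<Rightarrow> real" where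
  "second_moment P i j = (\<integral>\<omega>. fst \<omega> i * fst \<omega> j \<partial>P)"

definition patterns :: "nat \<Rightarrow> nat \<Rightarrow> (nat \<Rightarrow> nat set) \<Rightarrow> bool" where
  "patterns p K Ob \<longleftrightarrow> (\<forall>k<K. Ob k \<subseteq> {..<p}) \<and> (\<Union>k<K. Ob k) = {..<p}"

text \<open>
  Labelled observations are indexed by pairs \<open>(k, m)\<close> with \<open>m < n k\<close>, so that the pattern
  \<open>\<Xi>\<close> of an observation is \<open>fst\<close> of its index.  Each one is a pair \<open>(x, y)\<close> in which
  \<open>x\<close> contains only the observed coordinates (it is \<open>undefined\<close> outside \<open>Ob k\<close>).
\<close>

type_synonym sample = "((nat \<times> nat) \<Rightarrow> (nat \<Rightarrow> real) \<times> real) \<times> (nat \<Rightarrow> nat \<Rightarrow> real)"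

definition lab_index :: "nat \<Rightarrow> (nat \<Rightarrow> nat) \<Rightarrow> (nat \<times> nat) set" where
  "lab_index K n = (SIGMA k:{..<K}. {..<n k})"

definition lab_law :: "nat \<Rightarrow> model_law \<Rightarrow> (nat \<Rightarrow> real) \<Rightarrow> nat set \<Rightarrow> model_law" where
  "lab_law p P \<beta> J =
     distr P (Rvec J \<Otimes>\<^sub>M borel) (\<lambda>(x, e). (restrict x J, dot p x \<beta> + e))"

definition data_law ::
  "nat \<Rightarrow> nat \<Rightarrow> (nat \<Rightarrow> nat set) \<Rightarrow> (nat \<Rightarrow> nat) \<Rightarrow> nat \<Rightarrow> model_law \<Rightarrow> (nat \<Rightarrow> real) \<Rightarrow> sample measure" where
  "data_law p K Ob n N P \<beta> =
     PiM (lab_index K n) (\<lambda>i. lab_law p P \<beta> (Ob (fst i))) \<Otimes>\<^sub>M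
     PiM {..<N} (\<lambda>_. distr P (Rvec {..<p}) fst)"

definition compatible_partition ::
  "nat \<Rightarrow> nat \<Rightarrow> (nat \<Rightarrow> nat set) \<Rightarrow> nat set set \<Rightarrow> bool" where
  "compatible_partition p K Ob Q \<longleftrightarrow>
     partition_on {..<p} Q \<and> (\<forall>k<K. \<exists>U\<subseteq>Q. Ob k = \<Union>U)"

definition modalities ::
  "nat \<Rightarrow> nat \<Rightarrow> (nat \<Rightarrow> nat set) \<Rightarrow> nat \<Rightarrow> (nat \<Rightarrow> nat set) \<Rightarrow> bool" where
  "modalities p K Ob L Md \<longleftrightarrow>
     inj_on Md {..<L} \<and> compatible_partition p K Ob (Md ` {..<L}) \<and>
     (\<forall>Q. compatible_partition p K Ob Q \<longrightarrow> L \<le> card Q)"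

definition modality_of :: "nat \<Rightarrow> (nat \<Rightarrow> nat set) \<Rightarrow> nat \<Rightarrow> nat" where
  "modality_of L Md j = (THE g. g < L \<and> j \<in> Md g)"

definition h_count ::
  "nat \<Rightarrow> (nat \<Rightarrow> nat set) \<Rightarrow> (nat \<Rightarrow> nat) \<Rightarrow> (nat \<Rightarrow> nat set) \<Rightarrow> nat \<Rightarrow> nat" where
  "h_count K Ob n Md g = (\<Sum>k<K. n k * of_bool (Md g \<subseteq> Ob k))"

definition n_count ::
  "nat \<Rightarrow> (nat \<Rightarrow> nat set) \<Rightarrow> (nat \<Rightarrow> nat) \<Rightarrow> (nat \<Rightarrow> nat set) \<Rightarrow> nat \<Rightarrow> nat \<Rightarrow> nat" where
  "n_count K Ob n Md g h = (\<Sum>k<K. n k * of_bool (Md g \<union> Md h \<subseteq> Ob k))"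

definition gamma_hat ::
  "nat \<Rightarrow> (nat \<Rightarrow> nat set) \<Rightarrow> (nat \<Rightarrow> nat) \<Rightarrow> nat \<Rightarrow> (nat \<Rightarrow> nat set) \<Rightarrow> sample \<Rightarrow> nat \<Rightarrow> real" where
  "gamma_hat K Ob n L Md \<omega> j =
     1 / real (h_count K Ob n Md (modality_of L Md j)) *
     (\<Sum>i\<in>lab_index K n. fst (fst \<omega> i) j * snd (fst \<omega> i) * of_bool (j \<in> Ob (fst i)))"

definition Sigma_hat ::
  "nat \<Rightarrow> (nat \<Rightarrow> nat set) \<Rightarrow> (nat \<Rightarrow> nat) \<Rightarrow> nat \<Rightarrow> nat \<Rightarrow> (nat \<Rightarrow> nat set) \<Rightarrow> sample \<Rightarrow>
     nat \<Rightarrow> nat \<Rightarrow> real" where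
  "Sigma_hat K Ob n N L Md \<omega> i j =
     1 / real (n_count K Ob n Md (modality_of L Md i) (modality_of L Md j) + N) *
     ((\<Sum>k<N. snd \<omega> k i * snd \<omega> k j) +
      (\<Sum>k\<in>lab_index K n. fst (fst \<omega> k) i * fst (fst \<omega> k) j * of_bool ({i, j} \<subseteq> Ob (fst k))))"

definition lp_solutions ::
  "nat \<Rightarrow> (nat \<Rightarrow> nat \<Rightarrow> real) \<Rightarrow> (nat \<Rightarrow> real) \<Rightarrow> real \<Rightarrow> (nat \<Rightarrow> real) set" where
  "lp_solutions p S g lam =
     {b. is_arg_min (l1_norm p) (\<lambda>b. linf_norm p (\<lambda>i. mult_mat p S b i - g i) \<le> lam) b}"

text \<open>
  The linear program may be infeasible for some samples; there the estimator is arbitrary.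
  No measurability is required of the choice among several solutions.
\<close>

definition is_estimator ::
  "nat \<Rightarrow> nat \<Rightarrow> (nat \<Rightarrow> nat set) \<Rightarrow> (nat \<Rightarrow> nat) \<Rightarrow> nat \<Rightarrow> nat \<Rightarrow> (nat \<Rightarrow> nat set) \<Rightarrow> real \<Rightarrow>
     (sample \<Rightarrow> nat \<Rightarrow> real) \<Rightarrow> bool" where
  "is_estimator p K Ob n N L Md lam \<beta>hat \<longleftrightarrow>
     (\<forall>\<omega>. let sol = lp_solutions p (Sigma_hat K Ob n N L Md \<omega>) (gamma_hat K Ob n L Md \<omega>) lam
          in sol \<noteq> {} \<longrightarrow> \<beta>hat \<omega> \<in> sol)"

text \<open>
  ``With probability at least \<open>q\<close>'' for an event that need not be measurable; for measurable
  events this says that its probability is at least \<open>q\<close>.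
\<close>

definition with_prob_at_least :: "'a measure \<Rightarrow> real \<Rightarrow> ('a \<Rightarrow> bool) \<Rightarrow> bool" where
  "with_prob_at_least M q Q \<longleftrightarrow> (\<exists>E\<in>sets M. measure M E \<ge> q \<and> (\<forall>\<omega>\<in>E. Q \<omega>))"

end

theory Submission
  imports Defs
begin

text \<open>
  Write \<open>\<delta> = \<beta>hat - \<beta>\<close>.  The estimator is a Dantzig selector, and the proof has a
  deterministic and a probabilistic half.

  If \<open>\<beta>\<close> itself satisfies the constraint of the linear program, then the minimality of
  \<open>\<beta>hat\<close> puts \<open>\<delta>\<close> into the cone of the restricted eigenvalue condition, and both
  constraints together give \<open>\<bar>Sigma_hat \<delta>\<bar> \<le> 2 lam\<close> entrywise.  If moreover every entry of
  \<open>Sigma_hat - \<Sigma>\<close> is at most \<open>\<Phi> / (8 s)\<close>, then replacing \<open>Sigma_hat\<close> by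
  \<open>\<Sigma>\<close> in \<open>\<delta>\<^sup>T Sigma_hat \<delta>\<close> costs at most half of the restricted eigenvalue bound,
  and \<open>\<parallel>\<delta>\<parallel>\<^sup>2 \<le> 128 s lam\<^sup>2 / \<Phi>\<^sup>2\<close> follows (\<open>lp_solution_error\<close>).

  For the probability, every quantity to be controlled is an average of independent copies of a
  product of two sub-Gaussian variables: \<open>X\<^sub>j Y\<close> for \<open>gamma_hat\<close>, and
  \<open>X\<^sub>j v\<^sup>T X\<close> with \<open>v\<close> supported on one modality for \<open>Sigma_hat\<close>.  Within one block of
  \<open>Sigma_hat\<close>, given by two modalities, the average runs over the same labelled and unlabelled
  observations for all entries, because modalities are never observed partially.  Such a product is
  sub-exponential, so Bernstein's inequality holds for it (\<open>two_sample_bernstein\<close>).  The error of \<open>Sigma_hat \<beta>\<close> is cut into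
  \<open>L\<close> blocks, one for each modality of the column index, because the sample size changes from
  block to block; each block may use the share \<open>lam / (4 L)\<close>, which is where the factor \<open>L\<close>
  in \<open>lam\<close> comes from.

  All deviations are chosen so that an event about coordinate \<open>j\<close> fails with probability at most
  \<open>2 u\<^sub>j\<^sup>4\<close>, and one about a pair with probability at most
  \<open>2 u\<^sub>i\<^sup>2 u\<^sub>j\<^sup>2\<close>, where \<open>u\<^sub>j = 1 / (2 L \<bar>L\<^sub>g\<bar>)\<close> for the modality \<open>L\<^sub>g\<close> of \<open>j\<close>.  These
  weights sum to \<open>1/2\<close>, and the largest of them is half of the failure probability allowed by the
  theorem, so the union bound over all coordinates and pairs succeeds (\<open>union_bound_total\<close>).
\<close>

section \<open>The Dantzig selector under a restricted eigenvalue condition\<close>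

text \<open>
  At least \<open>k\<close> of the entries are as large as the \<open>k\<close>th largest one.
\<close>

lemma kth_largest_abs_mult_le_sum:
  assumes "finite T" "1 \<le> k" "k \<le> card T"
  shows "real k * kth_largest_abs k \<delta> T \<le> (\<Sum>i\<in>T. \<bar>\<delta> i\<bar>)"
proof -
  define ys where "ys = rev (sort (map (\<lambda>i. \<bar>\<delta> i\<bar>) (sorted_list_of_set T)))"
  have len: "length ys = card T" by (simp add: ys_def)
  have dec: "sorted_wrt (\<ge>) ys"
    by (simp add: ys_def sorted_wrt_rev)
  have nonneg: "\<forall>y\<in>set ys. 0 \<le> y" by (auto simp: ys_def)
  have "sum_list ys = sum_list (map (\<lambda>i. \<bar>\<delta> i\<bar>) (sorted_list_of_set T))"
    unfolding ys_def by (metis mset_rev mset_sort sum_mset_sum_list)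
  also have "\<dots> = (\<Sum>i\<in>T. \<bar>\<delta> i\<bar>)"
    using assms(1) by (simp add: sum_list_distinct_conv_sum_set)
  finally have total: "sum_list ys = (\<Sum>i\<in>T. \<bar>\<delta> i\<bar>)" .
  have "real k * ys ! (k - 1) = (\<Sum>i<k. ys ! (k - 1))" by simp
  also have "\<dots> \<le> (\<Sum>i<k. ys ! i)"
  proof (rule sum_mono)
    fix i assume "i \<in> {..<k}"
    then consider "i = k - 1" | "i < k - 1" by fastforce
    then show "ys ! (k - 1) \<le> ys ! i"
    proof cases
      case 2
      have "k - 1 < length ys" using assms len by auto
      with sorted_wrt_nth_less[OF dec 2] show ?thesis by auto
    qed simp
  qed
  also have "\<dots> \<le> (\<Sum>i<length ys. ys ! i)"
    using assms len nonneg by (intro sum_mono2) (auto intro: nth_mem)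
  also have "\<dots> = sum_list ys" by (simp add: sum_list_sum_nth atLeast0LessThan)
  finally show ?thesis unfolding total by (simp add: kth_largest_abs_def ys_def)
qed

text \<open>
  The last entry in decreasing order is the smallest.
\<close>

lemma kth_largest_abs_card_le:
  assumes "finite T" "i \<in> T"
  shows "kth_largest_abs (card T) \<delta> T \<le> \<bar>\<delta> i\<bar>"
proof -
  define zs where "zs = sort (map (\<lambda>i. \<bar>\<delta> i\<bar>) (sorted_list_of_set T))"
  have len: "length zs = card T" by (simp add: zs_def)
  have pos: "0 < card T" using assms by (auto simp: card_gt_0_iff)
  have "\<bar>\<delta> i\<bar> \<in> set zs" using assms by (simp add: zs_def)
  then obtain m where "m < length zs" "zs ! m = \<bar>\<delta> i\<bar>" by (auto simp: in_set_conv_nth)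
  moreover have "sorted zs" by (simp add: zs_def)
  ultimately have "zs ! 0 \<le> \<bar>\<delta> i\<bar>" by (metis le0 sorted_iff_nth_mono)
  moreover have "rev zs ! (card T - 1) = zs ! 0"
    using len pos by (simp add: rev_nth)
  ultimately show ?thesis by (simp add: kth_largest_abs_def zs_def)
qed

text \<open>
  An entry outside \<open>M(\<delta>)\<close> is smaller than the \<open>s\<close>th largest entry off \<open>S\<close>, hence at most
  \<open>1/s\<close> times the \<open>\<ell>\<^sub>1\<close> mass off \<open>S\<close>.  Bounding one factor of each square in this way leaves
  the square of that mass divided by \<open>s\<close>, which the cone condition and the Cauchy-Schwarz inequality
  compare with \<open>S\<close>.  If there are at most \<open>s\<close> entries off \<open>S\<close>, then nothing is outside
  \<open>M(\<delta>)\<close>.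
\<close>

lemma sum_power2_outside_M_set_le:
  assumes "S \<subseteq> {..<p}" "card S \<le> s" "0 < s"
    and cone: "(\<Sum>i\<in>{..<p} - S. \<bar>\<delta> i\<bar>) \<le> (\<Sum>i\<in>S. \<bar>\<delta> i\<bar>)"
  shows "(\<Sum>i\<in>{..<p} - M_set p s S \<delta>. (\<delta> i)\<^sup>2) \<le> (L2_set \<delta> S)\<^sup>2"
proof -
  define T where "T = {..<p} - S"
  define B where "B = {..<p} - M_set p s S \<delta>"
  define a where "a = (\<Sum>i\<in>T. \<bar>\<delta> i\<bar>)"
  have finS: "finite S" using assms(1) finite_subset by blast
  have finT: "finite T" by (simp add: T_def)
  have B: "B \<subseteq> T" "\<And>i. i \<in> B \<Longrightarrow> \<bar>\<delta> i\<bar> < kth_largest_abs (min s (card T)) \<delta> T"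
    by (auto simp: B_def M_set_def T_def Let_def not_le)
  have a0: "0 \<le> a" by (simp add: a_def sum_nonneg)
  have small: "real s * \<bar>\<delta> i\<bar> \<le> a" if "i \<in> B" for i
  proof (cases "s < card T")
    case True
    have "real s * \<bar>\<delta> i\<bar> \<le> real s * kth_largest_abs s \<delta> T"
      using B(2)[OF that] True by (intro mult_left_mono) auto
    also have "\<dots> \<le> a"
      unfolding a_def using True assms(3) finT by (intro kth_largest_abs_mult_le_sum) auto
    finally show ?thesis .
  next
    case False
    have "kth_largest_abs (card T) \<delta> T \<le> \<bar>\<delta> i\<bar>"
      using that B(1) by (intro kth_largest_abs_card_le finT) auto
    with B(2)[OF that] False show ?thesis by (simp add: min_def split: if_splits)
  qed
  have "real s * (\<Sum>i\<in>B. (\<delta> i)\<^sup>2) = (\<Sum>i\<in>B. (real s * \<bar>\<delta> i\<bar>) * \<bar>\<delta> i\<bar>)"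
    by (simp add: sum_distrib_left power2_eq_square mult.assoc)
  also have "\<dots> \<le> (\<Sum>i\<in>B. a * \<bar>\<delta> i\<bar>)"
    by (intro sum_mono mult_right_mono small) auto
  also have "\<dots> = a * (\<Sum>i\<in>B. \<bar>\<delta> i\<bar>)" by (simp add: sum_distrib_left)
  also have "\<dots> \<le> a * a"
    unfolding a_def using B(1) finT a0[unfolded a_def]
    by (intro mult_left_mono sum_mono2) auto
  also have "\<dots> \<le> (\<Sum>i\<in>S. \<bar>\<delta> i\<bar>) * (\<Sum>i\<in>S. \<bar>\<delta> i\<bar>)"
    using cone a0 by (intro mult_mono) (auto simp: a_def T_def)
  also have "\<dots> = (\<Sum>i\<in>S. \<bar>1\<bar> * \<bar>\<delta> i\<bar>)\<^sup>2" by (simp add: power2_eq_square)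
  also have "\<dots> \<le> (L2_set (\<lambda>_. 1) S * L2_set \<delta> S)\<^sup>2"
    by (intro power_mono L2_set_mult_ineq sum_nonneg) auto
  also have "\<dots> = real (card S) * (L2_set \<delta> S)\<^sup>2"
    by (simp add: power_mult_distrib L2_set_def)
  also have "\<dots> \<le> real s * (L2_set \<delta> S)\<^sup>2"
    using assms(2) by (intro mult_right_mono) auto
  finally show ?thesis using assms(3) by (simp add: B_def)
qed

text \<open>
  The restricted eigenvalue condition controls \<open>\<delta>\<close> on \<open>M(\<delta>)\<close> only.  For \<open>\<delta>\<close> in the cone that
  controls both norms which the error analysis needs.
\<close>

lemma l2_norm_power2_le_M_set:
  assumes "S \<subseteq> {..<p}" "card S \<le> s" "0 < s"
    and "(\<Sum>i\<in>{..<p} - S. \<bar>\<delta> i\<bar>) \<le> (\<Sum>i\<in>S. \<bar>\<delta> i\<bar>)"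
  shows "(l2_norm p \<delta>)\<^sup>2 \<le> 2 * (L2_set \<delta> (M_set p s S \<delta>))\<^sup>2"
    and "l1_norm p \<delta> \<le> 2 * sqrt (real s) * L2_set \<delta> (M_set p s S \<delta>)"
proof -
  define M where "M = M_set p s S \<delta>"
  have M: "M \<subseteq> {..<p}" "S \<subseteq> M" "finite M" "finite S"
    using assms(1) by (auto simp: M_def M_set_def Let_def intro: finite_subset)
  have sq: "(L2_set \<delta> B)\<^sup>2 = (\<Sum>i\<in>B. (\<delta> i)\<^sup>2)" for B
    by (simp add: L2_set_def sum_nonneg)
  have SM: "(L2_set \<delta> S)\<^sup>2 \<le> (L2_set \<delta> M)\<^sup>2"
    unfolding sq using M by (intro sum_mono2) auto
  have "(l2_norm p \<delta>)\<^sup>2 = (\<Sum>i\<in>{..<p} - M. (\<delta> i)\<^sup>2) + (L2_set \<delta> M)\<^sup>2"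
    unfolding sq using M(1) by (intro sum.subset_diff) auto
  also have "\<dots> \<le> (L2_set \<delta> S)\<^sup>2 + (L2_set \<delta> M)\<^sup>2"
    using sum_power2_outside_M_set_le[OF assms] by (simp add: M_def)
  finally show "(l2_norm p \<delta>)\<^sup>2 \<le> 2 * (L2_set \<delta> (M_set p s S \<delta>))\<^sup>2"
    using SM unfolding M_def by linarith
  have "l1_norm p \<delta> = (\<Sum>i\<in>{..<p} - S. \<bar>\<delta> i\<bar>) + (\<Sum>i\<in>S. \<bar>\<delta> i\<bar>)"
    unfolding l1_norm_def using assms(1) by (intro sum.subset_diff) auto
  also have "\<dots> \<le> 2 * (\<Sum>i\<in>S. \<bar>1\<bar> * \<bar>\<delta> i\<bar>)" using assms(4) by simp
  also have "\<dots> \<le> 2 * (L2_set (\<lambda>_. 1) S * L2_set \<delta> S)"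
    by (intro mult_left_mono L2_set_mult_ineq) auto
  also have "\<dots> \<le> 2 * (sqrt (real s) * L2_set \<delta> M)"
    using assms(2) power2_le_imp_le[OF SM L2_set_nonneg]
    by (intro mult_left_mono mult_mono) (auto simp: L2_set_def[of "\<lambda>_. 1"])
  finally show "l1_norm p \<delta> \<le> 2 * sqrt (real s) * L2_set \<delta> (M_set p s S \<delta>)"
    by (simp add: M_def)
qed

lemma abs_le_linf_norm: "i < p \<Longrightarrow> \<bar>v i\<bar> \<le> linf_norm p v"
  unfolding linf_norm_def by (intro Max_ge) auto

lemma linf_norm_le_iff: "0 < p \<Longrightarrow> linf_norm p v \<le> c \<longleftrightarrow> (\<forall>i<p. \<bar>v i\<bar> \<le> c)"
  unfolding linf_norm_def by (subst Max_le_iff) auto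

text \<open>
  Off the support \<open>S\<close> of \<open>\<beta>\<close> the error \<open>b - \<beta>\<close> equals \<open>b\<close>, so its mass there is mass that \<open>b\<close>
  must save on \<open>S\<close>.
\<close>

lemma l1_norm_cone:
  assumes "l1_norm p b \<le> l1_norm p \<beta>"
  defines "S \<equiv> {i. i < p \<and> \<beta> i \<noteq> 0}"
  shows "(\<Sum>i\<in>{..<p} - S. \<bar>b i - \<beta> i\<bar>) \<le> (\<Sum>i\<in>S. \<bar>b i - \<beta> i\<bar>)"
proof -
  have S: "S \<subseteq> {..<p}" by (auto simp: S_def)
  have split: "l1_norm p v = (\<Sum>i\<in>{..<p} - S. \<bar>v i\<bar>) + (\<Sum>i\<in>S. \<bar>v i\<bar>)" for v
    unfolding l1_norm_def using S by (intro sum.subset_diff) auto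
  have off: "(\<Sum>i\<in>{..<p} - S. \<bar>b i - \<beta> i\<bar>) = (\<Sum>i\<in>{..<p} - S. \<bar>b i\<bar>)"
    "(\<Sum>i\<in>{..<p} - S. \<bar>\<beta> i\<bar>) = 0"
    by (auto simp: S_def intro!: sum.cong)
  have "(\<Sum>i\<in>S. \<bar>\<beta> i\<bar>) - (\<Sum>i\<in>S. \<bar>b i\<bar>) \<le> (\<Sum>i\<in>S. \<bar>b i - \<beta> i\<bar>)"
    unfolding sum_subtractf[symmetric] by (intro sum_mono) auto
  then show ?thesis using assms(1) off by (simp add: split)
qed

lemma dot_le_l1_linf:
  assumes "\<And>i. i < p \<Longrightarrow> \<bar>v i\<bar> \<le> c"
  shows "\<bar>dot p u v\<bar> \<le> l1_norm p u * c"
proof -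
  have "\<bar>dot p u v\<bar> \<le> (\<Sum>i<p. \<bar>u i * v i\<bar>)" unfolding dot_def by (rule sum_abs)
  also have "\<dots> \<le> (\<Sum>i<p. \<bar>u i\<bar> * c)"
    by (intro sum_mono) (auto simp: abs_mult intro!: mult_left_mono assms)
  finally show ?thesis by (simp add: l1_norm_def sum_distrib_right)
qed

lemma mult_mat_diff: "mult_mat p A (\<lambda>i. u i - v i) j = mult_mat p A u j - mult_mat p A v j"
  by (simp add: mult_mat_def right_diff_distrib sum_subtractf)

lemma quadratic_form_perturbation:
  assumes "\<And>i j. i < p \<Longrightarrow> j < p \<Longrightarrow> \<bar>B i j - A i j\<bar> \<le> \<eta>"
  shows "dot p \<delta> (mult_mat p A \<delta>) \<le> dot p \<delta> (mult_mat p B \<delta>) + \<eta> * (l1_norm p \<delta>)\<^sup>2"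
proof -
  define D where "D i j = A i j - B i j" for i j
  have "dot p \<delta> (mult_mat p A \<delta>) - dot p \<delta> (mult_mat p B \<delta>) = dot p \<delta> (mult_mat p D \<delta>)"
    by (simp add: dot_def mult_mat_def D_def sum_subtractf left_diff_distrib right_diff_distrib)
  also have "\<dots> \<le> l1_norm p \<delta> * (l1_norm p \<delta> * \<eta>)"
  proof (rule order_trans[OF abs_ge_self dot_le_l1_linf])
    fix i assume "i < p"
    have "mult_mat p D \<delta> i = dot p \<delta> (D i)" by (simp add: mult_mat_def dot_def mult.commute)
    also have "\<bar>\<dots>\<bar> \<le> l1_norm p \<delta> * \<eta>"
      using assms[OF \<open>i < p\<close>] by (intro dot_le_l1_linf) (auto simp: D_def abs_minus_commute)
    finally show "\<bar>mult_mat p D \<delta> i\<bar> \<le> l1_norm p \<delta> * \<eta>" .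
  qed
  finally show ?thesis by (simp add: power2_eq_square algebra_simps)
qed

lemma Re_cond_bound:
  assumes "Re_cond p A s \<Phi>" "S \<subseteq> {..<p}" "card S \<le> s" "\<exists>i<p. \<delta> i \<noteq> 0"
    and "(\<Sum>i\<in>{..<p} - S. \<bar>\<delta> i\<bar>) \<le> (\<Sum>i\<in>S. \<bar>\<delta> i\<bar>)" "0 < \<Phi>"
  shows "\<Phi> * (L2_set \<delta> (M_set p s S \<delta>))\<^sup>2 \<le> dot p \<delta> (mult_mat p A \<delta>)"
    and "0 < L2_set \<delta> (M_set p s S \<delta>)"
proof -
  have "ereal \<Phi> \<le> ereal (dot p \<delta> (mult_mat p A \<delta>) / (L2_set \<delta> (M_set p s S \<delta>))\<^sup>2)"
    using assms(1) unfolding Re_cond_def phi_sq_def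
    by (rule order_trans) (use assms in \<open>auto intro!: INF_lower2[of S] INF_lower2[of \<delta>]\<close>)
  then have *: "\<Phi> \<le> dot p \<delta> (mult_mat p A \<delta>) / (L2_set \<delta> (M_set p s S \<delta>))\<^sup>2" by simp
  show pos: "0 < L2_set \<delta> (M_set p s S \<delta>)"
    using * \<open>0 < \<Phi>\<close> by (cases "L2_set \<delta> (M_set p s S \<delta>) = 0") (auto simp: less_le)
  show "\<Phi> * (L2_set \<delta> (M_set p s S \<delta>))\<^sup>2 \<le> dot p \<delta> (mult_mat p A \<delta>)"
    using * pos by (simp add: pos_le_divide_eq)
qed

text \<open>
  Let \<open>m\<close> be the norm of \<open>\<delta> = b - \<beta>\<close> on \<open>M(\<delta>)\<close>.  As \<open>\<delta>\<close> lies in the cone,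
  \<open>\<parallel>\<delta>\<parallel>\<^sub>1 \<le> 2 \<surd>s m\<close>, so that \<open>\<Phi> m\<^sup>2 \<le> \<delta>\<^sup>T A \<delta> \<le> \<delta>\<^sup>T B \<delta> + \<Phi> m\<^sup>2 / 2\<close> and
  \<open>\<delta>\<^sup>T B \<delta> \<le> \<parallel>\<delta>\<parallel>\<^sub>1 2 lam \<le> 4 \<surd>s m lam\<close>; solve for \<open>m\<close>.
\<close>

lemma lp_solution_error:
  assumes b: "b \<in> lp_solutions p B g lam"
    and feasible: "linf_norm p (\<lambda>i. mult_mat p B \<beta> i - g i) \<le> lam"
    and sparse: "l0_norm p \<beta> \<le> s"
    and Re: "Re_cond p A s \<Phi>" "0 < \<Phi>"
    and near: "\<And>i j. 0 < s \<Longrightarrow> i < p \<Longrightarrow> j < p \<Longrightarrow> \<bar>B i j - A i j\<bar> \<le> \<Phi> / (8 * real s)"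
  shows "(l2_norm p (\<lambda>i. b i - \<beta> i))\<^sup>2 \<le> 128 * (real s / \<Phi>\<^sup>2) * lam\<^sup>2"
proof -
  define \<delta> where "\<delta> = (\<lambda>i. b i - \<beta> i)"
  define S where "S = {i. i < p \<and> \<beta> i \<noteq> 0}"
  have S: "S \<subseteq> {..<p}" "card S \<le> s" using sparse by (auto simp: S_def l0_norm_def)
  have bfeas: "linf_norm p (\<lambda>i. mult_mat p B b i - g i) \<le> lam"
    and "l1_norm p b \<le> l1_norm p \<beta>"
    using b feasible by (auto simp: lp_solutions_def is_arg_min_def not_less)
  from l1_norm_cone[OF this(2)]
  have cone: "(\<Sum>i\<in>{..<p} - S. \<bar>\<delta> i\<bar>) \<le> (\<Sum>i\<in>S. \<bar>\<delta> i\<bar>)" by (simp add: S_def \<delta>_def)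
  show ?thesis
  proof (cases "\<exists>i<p. \<delta> i \<noteq> 0")
    case False
    then have "l2_norm p \<delta> = 0" by (auto simp: L2_set_def)
    then show ?thesis by (simp add: \<delta>_def)
  next
    case True
    \<comment> \<open>For \<open>s = 0\<close> the cone contains only 0.\<close>
    have "s \<noteq> 0"
    proof
      assume "s = 0"
      then have "S = {}" using S finite_subset[OF S(1)] by auto
      with cone have "(\<Sum>i<p. \<bar>\<delta> i\<bar>) \<le> 0" by simp
      then have "\<forall>i<p. \<delta> i = 0" using sum_nonneg_eq_0_iff[of "{..<p}" "\<lambda>i. \<bar>\<delta> i\<bar>"]
        by (auto simp: antisym[OF _ sum_nonneg])
      with True show False by blast
    qed
    then have s: "0 < s" by simp
    define m where "m = L2_set \<delta> (M_set p s S \<delta>)"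
    have RE: "\<Phi> * m\<^sup>2 \<le> dot p \<delta> (mult_mat p A \<delta>)" "0 < m"
      unfolding m_def using Re_cond_bound[OF Re(1) S True cone Re(2)] by auto
    have l1: "l1_norm p \<delta> \<le> 2 * sqrt (real s) * m" and l2: "(l2_norm p \<delta>)\<^sup>2 \<le> 2 * m\<^sup>2"
      unfolding m_def using l2_norm_power2_le_M_set[OF S s cone] by auto
    have l1_0: "0 \<le> l1_norm p \<delta>" by (simp add: l1_norm_def sum_nonneg)
    have p: "0 < p" using True by auto
    have lam0: "0 \<le> lam" using feasible p abs_le_linf_norm[of 0 p] by (meson abs_ge_zero order_trans)
    have "\<bar>mult_mat p B \<delta> i\<bar> \<le> 2 * lam" if "i < p" for i
      using abs_le_linf_norm[OF that, of "\<lambda>i. mult_mat p B b i - g i"]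
        abs_le_linf_norm[OF that, of "\<lambda>i. mult_mat p B \<beta> i - g i"] bfeas feasible
      by (simp add: \<delta>_def mult_mat_diff)
    then have "\<bar>dot p \<delta> (mult_mat p B \<delta>)\<bar> \<le> l1_norm p \<delta> * (2 * lam)"
      by (rule dot_le_l1_linf)
    also have "\<dots> \<le> (2 * sqrt (real s) * m) * (2 * lam)"
      using l1 lam0 by (intro mult_right_mono) auto
    finally have first: "dot p \<delta> (mult_mat p B \<delta>) \<le> 4 * sqrt (real s) * m * lam" by simp
    have "\<Phi> / (8 * real s) * (l1_norm p \<delta>)\<^sup>2 \<le> \<Phi> / (8 * real s) * (2 * sqrt (real s) * m)\<^sup>2"
      using Re(2) l1 l1_0 by (intro mult_left_mono power_mono) auto
    also have "\<dots> = \<Phi> * m\<^sup>2 / 2" using s by (simp add: power_mult_distrib)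
    finally have "\<Phi> * m\<^sup>2 \<le> 4 * sqrt (real s) * m * lam + \<Phi> * m\<^sup>2 / 2"
      using quadratic_form_perturbation[of p B A "\<Phi> / (8 * real s)" \<delta>] near s RE first by simp
    then have "m * (\<Phi> * m) \<le> m * (8 * sqrt (real s) * lam)"
      by (simp add: power2_eq_square algebra_simps)
    then have "\<Phi> * m \<le> 8 * sqrt (real s) * lam" using RE(2) by simp
    then have "(\<Phi> * m)\<^sup>2 \<le> (8 * sqrt (real s) * lam)\<^sup>2"
      using Re(2) RE(2) by (intro power_mono) auto
    then have "m\<^sup>2 \<le> 64 * real s * lam\<^sup>2 / \<Phi>\<^sup>2"
      using Re(2) by (simp add: power_mult_distrib field_simps)
    then have "2 * m\<^sup>2 \<le> 128 * (real s / \<Phi>\<^sup>2) * lam\<^sup>2" by simp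
    with l2 show ?thesis by (simp add: \<delta>_def)
  qed
qed

text \<open>
  The objective is continuous and every candidate that beats \<open>\<beta>\<close> has its entries in
  \<open>[- \<parallel>\<beta>\<parallel>\<^sub>1, \<parallel>\<beta>\<parallel>\<^sub>1]\<close>.  Setting the irrelevant entries from \<open>p\<close> on to 0 makes
  the candidates a closed subset of a product of compact sets.
\<close>

lemma lp_solutions_nonempty:
  assumes feasible: "linf_norm p (\<lambda>i. mult_mat p B \<beta> i - g i) \<le> lam" and "0 < p"
  shows "lp_solutions p B g lam \<noteq> {}"
proof -
  define r where "r = l1_norm p \<beta>"
  define box where "box = (\<Pi>\<^sub>E i\<in>UNIV. if i < p then {- r..r} else {0::real})"
  define feas where "feas = (\<lambda>b. linf_norm p (\<lambda>i. mult_mat p B b i - g i) \<le> lam)"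
  define trunc where "trunc = (\<lambda>(b::nat \<Rightarrow> real) i. if i < p then b i else 0)"
  have feas_iff: "feas b \<longleftrightarrow> (\<forall>i<p. \<bar>mult_mat p B b i - g i\<bar> \<le> lam)" for b
    unfolding feas_def using linf_norm_le_iff[OF assms(2)] by simp
  have trunc: "l1_norm p (trunc b) = l1_norm p b" "feas (trunc b) = feas b" for b
    by (simp_all add: feas_iff l1_norm_def trunc_def mult_mat_def)
  have in_box: "trunc b \<in> box" if "l1_norm p b \<le> r" for b
  proof -
    have "\<bar>b i\<bar> \<le> r" if "i < p" for i
    proof -
      have "\<bar>b i\<bar> \<le> l1_norm p b"
        unfolding l1_norm_def using that by (intro member_le_sum) auto
      with \<open>l1_norm p b \<le> r\<close> show ?thesis by simp
    qed
    then show ?thesis by (force simp: box_def trunc_def abs_le_iff)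
  qed
  have "compactin (product_topology (\<lambda>_. euclidean) UNIV) box"
    unfolding box_def compactin_PiE by (auto simp: compactin_euclidean_iff)
  then have cbox: "compact box" by (simp add: euclidean_product_topology)
  have cont: "continuous_on UNIV (\<lambda>b::nat \<Rightarrow> real. b i)" for i
    by (rule continuous_on_product_coordinates)
  have cont_row: "continuous_on UNIV (\<lambda>b. \<bar>mult_mat p B b i - g i\<bar>)" for i
    unfolding mult_mat_def by (intro continuous_intros cont)
  have cont_l1: "continuous_on X (l1_norm p)" for X
    unfolding l1_norm_def by (intro continuous_intros continuous_on_subset[OF cont]) auto
  have "closed (\<Inter>i\<in>{..<p}. {b. \<bar>mult_mat p B b i - g i\<bar> \<le> lam})"
    by (intro closed_INT ballI closed_Collect_le cont_row continuous_intros)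
  also have "(\<Inter>i\<in>{..<p}. {b. \<bar>mult_mat p B b i - g i\<bar> \<le> lam}) = {b. feas b}"
    by (auto simp: feas_iff)
  finally have "compact (box \<inter> {b. feas b})" using cbox by (rule compact_Int_closed[rotated])
  moreover have "trunc \<beta> \<in> box \<inter> {b. feas b}"
    using in_box[of \<beta>] trunc(2)[of \<beta>] feasible by (simp add: feas_def r_def)
  ultimately obtain x where x: "x \<in> box" "feas x"
    and min: "\<And>y. y \<in> box \<Longrightarrow> feas y \<Longrightarrow> l1_norm p x \<le> l1_norm p y"
    using continuous_attains_inf[of "box \<inter> {b. feas b}" "l1_norm p"] cont_l1 by auto
  have "\<not> l1_norm p y < l1_norm p x" if "feas y" for y
  proof
    assume less: "l1_norm p y < l1_norm p x"
    have "l1_norm p x \<le> r"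
      using min[of "trunc \<beta>"] \<open>trunc \<beta> \<in> box \<inter> {b. feas b}\<close> trunc(1)[of \<beta>] by (simp add: r_def)
    with less have "trunc y \<in> box" by (intro in_box) simp
    with min[of "trunc y"] trunc[of y] that less show False by simp
  qed
  with x have "x \<in> lp_solutions p B g lam"
    unfolding lp_solutions_def is_arg_min_def feas_def by auto
  then show ?thesis by blast
qed

section \<open>Sub-Gaussian and sub-exponential variables\<close>

text \<open>
  The infimum that defines the norm need not be known to be attained: a bound by \<open>c\<close> says that
  every larger constant works.  In this form \<open>c = 0\<close> is harmless, which spares case distinctions when
  the noise or \<open>\<beta>\<close> vanishes.
\<close>

lemma psi2_norm_le_iff:
  assumes "0 \<le> c"
  shows "psi2_norm M Z \<le> ereal c \<longleftrightarrow>
    (\<forall>b>c. (\<integral>\<^sup>+\<omega>. ennreal (exp ((Z \<omega>)\<^sup>2 / b\<^sup>2)) \<partial>M) \<le> 2)"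
proof
  assume le: "psi2_norm M Z \<le> ereal c"
  show "\<forall>b>c. (\<integral>\<^sup>+\<omega>. ennreal (exp ((Z \<omega>)\<^sup>2 / b\<^sup>2)) \<partial>M) \<le> 2"
  proof (intro allI impI)
    fix b :: real assume "c < b"
    with le have "psi2_norm M Z < ereal b" by (metis le_less_trans less_ereal.simps(1))
    then obtain a where a: "0 < a" "(\<integral>\<^sup>+\<omega>. ennreal (exp ((Z \<omega>)\<^sup>2 / a\<^sup>2)) \<partial>M) \<le> 2" "a < b"
      by (auto simp: psi2_norm_def INF_less_iff)
    have "(Z \<omega>)\<^sup>2 / b\<^sup>2 \<le> (Z \<omega>)\<^sup>2 / a\<^sup>2" for \<omega>
      using a by (intro divide_left_mono power_mono) auto
    then have "(\<integral>\<^sup>+\<omega>. ennreal (exp ((Z \<omega>)\<^sup>2 / b\<^sup>2)) \<partial>M) \<le> (\<integral>\<^sup>+\<omega>. ennreal (exp ((Z \<omega>)\<^sup>2 / a\<^sup>2)) \<partial>M)"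
      by (intro nn_integral_mono ennreal_leI) simp
    with a(2) show "(\<integral>\<^sup>+\<omega>. ennreal (exp ((Z \<omega>)\<^sup>2 / b\<^sup>2)) \<partial>M) \<le> 2" by (rule order_trans[rotated])
  qed
next
  assume *: "\<forall>b>c. (\<integral>\<^sup>+\<omega>. ennreal (exp ((Z \<omega>)\<^sup>2 / b\<^sup>2)) \<partial>M) \<le> 2"
  show "psi2_norm M Z \<le> ereal c"
  proof (rule ereal_le_epsilon2)
    fix e :: real assume "0 < e"
    then have "c + e \<in> {b. 0 < b \<and> (\<integral>\<^sup>+\<omega>. ennreal (exp ((Z \<omega>)\<^sup>2 / b\<^sup>2)) \<partial>M) \<le> 2}"
      using *[rule_format, of "c + e"] assms by auto
    then have "psi2_norm M Z \<le> ereal (c + e)"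
      unfolding psi2_norm_def by (rule INF_lower)
    then show "psi2_norm M Z \<le> ereal c + ereal e" by simp
  qed
qed

lemma psi2_normD:
  assumes "psi2_norm M Z \<le> ereal c" "0 \<le> c" "c < b"
  shows "(\<integral>\<^sup>+\<omega>. ennreal (exp ((Z \<omega>)\<^sup>2 / b\<^sup>2)) \<partial>M) \<le> 2"
  using assms psi2_norm_le_iff by blast

lemma psi2_norm_mono: "psi2_norm M Z \<le> ereal a \<Longrightarrow> a \<le> b \<Longrightarrow> psi2_norm M Z \<le> ereal b"
  by (meson ereal_less_eq(3) order_trans)

lemma psi2_norm_zero:
  assumes "prob_space M"
  shows "psi2_norm M (\<lambda>_. 0) \<le> ereal 0"
  by (subst psi2_norm_le_iff) (auto simp: prob_space.emeasure_space_1[OF assms])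

lemma psi2_norm_scale:
  assumes "psi2_norm M Z \<le> ereal c" "0 \<le> c" "0 < a"
  shows "psi2_norm M (\<lambda>\<omega>. a * Z \<omega>) \<le> ereal (a * c)"
proof (subst psi2_norm_le_iff)
  show "0 \<le> a * c" using assms by simp
  show "\<forall>b>a * c. (\<integral>\<^sup>+\<omega>. ennreal (exp ((a * Z \<omega>)\<^sup>2 / b\<^sup>2)) \<partial>M) \<le> 2"
  proof (intro allI impI)
    fix b assume "a * c < b"
    then have "c < b / a" using assms by (simp add: pos_less_divide_eq mult.commute)
    from psi2_normD[OF assms(1,2) this]
    show "(\<integral>\<^sup>+\<omega>. ennreal (exp ((a * Z \<omega>)\<^sup>2 / b\<^sup>2)) \<partial>M) \<le> 2"
      by (simp add: power_divide power_mult_distrib mult.commute)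
  qed
qed

text \<open>
  Convexity of the exponential function turns a pointwise convex combination of exponents into the same
  combination of the integrals.
\<close>

lemma nn_integral_convex_le:
  assumes "U \<in> borel_measurable M" "V \<in> borel_measurable M" "0 \<le> \<theta>" "\<theta> \<le> 1"
    and "(\<integral>\<^sup>+\<omega>. ennreal (exp (U \<omega>)) \<partial>M) \<le> 2" "(\<integral>\<^sup>+\<omega>. ennreal (exp (V \<omega>)) \<partial>M) \<le> 2"
    and "\<And>\<omega>. W \<omega> \<le> \<theta> * U \<omega> + (1 - \<theta>) * V \<omega>"
  shows "(\<integral>\<^sup>+\<omega>. ennreal (exp (W \<omega>)) \<partial>M) \<le> 2"
proof -
  have "ennreal \<theta> + ennreal (1 - \<theta>) = ennreal (\<theta> + (1 - \<theta>))"
    using assms(3,4) by (intro ennreal_plus[symmetric]) linarith+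
  then have one: "ennreal \<theta> + ennreal (1 - \<theta>) = 1" by (simp only: add_diff_cancel_left' add_diff_eq ennreal_1)
  have "(\<integral>\<^sup>+\<omega>. ennreal (exp (W \<omega>)) \<partial>M) \<le>
      (\<integral>\<^sup>+\<omega>. ennreal \<theta> * ennreal (exp (U \<omega>)) + ennreal (1 - \<theta>) * ennreal (exp (V \<omega>)) \<partial>M)"
  proof (rule nn_integral_mono)
    fix \<omega>
    have "exp (W \<omega>) \<le> exp ((1 - (1 - \<theta>)) *\<^sub>R U \<omega> + (1 - \<theta>) *\<^sub>R V \<omega>)"
      using assms(7)[of \<omega>] by simp
    also have "\<dots> \<le> (1 - (1 - \<theta>)) * exp (U \<omega>) + (1 - \<theta>) * exp (V \<omega>)"
      using assms(3,4) by (intro convex_onD[OF exp_convex]) auto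
    finally show "ennreal (exp (W \<omega>)) \<le>
        ennreal \<theta> * ennreal (exp (U \<omega>)) + ennreal (1 - \<theta>) * ennreal (exp (V \<omega>))"
      using assms(3,4) by (simp add: ennreal_mult'[symmetric] ennreal_plus[symmetric] ennreal_leI
          del: ennreal_plus)
  qed
  also have "\<dots> = ennreal \<theta> * (\<integral>\<^sup>+\<omega>. ennreal (exp (U \<omega>)) \<partial>M) +
      ennreal (1 - \<theta>) * (\<integral>\<^sup>+\<omega>. ennreal (exp (V \<omega>)) \<partial>M)"
    using assms(1,2) by (simp add: nn_integral_add nn_integral_cmult)
  also have "\<dots> \<le> ennreal \<theta> * 2 + ennreal (1 - \<theta>) * 2"
    using assms by (intro add_mono mult_left_mono) auto
  also have "\<dots> = (ennreal \<theta> + ennreal (1 - \<theta>)) * 2" by (rule distrib_right[symmetric])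
  also have "\<dots> = 2" unfolding one by (rule mult_1)
  finally show ?thesis .
qed

text \<open>
  The difference of both sides is a multiple of \<open>(b x - a y)\<^sup>2\<close>.
\<close>

lemma square_sum_weighted:
  fixes x y a b :: real
  assumes "0 < a" "0 < b"
  shows "(x + y)\<^sup>2 / (a + b)\<^sup>2 \<le> a / (a + b) * (x\<^sup>2 / a\<^sup>2) + b / (a + b) * (y\<^sup>2 / b\<^sup>2)"
proof -
  have ab: "0 < a + b" using assms by simp
  have "(x + y)\<^sup>2 \<le> (x + y)\<^sup>2 + (b * x - a * y)\<^sup>2 / (a * b)" using assms by simp
  also have "\<dots> = (a + b) * (x\<^sup>2 / a + y\<^sup>2 / b)"
    using assms by (simp add: field_simps power2_eq_square)
  finally have "(x + y)\<^sup>2 / (a + b)\<^sup>2 \<le> (a + b) * (x\<^sup>2 / a + y\<^sup>2 / b) / (a + b)\<^sup>2"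
    by (rule divide_right_mono) simp
  also have "\<dots> = (x\<^sup>2 / a + y\<^sup>2 / b) / (a + b)" using ab by (simp add: power2_eq_square)
  also have "\<dots> = a / (a + b) * (x\<^sup>2 / a\<^sup>2) + b / (a + b) * (y\<^sup>2 / b\<^sup>2)"
    using assms by (simp add: add_divide_distrib power2_eq_square mult.commute)
  finally show ?thesis .
qed

text \<open>
  With the weights \<open>a / (a + c)\<close> and \<open>c / (a + c)\<close> the square of the normalised sum is
  at most the convex combination of the normalised squares.
\<close>

lemma psi2_norm_add:
  assumes [measurable]: "U \<in> borel_measurable M" "V \<in> borel_measurable M"
    and U: "psi2_norm M U \<le> ereal a" "0 \<le> a" and V: "psi2_norm M V \<le> ereal c" "0 \<le> c"
  shows "psi2_norm M (\<lambda>\<omega>. U \<omega> + V \<omega>) \<le> ereal (a + c)"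
proof (subst psi2_norm_le_iff)
  show "0 \<le> a + c" using assms by simp
  show "\<forall>b>a + c. (\<integral>\<^sup>+\<omega>. ennreal (exp ((U \<omega> + V \<omega>)\<^sup>2 / b\<^sup>2)) \<partial>M) \<le> 2"
  proof (intro allI impI)
    fix b assume b: "a + c < b"
    define a' c' where "a' = a + (b - (a + c)) / 2" and "c' = c + (b - (a + c)) / 2"
    have pos: "a < a'" "c < c'" using b by (simp_all add: a'_def c'_def)
    then have pos': "0 < a'" "0 < c'" using U(2) V(2) by linarith+
    have sum: "b = a' + c'" by (simp add: a'_def c'_def field_simps)
    define \<theta> where "\<theta> = a' / b"
    have \<theta>: "0 \<le> \<theta>" "\<theta> \<le> 1" "1 - \<theta> = c' / b"
      unfolding \<theta>_def sum using pos' by (simp_all add: field_simps)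
    have "(U \<omega> + V \<omega>)\<^sup>2 / b\<^sup>2 \<le> \<theta> * ((U \<omega>)\<^sup>2 / a'\<^sup>2) + (1 - \<theta>) * ((V \<omega>)\<^sup>2 / c'\<^sup>2)" for \<omega>
      unfolding \<theta>(3) unfolding \<theta>_def sum by (rule square_sum_weighted[OF pos'])
    then show "(\<integral>\<^sup>+\<omega>. ennreal (exp ((U \<omega> + V \<omega>)\<^sup>2 / b\<^sup>2)) \<partial>M) \<le> 2"
      by (rule nn_integral_convex_le[OF _ _ \<theta>(1,2) psi2_normD[OF U pos(1)] psi2_normD[OF V pos(2)],
            rotated 2]) measurable
  qed
qed

text \<open>
  The moment generating function of a centred normal variable, by completing the square.
\<close>

lemma nn_integral_normal_exp:
  fixes x \<tau> :: real
  assumes "0 < \<tau>"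
  shows "(\<integral>\<^sup>+g. ennreal (normal_density 0 \<tau> g) * ennreal (exp (x * g)) \<partial>lborel) = ennreal (exp (\<tau>\<^sup>2 * x\<^sup>2 / 2))"
proof -
  have "normal_density 0 \<tau> g * exp (x * g) = exp (\<tau>\<^sup>2 * x\<^sup>2 / 2) * normal_density (\<tau>\<^sup>2 * x) \<tau> g" for g
  proof -
    have "- g\<^sup>2 / (2 * \<tau>\<^sup>2) + x * g = \<tau>\<^sup>2 * x\<^sup>2 / 2 - (g - \<tau>\<^sup>2 * x)\<^sup>2 / (2 * \<tau>\<^sup>2)"
      using assms by (simp add: field_simps power2_eq_square)
    then show ?thesis
      by (simp add: normal_density_def exp_add[symmetric])
  qed
  then have "(\<integral>\<^sup>+g. ennreal (normal_density 0 \<tau> g) * ennreal (exp (x * g)) \<partial>lborel) =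
      (\<integral>\<^sup>+g. ennreal (exp (\<tau>\<^sup>2 * x\<^sup>2 / 2)) * ennreal (normal_density (\<tau>\<^sup>2 * x) \<tau> g) \<partial>lborel)"
    by (simp add: ennreal_mult'[symmetric])
  also have "\<dots> = ennreal (exp (\<tau>\<^sup>2 * x\<^sup>2 / 2)) * (\<integral>\<^sup>+g. ennreal (normal_density (\<tau>\<^sup>2 * x) \<tau> g) \<partial>lborel)"
    by (intro nn_integral_cmult) auto
  also have "(\<integral>\<^sup>+g. ennreal (normal_density (\<tau>\<^sup>2 * x) \<tau> g) \<partial>lborel) = 1"
    using prob_space.emeasure_space_1[OF prob_space_normal_density[OF assms, of "\<tau>\<^sup>2 * x"]]
    by (simp add: emeasure_density)
  finally show ?thesis by simp
qed

text \<open>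
  For a standard normal \<open>g\<close> independent of \<open>Z\<close>, integrating out \<open>g\<close> first gives
  \<open>E exp (Z\<^sup>2 / b\<^sup>2) = E exp (\<surd>2 g Z / b)\<close>, and integrating out \<open>Z\<close> first bounds this by
  \<open>E exp (\<sigma>\<^sup>2 g\<^sup>2 / b\<^sup>2) \<le> E exp (g\<^sup>2 / 4)\<close> for \<open>b \<ge> 2 \<sigma>\<close>.  That integral is
  bounded by comparing its integrand with twice a normal density of variance 4.
\<close>

lemma sub_Gaussian_psi2_norm:
  assumes "prob_space M" and [measurable]: "Z \<in> borel_measurable M"
    and "sub_Gaussian M Z \<sigma>" "0 \<le> \<sigma>"
  shows "psi2_norm M Z \<le> ereal (2 * \<sigma>)"
proof (subst psi2_norm_le_iff)
  show "0 \<le> 2 * \<sigma>" using assms by simp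
  show "\<forall>b>2 * \<sigma>. (\<integral>\<^sup>+\<omega>. ennreal (exp ((Z \<omega>)\<^sup>2 / b\<^sup>2)) \<partial>M) \<le> 2"
  proof (intro allI impI)
    fix b assume b: "2 * \<sigma> < b"
    interpret prob_space M by fact
    have b0: "0 < b" using b assms(4) by simp
    define n where "n = (\<lambda>g. ennreal (normal_density 0 1 g))"
    have [measurable]: "n \<in> borel_measurable borel" by (simp add: n_def)
    have "ennreal (exp ((Z \<omega>)\<^sup>2 / b\<^sup>2)) = (\<integral>\<^sup>+g. n g * ennreal (exp (sqrt 2 / b * Z \<omega> * g)) \<partial>lborel)" for \<omega>
      unfolding n_def nn_integral_normal_exp[OF zero_less_one]
      by (simp add: power_mult_distrib power_divide)
    then have "(\<integral>\<^sup>+\<omega>. ennreal (exp ((Z \<omega>)\<^sup>2 / b\<^sup>2)) \<partial>M) =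
        (\<integral>\<^sup>+\<omega>. (\<integral>\<^sup>+g. n g * ennreal (exp (sqrt 2 / b * Z \<omega> * g)) \<partial>lborel) \<partial>M)"
      by (simp only: )
    also have "\<dots> = (\<integral>\<^sup>+g. (\<integral>\<^sup>+\<omega>. n g * ennreal (exp (sqrt 2 / b * Z \<omega> * g)) \<partial>M) \<partial>lborel)"
    proof -
      interpret pair_sigma_finite M lborel ..
      show ?thesis by (rule Fubini'[symmetric]) measurable
    qed
    also have "\<dots> = (\<integral>\<^sup>+g. n g * (\<integral>\<^sup>+\<omega>. ennreal (exp ((sqrt 2 / b * g) * Z \<omega>)) \<partial>M) \<partial>lborel)"
      by (simp add: nn_integral_cmult mult_ac)
    also have "\<dots> \<le> (\<integral>\<^sup>+g. n g * ennreal (exp ((sqrt 2 / b * g)\<^sup>2 * \<sigma>\<^sup>2 / 2)) \<partial>lborel)"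
      using assms(3) by (intro nn_integral_mono mult_left_mono) (simp_all only: sub_Gaussian_def zero_le)
    also have "\<dots> \<le> (\<integral>\<^sup>+g. 2 * ennreal (normal_density 0 2 g) \<partial>lborel)"
    proof (rule nn_integral_mono)
      \<comment> \<open>The standard normal density times \<open>exp (g\<^sup>2 / 4)\<close> is at most twice the normal density of
        variance 4.\<close>
      fix g :: real
      have "\<sigma>\<^sup>2 \<le> (b / 2)\<^sup>2" using b assms(4) by (intro power_mono) auto
      then have "(sqrt 2 / b * g)\<^sup>2 * \<sigma>\<^sup>2 / 2 \<le> (sqrt 2 / b * g)\<^sup>2 * (b / 2)\<^sup>2 / 2"
        by (intro divide_right_mono mult_left_mono) auto
      also have "\<dots> = g\<^sup>2 / 4" using b0 by (simp add: power2_eq_square)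
      finally have "normal_density 0 1 g * exp ((sqrt 2 / b * g)\<^sup>2 * \<sigma>\<^sup>2 / 2) \<le>
          normal_density 0 1 g * exp (g\<^sup>2 / 4)"
        by (intro mult_left_mono) auto
      also have "\<dots> = exp (- g\<^sup>2 / 4) / sqrt (2 * pi)"
        by (simp add: normal_density_def exp_add[symmetric])
      also have "\<dots> \<le> exp (- g\<^sup>2 / 8) / sqrt (2 * pi)"
        by (intro divide_right_mono) auto
      also have "\<dots> = 2 * normal_density 0 2 g"
        using real_sqrt_mult[of "2 * pi" "2\<^sup>2"] by (simp add: normal_density_def mult.assoc)
      finally show "n g * ennreal (exp ((sqrt 2 / b * g)\<^sup>2 * \<sigma>\<^sup>2 / 2)) \<le> 2 * ennreal (normal_density 0 2 g)"
        unfolding n_def by (metis ennreal_leI ennreal_mult' ennreal_numeral exp_ge_zero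
            mult.commute normal_density_nonneg zero_le_numeral)
    qed
    also have "\<dots> = 2 * (\<integral>\<^sup>+g. ennreal (normal_density 0 2 g) * ennreal (exp (0 * g)) \<partial>lborel)"
      by (simp add: nn_integral_cmult)
    also have "\<dots> = 2" by (subst nn_integral_normal_exp) auto
    finally show "(\<integral>\<^sup>+\<omega>. ennreal (exp ((Z \<omega>)\<^sup>2 / b\<^sup>2)) \<partial>M) \<le> 2" .
  qed
qed

text \<open>
  A measurable variable with \<open>\<psi>\<^sub>1\<close> norm at most \<open>c\<close>, in the form of \<open>psi2_norm_le_iff\<close>, so that
  \<open>c = 0\<close> is allowed and means that the variable vanishes almost surely.
\<close>

definition sub_exponential :: "'a measure \<Rightarrow> ('a \<Rightarrow> real) \<Rightarrow> real \<Rightarrow> bool" where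
  "sub_exponential M W c \<longleftrightarrow>
     W \<in> borel_measurable M \<and> 0 \<le> c \<and> (\<forall>b>c. (\<integral>\<^sup>+\<omega>. ennreal (exp (\<bar>W \<omega>\<bar> / b)) \<partial>M) \<le> 2)"

lemma mult_le_mean_squares: "x * y \<le> (x\<^sup>2 + y\<^sup>2) / 2" for x y :: real
  using sum_squares_bound[of x y] by (simp add: mult.assoc)

text \<open>
  By the inequality between the arithmetic and the geometric mean the exponent \<open>\<bar>U V\<bar> / (a c)\<close> is at
  most the mean of \<open>U\<^sup>2 / a\<^sup>2\<close> and \<open>V\<^sup>2 / c\<^sup>2\<close>.
\<close>

lemma sub_exponential_mult:
  assumes [measurable]: "U \<in> borel_measurable M" "V \<in> borel_measurable M"
    and U: "psi2_norm M U \<le> ereal a" "0 \<le> a" and V: "psi2_norm M V \<le> ereal c" "0 \<le> c"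
  shows "sub_exponential M (\<lambda>\<omega>. U \<omega> * V \<omega>) (a * c)"
  unfolding sub_exponential_def
proof (intro conjI allI impI)
  fix b assume b: "a * c < b"
  \<comment> \<open>Small enough for \<open>(a + e) (c + e) \<le> b\<close>.\<close>
  define e where "e = min 1 ((b - a * c) / (a + c + 1))"
  have e: "0 < e" "e \<le> 1" "e * (a + c + 1) \<le> b - a * c"
    using b U(2) V(2) by (auto simp: e_def pos_le_divide_eq[symmetric])
  define a' c' where "a' = a + e" and "c' = c + e"
  have pos: "a < a'" "c < c'" "0 < a'" "0 < c'" using e U(2) V(2) by (auto simp: a'_def c'_def)
  have "a' * c' = a * c + e * (a + c) + e * e" by (simp add: a'_def c'_def algebra_simps)
  also have "\<dots> \<le> a * c + e * (a + c) + e * 1" using e by (intro add_left_mono mult_left_mono) auto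
  also have "\<dots> \<le> b" using e(3) by (simp add: algebra_simps)
  finally have "a' * c' \<le> b" .
  have "\<bar>U \<omega> * V \<omega>\<bar> / b \<le> 1/2 * ((U \<omega>)\<^sup>2 / a'\<^sup>2) + (1 - 1/2) * ((V \<omega>)\<^sup>2 / c'\<^sup>2)" for \<omega>
  proof -
    have "\<bar>U \<omega> * V \<omega>\<bar> / b \<le> \<bar>U \<omega> * V \<omega>\<bar> / (a' * c')"
      using pos \<open>a' * c' \<le> b\<close> by (intro divide_left_mono) (auto intro: mult_pos_pos less_le_trans)
    also have "\<dots> = \<bar>U \<omega>\<bar> / a' * (\<bar>V \<omega>\<bar> / c')" by (simp add: abs_mult)
    also have "\<dots> \<le> ((\<bar>U \<omega>\<bar> / a')\<^sup>2 + (\<bar>V \<omega>\<bar> / c')\<^sup>2) / 2"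
      by (rule mult_le_mean_squares)
    finally show ?thesis by (simp add: power_divide add_divide_distrib)
  qed
  then show "(\<integral>\<^sup>+\<omega>. ennreal (exp (\<bar>U \<omega> * V \<omega>\<bar> / b)) \<partial>M) \<le> 2"
    by (rule nn_integral_convex_le[OF _ _ _ _ psi2_normD[OF U pos(1)] psi2_normD[OF V pos(2)],
          rotated 4]) auto
qed (use U V in auto)

text \<open>
  Taylor expansion to second order; half of the exponent \<open>\<bar>w\<bar>\<close> absorbs the factor \<open>w\<^sup>2\<close> and the
  other half absorbs the exponential in the remainder.
\<close>

lemma exp_mult_le_quadratic:
  fixes t w :: real
  assumes "\<bar>t\<bar> \<le> 1/2"
  shows "exp (t * w) \<le> 1 + t * w + 4 * t\<^sup>2 * exp \<bar>w\<bar>"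
proof -
  define y where "y = t * w"
  have "exp y \<le> 1 + y + y\<^sup>2 / 2 * exp \<bar>y\<bar>"
  proof -
    obtain z where z: "\<bar>z\<bar> \<le> \<bar>y\<bar>" "exp y = (\<Sum>m<2. y ^ m / fact m) + exp z / fact 2 * y ^ 2"
      using Maclaurin_exp_le[of y 2] by blast
    have "exp z \<le> exp \<bar>y\<bar>" using z(1) by simp
    then have "exp z / 2 * y\<^sup>2 \<le> exp \<bar>y\<bar> / 2 * y\<^sup>2" by (intro mult_right_mono divide_right_mono) auto
    with z(2) show ?thesis by (simp add: numeral_2_eq_2 mult.commute)
  qed
  also have "y\<^sup>2 / 2 * exp \<bar>y\<bar> \<le> 4 * t\<^sup>2 * exp \<bar>w\<bar>"
  proof -
    have "(\<bar>w\<bar> / 2)\<^sup>2 / 2 \<le> exp (\<bar>w\<bar> / 2)"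
      using exp_lower_Taylor_quadratic[of "\<bar>w\<bar> / 2"] by simp
    then have w: "w\<^sup>2 / 2 \<le> 4 * exp (\<bar>w\<bar> / 2)" by (simp add: power_divide)
    have "\<bar>y\<bar> \<le> \<bar>w\<bar> / 2" using mult_right_mono[OF assms, of "\<bar>w\<bar>"] by (simp add: y_def abs_mult)
    then have "y\<^sup>2 / 2 * exp \<bar>y\<bar> \<le> y\<^sup>2 / 2 * exp (\<bar>w\<bar> / 2)" by (intro mult_left_mono) auto
    also have "\<dots> = t\<^sup>2 * (w\<^sup>2 / 2 * exp (\<bar>w\<bar> / 2))" by (simp add: y_def power_mult_distrib)
    also have "\<dots> \<le> t\<^sup>2 * (4 * exp (\<bar>w\<bar> / 2) * exp (\<bar>w\<bar> / 2))"
      using w by (intro mult_left_mono mult_right_mono) auto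
    also have "\<dots> = 4 * t\<^sup>2 * exp \<bar>w\<bar>" by (simp add: exp_add[symmetric])
    finally show ?thesis .
  qed
  finally show ?thesis by (simp add: y_def)
qed

text \<open>
  Integrating \<open>exp_mult_le_quadratic\<close> gives \<open>1 + t E W / b + 8 t\<^sup>2\<close>, which is at most
  \<open>exp (t E W / b + 8 t\<^sup>2)\<close>; the linear term disappears by centring.
\<close>

lemma sub_exponential_mgf:
  assumes "prob_space M" "sub_exponential M W c" "c < b" "\<bar>t\<bar> \<le> 1/2"
  shows "integrable M W"
    and "(\<integral>\<^sup>+\<omega>. ennreal (exp (t / b * (W \<omega> - (\<integral>\<omega>. W \<omega> \<partial>M)))) \<partial>M) \<le> ennreal (exp (8 * t\<^sup>2))"
proof -
  interpret prob_space M by fact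
  have [measurable]: "W \<in> borel_measurable M" and b: "0 < b"
    and le2: "(\<integral>\<^sup>+\<omega>. ennreal (exp (\<bar>W \<omega>\<bar> / b)) \<partial>M) \<le> 2"
    using assms(2,3) by (auto simp: sub_exponential_def)
  have int_exp: "integrable M (\<lambda>\<omega>. exp (\<bar>W \<omega>\<bar> / b))"
    using le2 by (intro integrableI_bounded) (auto intro: le_less_trans)
  have "(\<integral>\<^sup>+\<omega>. ennreal (exp (\<bar>W \<omega>\<bar> / b)) \<partial>M) = ennreal (expectation (\<lambda>\<omega>. exp (\<bar>W \<omega>\<bar> / b)))"
    using int_exp by (intro nn_integral_eq_integral) auto
  then have exp2: "expectation (\<lambda>\<omega>. exp (\<bar>W \<omega>\<bar> / b)) \<le> 2"
    using le2 by (metis ennreal_le_iff ennreal_numeral zero_le_numeral)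
  have int_Wb: "integrable M (\<lambda>\<omega>. W \<omega> / b)"
  proof (rule Bochner_Integration.integrable_bound[OF int_exp])
    show "AE \<omega> in M. norm (W \<omega> / b) \<le> norm (exp (\<bar>W \<omega>\<bar> / b))"
    proof (rule AE_I2)
      fix \<omega>
      have "norm (W \<omega> / b) = \<bar>W \<omega>\<bar> / b" using b by simp
      also have "\<dots> \<le> exp (\<bar>W \<omega>\<bar> / b)" using exp_ge_add_one_self[of "\<bar>W \<omega>\<bar> / b"] by linarith
      finally show "norm (W \<omega> / b) \<le> norm (exp (\<bar>W \<omega>\<bar> / b))" by simp
    qed
  qed simp
  then have "integrable M (\<lambda>\<omega>. b * (W \<omega> / b))" by (intro integrable_mult_right) auto
  then show int_W: "integrable M W" using b by simp
  define \<mu> where "\<mu> = (\<integral>\<omega>. W \<omega> \<partial>M)"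
  have bound: "exp (t / b * W \<omega>) \<le> 1 + t * (W \<omega> / b) + 4 * t\<^sup>2 * exp (\<bar>W \<omega>\<bar> / b)" for \<omega>
    using exp_mult_le_quadratic[OF assms(4), of "W \<omega> / b"] b by simp
  then have "(\<integral>\<^sup>+\<omega>. ennreal (exp (t / b * W \<omega>)) \<partial>M) \<le>
      (\<integral>\<^sup>+\<omega>. ennreal (1 + t * (W \<omega> / b) + 4 * t\<^sup>2 * exp (\<bar>W \<omega>\<bar> / b)) \<partial>M)"
    by (intro nn_integral_mono ennreal_leI) auto
  also have "\<dots> = ennreal (expectation (\<lambda>\<omega>. 1 + t * (W \<omega> / b) + 4 * t\<^sup>2 * exp (\<bar>W \<omega>\<bar> / b)))"
  proof (rule nn_integral_eq_integral)
    show "integrable M (\<lambda>\<omega>. 1 + t * (W \<omega> / b) + 4 * t\<^sup>2 * exp (\<bar>W \<omega>\<bar> / b))"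
      by (rule Bochner_Integration.integrable_add[OF Bochner_Integration.integrable_add
            [OF integrable_const integrable_mult_right[OF int_Wb]] integrable_mult_right[OF int_exp]])
    show "AE \<omega> in M. 0 \<le> 1 + t * (W \<omega> / b) + 4 * t\<^sup>2 * exp (\<bar>W \<omega>\<bar> / b)"
      by (intro AE_I2 order_trans[OF exp_ge_zero bound])
  qed
  also have "expectation (\<lambda>\<omega>. 1 + t * (W \<omega> / b) + 4 * t\<^sup>2 * exp (\<bar>W \<omega>\<bar> / b)) =
      1 + t * (\<mu> / b) + 4 * t\<^sup>2 * expectation (\<lambda>\<omega>. exp (\<bar>W \<omega>\<bar> / b))"
    using int_W int_exp by (simp add: \<mu>_def prob_space)
  also have "ennreal \<dots> \<le> ennreal (exp (t / b * \<mu> + 8 * t\<^sup>2))"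
  proof (rule ennreal_leI)
    have "4 * t\<^sup>2 * expectation (\<lambda>\<omega>. exp (\<bar>W \<omega>\<bar> / b)) \<le> 4 * t\<^sup>2 * 2"
      using exp2 by (intro mult_left_mono) auto
    then show "1 + t * (\<mu> / b) + 4 * t\<^sup>2 * expectation (\<lambda>\<omega>. exp (\<bar>W \<omega>\<bar> / b)) \<le> exp (t / b * \<mu> + 8 * t\<^sup>2)"
      using exp_ge_add_one_self[of "t / b * \<mu> + 8 * t\<^sup>2"] by (simp only: times_divide_eq_left times_divide_eq_right)
  qed
  finally have main: "(\<integral>\<^sup>+\<omega>. ennreal (exp (t / b * W \<omega>)) \<partial>M) \<le> ennreal (exp (t / b * \<mu> + 8 * t\<^sup>2))" .
  have "exp (t / b * (W \<omega> - \<mu>)) = exp (- (t / b * \<mu>)) * exp (t / b * W \<omega>)" for \<omega>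
    by (simp add: exp_add[symmetric] right_diff_distrib)
  then have "(\<integral>\<^sup>+\<omega>. ennreal (exp (t / b * (W \<omega> - \<mu>))) \<partial>M) =
      ennreal (exp (- (t / b * \<mu>))) * (\<integral>\<^sup>+\<omega>. ennreal (exp (t / b * W \<omega>)) \<partial>M)"
    by (simp add: ennreal_mult' nn_integral_cmult)
  also have "\<dots> \<le> ennreal (exp (- (t / b * \<mu>))) * ennreal (exp (t / b * \<mu> + 8 * t\<^sup>2))"
    by (intro mult_left_mono main) auto
  also have "\<dots> = ennreal (exp (8 * t\<^sup>2))" by (simp add: ennreal_mult'[symmetric] exp_add[symmetric])
  finally show "(\<integral>\<^sup>+\<omega>. ennreal (exp (t / b * (W \<omega> - (\<integral>\<omega>. W \<omega> \<partial>M)))) \<partial>M) \<le> ennreal (exp (8 * t\<^sup>2))"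
    by (simp add: \<mu>_def)
qed

corollary sub_exponential_integrable:
  "prob_space M \<Longrightarrow> sub_exponential M W c \<Longrightarrow> integrable M W"
  by (rule sub_exponential_mgf(1)[where b = "c + 1" and t = 0]) auto

section \<open>Bernstein's inequality for two independent samples\<close>

lemma with_prob_at_least_mono:
  assumes "with_prob_at_least M q Q" "q' \<le> q" "\<And>\<omega>. \<omega> \<in> space M \<Longrightarrow> Q \<omega> \<Longrightarrow> Q' \<omega>"
  shows "with_prob_at_least M q' Q'"
  using assms unfolding with_prob_at_least_def
  by (meson order_trans sets.sets_into_space subsetD)

text \<open>
  The union bound, for events that contain measurable sets of large probability.
\<close>

lemma with_prob_at_least_ball:
  assumes "prob_space M" "finite T"
    and "\<And>i. i \<in> T \<Longrightarrow> with_prob_at_least M (1 - q i) (Q i)"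
  shows "with_prob_at_least M (1 - (\<Sum>i\<in>T. q i)) (\<lambda>\<omega>. \<forall>i\<in>T. Q i \<omega>)"
proof -
  interpret prob_space M by fact
  obtain E where E: "\<And>i. i \<in> T \<Longrightarrow> E i \<in> sets M" "\<And>i. i \<in> T \<Longrightarrow> 1 - q i \<le> prob (E i)"
    "\<And>i \<omega>. i \<in> T \<Longrightarrow> \<omega> \<in> E i \<Longrightarrow> Q i \<omega>"
    using assms(3) unfolding with_prob_at_least_def by metis
  define B where "B = (\<Union>i\<in>T. space M - E i)"
  have B: "B \<in> sets M" unfolding B_def using E(1) assms(2) by (intro sets.finite_UN sets.compl_sets) auto
  have "prob B \<le> (\<Sum>i\<in>T. prob (space M - E i))"
    unfolding B_def using E(1) assms(2) by (intro finite_measure_subadditive_finite) auto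
  also have "\<dots> \<le> (\<Sum>i\<in>T. q i)"
  proof (rule sum_mono)
    fix i assume "i \<in> T"
    then show "prob (space M - E i) \<le> q i" using E(1,2)[of i] by (simp add: prob_compl)
  qed
  finally have "1 - (\<Sum>i\<in>T. q i) \<le> prob (space M - B)" using B by (simp add: prob_compl)
  moreover have "\<forall>\<omega>\<in>space M - B. \<forall>i\<in>T. Q i \<omega>" using E(3) by (auto simp: B_def)
  ultimately show ?thesis unfolding with_prob_at_least_def using B by (intro bexI[of _ "space M - B"]) auto
qed

lemma with_prob_at_least_conj:
  assumes "prob_space M" "with_prob_at_least M (1 - q) Q" "with_prob_at_least M (1 - q') Q'"
  shows "with_prob_at_least M (1 - (q + q')) (\<lambda>\<omega>. Q \<omega> \<and> Q' \<omega>)"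
proof -
  have "with_prob_at_least M (1 - (\<Sum>b\<in>UNIV. if b then q else q'))
      (\<lambda>\<omega>. \<forall>b\<in>UNIV. if b then Q \<omega> else Q' \<omega>)"
    using assms(2,3) by (intro with_prob_at_least_ball assms(1)) (auto split: if_splits)
  then show ?thesis
  proof (rule with_prob_at_least_mono)
    show "1 - (q + q') \<le> 1 - (\<Sum>b\<in>UNIV. if b then q else q')" by (simp add: UNIV_bool)
    fix \<omega> assume "\<forall>b\<in>UNIV. if b then Q \<omega> else Q' \<omega>"
    from this[rule_format, of True] this[rule_format, of False] show "Q \<omega> \<and> Q' \<omega>" by simp
  qed
qed

text \<open>
  Fubini: the exponential of the sum factorises over the coordinates.
\<close>

lemma nn_integral_PiM_prod_exp_le:
  assumes "finite I" "\<And>i. i \<in> I \<Longrightarrow> prob_space (M i)" "I' \<subseteq> I"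
    and "\<And>i. i \<in> I' \<Longrightarrow> f i \<in> borel_measurable (M i)"
    and "\<And>i. i \<in> I' \<Longrightarrow> (\<integral>\<^sup>+x. ennreal (exp (f i x)) \<partial>M i) \<le> ennreal (exp q)"
  shows "(\<integral>\<^sup>+x. ennreal (exp (\<Sum>i\<in>I'. f i (x i))) \<partial>PiM I M) \<le> ennreal (exp (real (card I') * q))"
proof -
  \<comment> \<open>Outside \<open>I\<close> any probability space will do, as the product does not see it.\<close>
  define M' where "M' i = (if i \<in> I then M i else return (count_space UNIV) undefined)" for i
  have ps: "prob_space (M' i)" for i
    using assms(2) by (auto simp: M'_def intro: prob_space_return)
  interpret product_prob_space M'
    using ps by (auto simp: product_prob_space_def product_prob_space_axioms_def product_sigma_finite_def
        prob_space_imp_sigma_finite)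
  define F where "F i x = (if i \<in> I' then ennreal (exp (f i x)) else 1)" for i x
  have finI': "finite I'" using assms(1,3) finite_subset by blast
  have PiM: "PiM I M = PiM I M'" by (intro PiM_cong) (auto simp: M'_def)
  have "ennreal (exp (\<Sum>i\<in>I'. f i (x i))) = (\<Prod>i\<in>I. F i (x i))" for x
  proof -
    have "ennreal (exp (\<Sum>i\<in>I'. f i (x i))) = (\<Prod>i\<in>I'. ennreal (exp (f i (x i))))"
      using finI' by (simp add: exp_sum prod_ennreal)
    also have "\<dots> = (\<Prod>i\<in>I. F i (x i))"
      using assms(1,3) by (intro prod.mono_neutral_cong_left) (auto simp: F_def)
    finally show ?thesis .
  qed
  then have "(\<integral>\<^sup>+x. ennreal (exp (\<Sum>i\<in>I'. f i (x i))) \<partial>PiM I M) = (\<integral>\<^sup>+x. (\<Prod>i\<in>I. F i (x i)) \<partial>PiM I M')"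
    by (simp add: PiM)
  also have "\<dots> = (\<Prod>i\<in>I. \<integral>\<^sup>+x. F i x \<partial>M' i)"
  proof (rule product_nn_integral_prod[OF assms(1)])
    fix i assume "i \<in> I"
    then show "F i \<in> borel_measurable (M' i)"
      using assms(4)[of i] by (cases "i \<in> I'") (auto simp: F_def[abs_def] M'_def)
  qed
  also have "\<dots> \<le> (\<Prod>i\<in>I. if i \<in> I' then ennreal (exp q) else 1)"
  proof (rule prod_mono_ennreal)
    fix i assume i: "i \<in> I"
    show "(\<integral>\<^sup>+x. F i x \<partial>M' i) \<le> (if i \<in> I' then ennreal (exp q) else 1)"
      using assms(5)[of i] i prob_space.emeasure_space_1[OF ps[of i]]
      by (cases "i \<in> I'") (auto simp: F_def M'_def)
  qed
  also have "\<dots> = (\<Prod>i\<in>I'. ennreal (exp q))"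
    using assms(1,3) by (intro prod.mono_neutral_cong_right) auto
  also have "\<dots> = ennreal (exp (real (card I') * q))"
    by (simp add: ennreal_power exp_of_nat_mult)
  finally show ?thesis .
qed

text \<open>
  Markov's inequality for the exponential of the sum, which factorises over both samples and over the
  observations in each of them.
\<close>

lemma two_sample_chernoff:
  assumes I: "finite I" "\<And>i. i \<in> I \<Longrightarrow> prob_space (M i)" "I' \<subseteq> I"
    and f: "\<And>i. i \<in> I' \<Longrightarrow> f i \<in> borel_measurable (M i)"
      "\<And>i. i \<in> I' \<Longrightarrow> (\<integral>\<^sup>+x. ennreal (exp (f i x)) \<partial>M i) \<le> ennreal (exp q)"
    and J: "finite J" "\<And>j. j \<in> J \<Longrightarrow> prob_space (N j)" "J' \<subseteq> J"
    and g: "\<And>j. j \<in> J' \<Longrightarrow> g j \<in> borel_measurable (N j)"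
      "\<And>j. j \<in> J' \<Longrightarrow> (\<integral>\<^sup>+x. ennreal (exp (g j x)) \<partial>N j) \<le> ennreal (exp q)"
  defines "D \<equiv> PiM I M \<Otimes>\<^sub>M PiM J N"
  shows "emeasure D {\<omega>\<in>space D. a \<le> (\<Sum>i\<in>I'. f i (fst \<omega> i)) + (\<Sum>j\<in>J'. g j (snd \<omega> j))}
    \<le> ennreal (exp (real (card I' + card J') * q - a))"
proof -
  have "prob_space (PiM I M)" "prob_space (PiM J N)" using I J by (auto intro: prob_space_PiM)
  then interpret A: prob_space "PiM I M" + B: prob_space "PiM J N" .
  define F G where "F x = ennreal (exp (\<Sum>i\<in>I'. f i (x i)))"
    and "G y = ennreal (exp (\<Sum>j\<in>J'. g j (y j)))" for x y
  have fm [measurable]: "(\<lambda>x. f i (x i)) \<in> borel_measurable (PiM I M)" if "i \<in> I'" for i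
    using f(1)[OF that] I(3) that by (auto intro!: measurable_compose[OF measurable_component_singleton])
  have gm [measurable]: "(\<lambda>y. g j (y j)) \<in> borel_measurable (PiM J N)" if "j \<in> J'" for j
    using g(1)[OF that] J(3) that by (auto intro!: measurable_compose[OF measurable_component_singleton])
  have [measurable]: "F \<in> borel_measurable (PiM I M)" "G \<in> borel_measurable (PiM J N)"
    unfolding F_def[abs_def] G_def[abs_def] by measurable
  define u where "u \<omega> = F (fst \<omega>) * G (snd \<omega>)" for \<omega>
  have [measurable]: "u \<in> borel_measurable D" unfolding u_def[abs_def] D_def by measurable
  have u: "u \<omega> = ennreal (exp ((\<Sum>i\<in>I'. f i (fst \<omega> i)) + (\<Sum>j\<in>J'. g j (snd \<omega> j))))" for \<omega>
    by (simp add: u_def F_def G_def exp_add ennreal_mult')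
  have "{\<omega>\<in>space D. a \<le> (\<Sum>i\<in>I'. f i (fst \<omega> i)) + (\<Sum>j\<in>J'. g j (snd \<omega> j))} =
      {\<omega>\<in>space D. 1 \<le> ennreal (exp (- a)) * u \<omega>}"
    by (auto simp: u ennreal_mult'[symmetric] exp_add[symmetric])
  also have "emeasure D \<dots> \<le> ennreal (exp (- a)) * (\<integral>\<^sup>+\<omega>. u \<omega> * indicator (space D) \<omega> \<partial>D)"
    using nn_integral_Markov_inequality[of u "space D" D "ennreal (exp (- a))"] by (simp add: Int_def)
  also have "(\<integral>\<^sup>+\<omega>. u \<omega> * indicator (space D) \<omega> \<partial>D) = (\<integral>\<^sup>+\<omega>. u \<omega> \<partial>D)"
    by (intro nn_integral_cong) simp
  also have "\<dots> = (\<integral>\<^sup>+x. F x \<partial>PiM I M) * (\<integral>\<^sup>+y. G y \<partial>PiM J N)"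
    unfolding D_def u_def
    by (simp add: B.nn_integral_fst[symmetric] nn_integral_cmult nn_integral_multc)
  also have "\<dots> \<le> ennreal (exp (real (card I') * q)) * ennreal (exp (real (card J') * q))"
    unfolding F_def G_def using assms by (intro mult_mono nn_integral_PiM_prod_exp_le) auto
  also have "ennreal (exp (- a)) * \<dots> = ennreal (exp (real (card I' + card J') * q - a))"
    by (simp add: ennreal_mult'[symmetric] exp_add[symmetric] algebra_simps)
  finally show ?thesis by (simp add: mult_left_mono)
qed

text \<open>
  For \<open>b > c\<close> the Chernoff bound with \<open>t = x / 16\<close> gives the exponent
  \<open>8 n t\<^sup>2 - n t x = - n x\<^sup>2 / 32\<close>; the condition \<open>x \<le> 8\<close> is \<open>t \<le> 1/2\<close>.  The bound does
  not depend on \<open>b\<close>, so that it passes to the limit \<open>b \<longrightarrow> c\<close>, also for \<open>c = 0\<close>.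
\<close>

lemma two_sample_bernstein:
  assumes P: "prob_space P" and W: "sub_exponential P W c"
    and I: "finite I" "\<And>i. i \<in> I \<Longrightarrow> prob_space (M i)" "I' \<subseteq> I"
    and f: "\<And>i. i \<in> I' \<Longrightarrow> f i \<in> borel_measurable (M i)"
      "\<And>i. i \<in> I' \<Longrightarrow> distr (M i) borel (f i) = distr P borel W"
    and J: "finite J" "\<And>j. j \<in> J \<Longrightarrow> prob_space (N j)" "J' \<subseteq> J"
    and g: "\<And>j. j \<in> J' \<Longrightarrow> g j \<in> borel_measurable (N j)"
      "\<And>j. j \<in> J' \<Longrightarrow> distr (N j) borel (g j) = distr P borel W"
    and x: "0 < x" "x \<le> 8"
    and n: "n = card I' + card J'"
  defines "D \<equiv> PiM I M \<Otimes>\<^sub>M PiM J N"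
  shows "with_prob_at_least D (1 - 2 * exp (- (real n * x\<^sup>2 / 32)))
    (\<lambda>\<omega>. \<bar>(\<Sum>i\<in>I'. f i (fst \<omega> i)) + (\<Sum>j\<in>J'. g j (snd \<omega> j)) - real n * (\<integral>\<omega>. W \<omega> \<partial>P)\<bar> \<le> real n * (c * x))"
proof -
  have "prob_space (PiM I M)" "prob_space (PiM J N)" using I J by (auto intro: prob_space_PiM)
  then interpret D: prob_space D unfolding D_def by (intro prob_space_pair)
  have Wm [measurable]: "W \<in> borel_measurable P" using W by (simp add: sub_exponential_def)
  define \<mu> where "\<mu> = (\<integral>\<omega>. W \<omega> \<partial>P)"
  define S where "S = (\<lambda>\<omega>. (\<Sum>i\<in>I'. f i (fst \<omega> i)) + (\<Sum>j\<in>J'. g j (snd \<omega> j)) - real n * \<mu>)"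
  have "(\<lambda>\<omega>. f i (fst \<omega> i)) \<in> borel_measurable D" if "i \<in> I'" for i
  proof -
    have "i \<in> I" using that I(3) by auto
    then have "(\<lambda>\<omega>. fst \<omega> i) \<in> D \<rightarrow>\<^sub>M M i" unfolding D_def by measurable
    from measurable_compose[OF this f(1)[OF that]] show ?thesis .
  qed
  moreover have "(\<lambda>\<omega>. g j (snd \<omega> j)) \<in> borel_measurable D" if "j \<in> J'" for j
  proof -
    have "j \<in> J" using that J(3) by auto
    then have "(\<lambda>\<omega>. snd \<omega> j) \<in> D \<rightarrow>\<^sub>M N j" unfolding D_def by measurable
    from measurable_compose[OF this g(1)[OF that]] show ?thesis .
  qed
  ultimately have [measurable]: "S \<in> borel_measurable D" unfolding S_def by measurable
  have law: "(\<integral>\<^sup>+x. ennreal (exp (h x)) \<partial>M1) = (\<integral>\<^sup>+\<omega>. ennreal (exp (t * (W \<omega> - \<mu>))) \<partial>P)"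
    if h: "h = (\<lambda>x. t * (k x - \<mu>))" and k: "k \<in> borel_measurable M1" and eq: "distr M1 borel k = distr P borel W"
    for h k t and M1 :: "'z measure"
  proof -
    have "(\<integral>\<^sup>+x. ennreal (exp (h x)) \<partial>M1) = (\<integral>\<^sup>+r. ennreal (exp (t * (r - \<mu>))) \<partial>distr M1 borel k)"
      unfolding h using k by (subst nn_integral_distr) auto
    also have "\<dots> = (\<integral>\<^sup>+\<omega>. ennreal (exp (t * (W \<omega> - \<mu>))) \<partial>P)"
      unfolding eq by (subst nn_integral_distr) auto
    finally show ?thesis .
  qed
  have tail: "emeasure D {\<omega>\<in>space D. real n * (b * x) \<le> r * S \<omega>} \<le> ennreal (exp (- (real n * x\<^sup>2 / 32)))"
    if b: "c < b" and r: "\<bar>r\<bar> = 1" for b r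
  proof -
    have b0: "0 < b" using W b by (simp add: sub_exponential_def)
    define t where "t = r * x / 16"
    have t: "\<bar>t\<bar> \<le> 1/2" using x r by (simp add: t_def abs_mult)
    have t2: "t\<^sup>2 = x\<^sup>2 / 256"
      using r by (simp add: t_def power_divide power_mult_distrib abs_square_eq_1)
    have mgf: "(\<integral>\<^sup>+\<omega>. ennreal (exp (t / b * (W \<omega> - \<mu>))) \<partial>P) \<le> ennreal (exp (8 * t\<^sup>2))"
      unfolding \<mu>_def by (rule sub_exponential_mgf(2)[OF P W b t])
    have S_eq: "t / b * S \<omega> = (\<Sum>i\<in>I'. t / b * (f i (fst \<omega> i) - \<mu>)) + (\<Sum>j\<in>J'. t / b * (g j (snd \<omega> j) - \<mu>))" for \<omega>
    proof -
      have "S \<omega> = (\<Sum>i\<in>I'. f i (fst \<omega> i) - \<mu>) + (\<Sum>j\<in>J'. g j (snd \<omega> j) - \<mu>)"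
        by (simp add: S_def n sum_subtractf algebra_simps)
      then show ?thesis by (simp only: sum_distrib_left[symmetric] distrib_left)
    qed
    have fm: "(\<lambda>y. t / b * (f i y - \<mu>)) \<in> borel_measurable (M i)" if "i \<in> I'" for i
      using f(1)[OF that] by measurable
    have gm: "(\<lambda>y. t / b * (g j y - \<mu>)) \<in> borel_measurable (N j)" if "j \<in> J'" for j
      using g(1)[OF that] by measurable
    have fl: "(\<integral>\<^sup>+y. ennreal (exp (t / b * (f i y - \<mu>))) \<partial>M i) \<le> ennreal (exp (8 * t\<^sup>2))" if "i \<in> I'" for i
      unfolding law[OF refl f[OF that]] by (rule mgf)
    have gl: "(\<integral>\<^sup>+y. ennreal (exp (t / b * (g j y - \<mu>))) \<partial>N j) \<le> ennreal (exp (8 * t\<^sup>2))" if "j \<in> J'" for j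
      unfolding law[OF refl g[OF that]] by (rule mgf)
    have "{\<omega>\<in>space D. real n * (b * x) \<le> r * S \<omega>} = {\<omega>\<in>space D. real n * (x * (x / 16)) \<le> t / b * S \<omega>}"
    proof (intro Collect_cong conj_cong refl)
      fix \<omega>
      have "real n * (b * x) \<le> r * S \<omega> \<longleftrightarrow> (x / (16 * b)) * (real n * (b * x)) \<le> (x / (16 * b)) * (r * S \<omega>)"
        using x(1) b0 by (subst mult_le_cancel_left_pos) auto
      then show "real n * (b * x) \<le> r * S \<omega> \<longleftrightarrow> real n * (x * (x / 16)) \<le> t / b * S \<omega>"
        using b0 by (simp add: t_def mult_ac)
    qed
    also have "emeasure D \<dots> \<le> ennreal (exp (real (card I' + card J') * (8 * t\<^sup>2) - real n * (x * (x / 16))))"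
      unfolding S_eq D_def
      by (rule two_sample_chernoff[OF I fm fl J gm gl])
    also have "\<dots> = ennreal (exp (- (real n * x\<^sup>2 / 32)))"
      unfolding t2 n by (simp add: field_simps power2_eq_square)
    finally show ?thesis .
  qed
  \<comment> \<open>The failure events for \<open>b\<close> decreasing to \<open>c\<close> increase to the one for \<open>c\<close>.\<close>
  define B where "B k = {\<omega>\<in>space D. real n * ((c + inverse (real (Suc k))) * x) \<le> \<bar>S \<omega>\<bar>}" for k
  have Bm: "B k \<in> sets D" for k unfolding B_def by measurable
  have B_le: "emeasure D (B k) \<le> ennreal (2 * exp (- (real n * x\<^sup>2 / 32)))" for k
  proof -
    define b where "b = c + inverse (real (Suc k))"
    have b: "c < b" by (simp add: b_def)
    have "B k \<subseteq> {\<omega>\<in>space D. real n * (b * x) \<le> 1 * S \<omega>} \<union> {\<omega>\<in>space D. real n * (b * x) \<le> - 1 * S \<omega>}"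
      by (auto simp: B_def b_def)
    then have "emeasure D (B k) \<le> emeasure D {\<omega>\<in>space D. real n * (b * x) \<le> 1 * S \<omega>} +
        emeasure D {\<omega>\<in>space D. real n * (b * x) \<le> - 1 * S \<omega>}"
      by (intro order_trans[OF emeasure_mono emeasure_subadditive]) auto
    also have "\<dots> \<le> ennreal (exp (- (real n * x\<^sup>2 / 32))) + ennreal (exp (- (real n * x\<^sup>2 / 32)))"
      using tail[OF b, of 1] tail[OF b, of "-1"] by (intro add_mono) simp_all
    finally show ?thesis by (simp add: ennreal_plus[symmetric] del: ennreal_plus)
  qed
  have "incseq B"
  proof (rule incseq_SucI)
    fix k
    have "inverse (real (Suc (Suc k))) \<le> inverse (real (Suc k))" by (simp add: field_simps)
    then have "real n * ((c + inverse (real (Suc (Suc k)))) * x) \<le> real n * ((c + inverse (real (Suc k))) * x)"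
      using x(1) by (intro mult_left_mono mult_right_mono) auto
    then show "B k \<subseteq> B (Suc k)" unfolding B_def by auto
  qed
  then have "emeasure D (\<Union>k. B k) = (SUP k. emeasure D (B k))"
    using Bm by (intro SUP_emeasure_incseq[symmetric]) auto
  also have "\<dots> \<le> ennreal (2 * exp (- (real n * x\<^sup>2 / 32)))" by (intro SUP_least B_le)
  finally have "measure D (\<Union>k. B k) \<le> 2 * exp (- (real n * x\<^sup>2 / 32))"
    by (simp add: D.emeasure_eq_measure)
  moreover have BU: "(\<Union>k. B k) \<in> sets D" using Bm by auto
  moreover have "\<bar>S \<omega>\<bar> \<le> real n * (c * x)" if "\<omega> \<in> space D - (\<Union>k. B k)" for \<omega>
  proof (rule field_le_epsilon)
    fix e :: real assume e: "0 < e"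
    have "(\<lambda>k. real n * ((c + inverse (real (Suc k))) * x)) \<longlonglongrightarrow> real n * ((c + 0) * x)"
      by (intro tendsto_intros LIMSEQ_inverse_real_of_nat)
    then have "\<forall>\<^sub>F k in sequentially. real n * ((c + inverse (real (Suc k))) * x) < real n * (c * x) + e"
      using e by (intro order_tendstoD(2)[where y = "real n * ((c + 0) * x)"]) auto
    then obtain k where "real n * ((c + inverse (real (Suc k))) * x) < real n * (c * x) + e"
      by (auto simp: eventually_sequentially)
    moreover have "\<bar>S \<omega>\<bar> < real n * ((c + inverse (real (Suc k))) * x)"
    proof -
      have "\<omega> \<in> space D" "\<omega> \<notin> B k" using that by auto
      then show ?thesis by (simp add: B_def not_le del: of_nat_Suc)
    qed
    ultimately show "\<bar>S \<omega>\<bar> \<le> real n * (c * x) + e" by linarith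
  qed
  ultimately show ?thesis
    unfolding with_prob_at_least_def
    by (intro bexI[of _ "space D - (\<Union>k. B k)"]) (auto simp: D.prob_compl S_def \<mu>_def)
qed

section \<open>The data model\<close>

lemma linear_model_measurable:
  assumes "linear_model p P \<sigma>"
  shows "j < p \<Longrightarrow> (\<lambda>\<omega>. fst \<omega> j) \<in> borel_measurable P"
    and "snd \<in> borel_measurable P"
    and "(\<lambda>\<omega>. dot p v (fst \<omega>)) \<in> borel_measurable P"
proof -
  have sets: "sets P = sets (Rvec {..<p} \<Otimes>\<^sub>M borel)" using assms by (simp add: linear_model_def)
  have eq: "borel_measurable P = borel_measurable (Rvec {..<p} \<Otimes>\<^sub>M borel)"
    by (rule measurable_cong_sets[OF sets refl])
  show X: "(\<lambda>\<omega>. fst \<omega> j) \<in> borel_measurable P" if "j < p" for j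
  proof -
    have "j \<in> {..<p}" using that by simp
    then show ?thesis unfolding eq by measurable
  qed
  show "snd \<in> borel_measurable P" unfolding eq by measurable
  show "(\<lambda>\<omega>. dot p v (fst \<omega>)) \<in> borel_measurable P"
    unfolding dot_def using X by measurable
qed

lemma psi2_norm_dot:
  assumes "prob_space P" "psi2_norm_vec p P X \<le> ereal R" "0 \<le> R"
  shows "psi2_norm P (\<lambda>\<omega>. dot p v (X \<omega>)) \<le> ereal (R * l2_norm p v)"
proof (cases "l2_norm p v = 0")
  case True
  then have "dot p v (X \<omega>) = 0" for \<omega> by (simp add: dot_def L2_set_eq_0_iff)
  then show ?thesis using psi2_norm_zero[OF assms(1)] True by simp
next
  case False
  then have pos: "0 < l2_norm p v" by (simp add: less_le)
  define u where "u i = v i / l2_norm p v" for i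
  have "l2_norm p u = l2_norm p v / l2_norm p v"
    unfolding u_def using L2_set_left_distrib[of "1 / l2_norm p v" v "{..<p}"] pos by simp
  then have "l2_norm p u = 1" using pos by simp
  then have "psi2_norm P (\<lambda>\<omega>. dot p u (X \<omega>)) \<le> ereal R"
    using assms(2) unfolding psi2_norm_vec_def by (auto simp: SUP_le_iff)
  from psi2_norm_scale[OF this assms(3) pos]
  have "psi2_norm P (\<lambda>\<omega>. l2_norm p v * dot p u (X \<omega>)) \<le> ereal (l2_norm p v * R)" .
  moreover have "l2_norm p v * dot p u x = dot p v x" for x
    using pos by (simp add: dot_def u_def sum_distrib_left)
  ultimately show ?thesis by (simp add: mult.commute)
qed

lemma psi2_norm_coordinate:
  assumes "prob_space P" "psi2_norm_vec p P X \<le> ereal R" "0 \<le> R" "j < p"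
  shows "psi2_norm P (\<lambda>\<omega>. X \<omega> j) \<le> ereal R"
proof -
  define e where "e i = (if i = j then 1 else 0 :: real)" for i
  have "l2_norm p e = 1"
    using assms(4) by (simp add: L2_set_def e_def if_distrib[of "\<lambda>x. x\<^sup>2"] sum.delta cong: if_cong)
  moreover have "dot p e x = x j" for x
    using assms(4) by (simp add: dot_def e_def if_distrib[of "\<lambda>x. x * _"] sum.delta cong: if_cong)
  ultimately show ?thesis using psi2_norm_dot[OF assms(1-3), of e] by simp
qed

lemma psi2_norm_response:
  assumes "linear_model p P \<sigma>" "psi2_norm_vec p P fst \<le> ereal R" "0 \<le> R" "sub_Gaussian P snd \<sigma>"
  shows "psi2_norm P (\<lambda>\<omega>. dot p \<beta> (fst \<omega>) + snd \<omega>) \<le> ereal (2 * (\<sigma> + R * l2_norm p \<beta>))"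
proof -
  have P: "prob_space P" "0 \<le> \<sigma>" using assms(1) by (auto simp: linear_model_def)
  have "psi2_norm P (\<lambda>\<omega>. dot p \<beta> (fst \<omega>) + snd \<omega>) \<le> ereal (R * l2_norm p \<beta> + 2 * \<sigma>)"
    using P assms(3,4) linear_model_measurable[OF assms(1)]
    by (intro psi2_norm_add psi2_norm_dot assms(2) sub_Gaussian_psi2_norm) auto
  then show ?thesis
    by (rule psi2_norm_mono) (use assms(3) in \<open>simp add: mult_nonneg_nonneg\<close>)
qed

text \<open>
  The covariate is measurable with respect to the \<open>\<sigma>\<close>-algebra that \<open>X\<close> generates, so the noise may
  be replaced by its conditional expectation.
\<close>

lemma integral_covariate_noise:
  assumes model: "linear_model p P \<sigma>" and j: "j < p"
    and int: "integrable P (\<lambda>\<omega>. fst \<omega> j * snd \<omega>)"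
  shows "(\<integral>\<omega>. fst \<omega> j * snd \<omega> \<partial>P) = 0"
proof -
  define F where "F = sigma_X p P"
  have sets: "sets P = sets (Rvec {..<p} \<Otimes>\<^sub>M borel)" and P: "prob_space P"
    and zero: "AE \<omega> in P. real_cond_exp P F snd \<omega> = 0"
    using model by (auto simp: linear_model_def F_def)
  interpret prob_space P by fact
  have fst: "fst \<in> P \<rightarrow>\<^sub>M Rvec {..<p}"
    unfolding measurable_cong_sets[OF sets refl] by measurable
  have sub: "subalgebra P F"
    unfolding subalgebra_def F_def sigma_X_def
    using measurable_sets[OF fst] measurable_space[OF fst] by (auto simp: sets_vimage_algebra2)
  interpret finite_measure_subalgebra P F using sub by unfold_locales
  have "fst \<in> F \<rightarrow>\<^sub>M Rvec {..<p}"
    unfolding F_def sigma_X_def by (rule measurable_vimage_algebra1) (use measurable_space[OF fst] in auto)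
  then have "(\<lambda>\<omega>. fst \<omega> j) \<in> borel_measurable F"
    by (rule measurable_compose) (intro measurable_component_singleton, use j in simp)
  then have "(\<integral>\<omega>. fst \<omega> j * snd \<omega> \<partial>P) = (\<integral>\<omega>. fst \<omega> j * real_cond_exp P F snd \<omega> \<partial>P)"
    using real_cond_exp_intg(2)[OF int] linear_model_measurable(2)[OF model] by simp
  also have "\<dots> = (\<integral>\<omega>. 0 \<partial>P)"
    using zero linear_model_measurable(1)[OF model j] by (intro integral_cong_AE) auto
  finally show ?thesis by simp
qed

text \<open>
  A statistic of a labelled observation is a function of the pair \<open>(X, \<epsilon>)\<close>; its law can be computed
  under \<open>P\<close>.
\<close>

lemma lab_law_distr:
  assumes "linear_model p P \<sigma>" "J \<subseteq> {..<p}"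
  shows "prob_space (lab_law p P \<beta> J)"
    and "H \<in> borel_measurable (Rvec J \<Otimes>\<^sub>M borel) \<Longrightarrow> H \<in> borel_measurable (lab_law p P \<beta> J)"
    and "H \<in> borel_measurable (Rvec J \<Otimes>\<^sub>M borel) \<Longrightarrow> distr (lab_law p P \<beta> J) borel H =
      distr P borel (\<lambda>\<omega>. H (restrict (fst \<omega>) J, dot p (fst \<omega>) \<beta> + snd \<omega>))"
proof -
  define T where "T = (\<lambda>(x :: nat \<Rightarrow> real, e :: real). (restrict x J, dot p x \<beta> + e))"
  have P: "prob_space P" and sets: "sets P = sets (Rvec {..<p} \<Otimes>\<^sub>M borel)"
    using assms by (auto simp: linear_model_def)
  have "(\<lambda>\<omega>. dot p (fst \<omega>) \<beta>) \<in> borel_measurable P"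
    using linear_model_measurable(3)[OF assms(1), of \<beta>] by (simp add: dot_def mult.commute)
  moreover have "(\<lambda>\<omega>. restrict (fst \<omega>) J) \<in> P \<rightarrow>\<^sub>M Rvec J"
    using linear_model_measurable(1)[OF assms(1)] assms(2)
    by (intro measurable_restrict) auto
  ultimately have T: "T \<in> P \<rightarrow>\<^sub>M (Rvec J \<Otimes>\<^sub>M borel)"
    unfolding T_def case_prod_beta'
    using linear_model_measurable(2)[OF assms(1)] by measurable
  have law: "lab_law p P \<beta> J = distr P (Rvec J \<Otimes>\<^sub>M borel) T"
    by (simp add: lab_law_def T_def)
  show "prob_space (lab_law p P \<beta> J)"
    unfolding law by (rule prob_space.prob_space_distr[OF P T])
  show "H \<in> borel_measurable (lab_law p P \<beta> J)" if "H \<in> borel_measurable (Rvec J \<Otimes>\<^sub>M borel)"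
    using that by (simp add: law)
  show "distr (lab_law p P \<beta> J) borel H =
      distr P borel (\<lambda>\<omega>. H (restrict (fst \<omega>) J, dot p (fst \<omega>) \<beta> + snd \<omega>))"
    if "H \<in> borel_measurable (Rvec J \<Otimes>\<^sub>M borel)"
    unfolding law distr_distr[OF that T] by (simp add: comp_def T_def case_prod_beta)
qed

lemma covariate_law_distr:
  assumes "linear_model p P \<sigma>"
  shows "prob_space (distr P (Rvec {..<p}) fst)"
    and "H \<in> borel_measurable (Rvec {..<p}) \<Longrightarrow> H \<in> borel_measurable (distr P (Rvec {..<p}) fst)"
    and "H \<in> borel_measurable (Rvec {..<p}) \<Longrightarrow> distr (distr P (Rvec {..<p}) fst) borel H =
      distr P borel (\<lambda>\<omega>. H (fst \<omega>))"
proof -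
  have P: "prob_space P" and sets: "sets P = sets (Rvec {..<p} \<Otimes>\<^sub>M borel)"
    using assms by (auto simp: linear_model_def)
  have fst: "fst \<in> P \<rightarrow>\<^sub>M Rvec {..<p}"
    unfolding measurable_cong_sets[OF sets refl] by measurable
  show "prob_space (distr P (Rvec {..<p}) fst)"
    by (rule prob_space.prob_space_distr[OF P fst])
  show "H \<in> borel_measurable (distr P (Rvec {..<p}) fst)" if "H \<in> borel_measurable (Rvec {..<p})"
    using that by simp
  show "distr (distr P (Rvec {..<p}) fst) borel H = distr P borel (\<lambda>\<omega>. H (fst \<omega>))"
    if "H \<in> borel_measurable (Rvec {..<p})"
    unfolding distr_distr[OF that fst] by (simp add: comp_def)
qed

lemma card_lab_index:
  "card {i\<in>lab_index K n. Q (fst i)} = (\<Sum>k<K. n k * of_bool (Q k))"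
proof -
  have "{i\<in>lab_index K n. Q (fst i)} = (SIGMA k:{..<K}. {m. m < n k \<and> Q k})"
    by (auto simp: lab_index_def)
  also have "card \<dots> = (\<Sum>k<K. card {m. m < n k \<and> Q k})" by (intro card_SigmaI) auto
  also have "\<dots> = (\<Sum>k<K. n k * of_bool (Q k))"
  proof (rule sum.cong[OF refl])
    show "card {m. m < n k \<and> Q k} = n k * of_bool (Q k)" for k by (cases "Q k") simp_all
  qed
  finally show ?thesis .
qed

lemma finite_lab_index: "finite (lab_index K n)"
  by (simp add: lab_index_def)

lemma lab_index_pattern:
  assumes "patterns p K Ob" "i \<in> lab_index K n"
  shows "Ob (fst i) \<subseteq> {..<p}"
  using assms by (auto simp: patterns_def lab_index_def)

text \<open>
  The last claim is what makes modalities useful: a pattern is a union of them, so one observed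
  coordinate brings along its whole modality.
\<close>

lemma modalities_partition:
  assumes "modalities p K Ob L Md"
  shows "g < L \<Longrightarrow> Md g \<subseteq> {..<p}" "g < L \<Longrightarrow> Md g \<noteq> {}" "(\<Union>g<L. Md g) = {..<p}"
    and "g < L \<Longrightarrow> h < L \<Longrightarrow> g \<noteq> h \<Longrightarrow> Md g \<inter> Md h = {}"
    and "g < L \<Longrightarrow> j \<in> Md g \<Longrightarrow> modality_of L Md j = g"
    and "g < L \<Longrightarrow> j \<in> Md g \<Longrightarrow> k < K \<Longrightarrow> j \<in> Ob k \<longleftrightarrow> Md g \<subseteq> Ob k"
proof -
  have inj: "inj_on Md {..<L}" and part: "partition_on {..<p} (Md ` {..<L})"
    and union: "\<forall>k<K. \<exists>U\<subseteq>Md ` {..<L}. Ob k = \<Union>U"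
    using assms by (auto simp: modalities_def compatible_partition_def)
  note parts = part[unfolded partition_on_def]
  show un: "(\<Union>g<L. Md g) = {..<p}" using parts by (elim conjE)
  show "Md g \<subseteq> {..<p}" if "g < L" for g
    unfolding un[symmetric] using that by (intro UN_upper) simp
  have "{} \<notin> Md ` {..<L}" using parts by (elim conjE)
  then show "Md g \<noteq> {}" if "g < L" for g using that imageI[of g "{..<L}" Md] by auto
  have pairwise: "disjoint (Md ` {..<L})" using parts by (elim conjE)
  have same: "g = h" if "g < L" "h < L" "j \<in> Md g" "j \<in> Md h" for g h j
  proof (rule inj_onD[OF inj])
    show "Md g = Md h"
    proof (rule ccontr)
      assume "Md g \<noteq> Md h"
      with pairwise that(1,2) have "Md g \<inter> Md h = {}" by (intro disjointD) (auto intro!: imageI)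
      then show False using that(3,4) by blast
    qed
  qed (use that in simp_all)
  show "Md g \<inter> Md h = {}" if "g < L" "h < L" "g \<noteq> h" for g h
  proof (rule equals0I)
    fix j assume "j \<in> Md g \<inter> Md h"
    with same[OF that(1,2), of j] that(3) show False by simp
  qed
  show "modality_of L Md j = g" if gj: "g < L" "j \<in> Md g" for g j
    unfolding modality_of_def
  proof (rule the_equality)
    show "h = g" if "h < L \<and> j \<in> Md h" for h
      by (rule same[of h g j]) (use that gj in simp_all)
  qed (use gj in simp)
  show "j \<in> Ob k \<longleftrightarrow> Md g \<subseteq> Ob k" if g: "g < L" "j \<in> Md g" "k < K" for g j k
  proof
    assume "j \<in> Ob k"
    obtain U where U: "U \<subseteq> Md ` {..<L}" "Ob k = \<Union>U"
      using union[rule_format, OF g(3)] by (elim exE conjE)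
    obtain B where B: "B \<in> U" "j \<in> B" using \<open>j \<in> Ob k\<close> unfolding U(2) by blast
    obtain h where h: "h < L" "B = Md h" using B(1) U(1) by blast
    have "h = g" by (rule same[OF h(1) g(1) _ g(2)]) (use B(2) h(2) in simp)
    then show "Md g \<subseteq> Ob k" unfolding U(2) using B(1) h(2) by blast
  qed (erule subsetD[OF _ g(2)])
qed

section \<open>Deviations of the estimated moments\<close>

lemma average_deviation:
  fixes n :: nat
  assumes "0 < n" "\<bar>S - real n * \<mu>\<bar> \<le> real n * d" "a = S / real n"
  shows "\<bar>a - \<mu>\<bar> \<le> d"
proof -
  have "S - real n * \<mu> = real n * (a - \<mu>)" using assms by (simp add: algebra_simps)
  then have "real n * \<bar>a - \<mu>\<bar> \<le> real n * d" using assms(2) by (simp add: abs_mult)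
  then show ?thesis using assms(1) by simp
qed

lemma sub_exponential_quadratic:
  assumes "linear_model p P \<sigma>" "psi2_norm_vec p P fst \<le> ereal R" "0 \<le> R" "j < p"
  shows "sub_exponential P (\<lambda>\<omega>. fst \<omega> j * dot p v (fst \<omega>)) (R * (R * l2_norm p v))"
proof -
  have P: "prob_space P" using assms by (auto simp: linear_model_def)
  show ?thesis
    using linear_model_measurable[OF assms(1)] assms(3,4)
    by (intro sub_exponential_mult psi2_norm_coordinate[OF P assms(2-4)] psi2_norm_dot[OF P assms(2,3)]) auto
qed

lemma integral_quadratic:
  assumes "linear_model p P \<sigma>" "psi2_norm_vec p P fst \<le> ereal R" "0 \<le> R" "j < p"
  shows "integrable P (\<lambda>\<omega>. fst \<omega> j * dot p v (fst \<omega>))"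
    and "(\<integral>\<omega>. fst \<omega> j * dot p v (fst \<omega>) \<partial>P) = mult_mat p (second_moment P) v j"
proof -
  have P: "prob_space P" using assms by (auto simp: linear_model_def)
  show "integrable P (\<lambda>\<omega>. fst \<omega> j * dot p v (fst \<omega>))"
    by (rule sub_exponential_integrable[OF P sub_exponential_quadratic[OF assms]])
  have int: "integrable P (\<lambda>\<omega>. fst \<omega> j * fst \<omega> i)" if "i < p" for i
  proof (rule sub_exponential_integrable[OF P])
    show "sub_exponential P (\<lambda>\<omega>. fst \<omega> j * fst \<omega> i) (R * R)"
      using linear_model_measurable(1)[OF assms(1)] assms(3,4) that
      by (intro sub_exponential_mult psi2_norm_coordinate[OF P assms(2,3)]) auto
  qed
  have "(\<integral>\<omega>. fst \<omega> j * dot p v (fst \<omega>) \<partial>P) = (\<integral>\<omega>. (\<Sum>i<p. fst \<omega> j * fst \<omega> i * v i) \<partial>P)"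
    by (simp add: dot_def sum_distrib_left mult_ac)
  also have "\<dots> = (\<Sum>i<p. \<integral>\<omega>. fst \<omega> j * fst \<omega> i * v i \<partial>P)"
    using int by (intro Bochner_Integration.integral_sum integrable_mult_left) auto
  also have "\<dots> = mult_mat p (second_moment P) v j"
    by (simp add: mult_mat_def second_moment_def)
  finally show "(\<integral>\<omega>. fst \<omega> j * dot p v (fst \<omega>) \<partial>P) = mult_mat p (second_moment P) v j" .
qed

text \<open>
  The mean of \<open>X\<^sub>j Y\<close> is entry \<open>j\<close> of \<open>\<Sigma> \<beta>\<close>, because the noise is uncorrelated with
  \<open>X\<^sub>j\<close>; hence \<open>gamma_hat\<close> and \<open>Sigma_hat \<beta>\<close> estimate the same vector.
\<close>

lemma integral_covariate_response:
  assumes model: "linear_model p P \<sigma>" and R: "psi2_norm_vec p P fst \<le> ereal R" "0 \<le> R"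
    and noise: "sub_Gaussian P snd \<sigma>" and j: "j < p"
  shows "(\<integral>\<omega>. fst \<omega> j * (dot p \<beta> (fst \<omega>) + snd \<omega>) \<partial>P) = mult_mat p (second_moment P) \<beta> j"
proof -
  have P: "prob_space P" "0 \<le> \<sigma>" using model by (auto simp: linear_model_def)
  have int: "integrable P (\<lambda>\<omega>. fst \<omega> j * snd \<omega>)"
    using linear_model_measurable[OF model] P R(2) j
    by (intro sub_exponential_integrable[OF P(1) sub_exponential_mult[OF _ _
            psi2_norm_coordinate[OF P(1) R j] _ sub_Gaussian_psi2_norm[OF P(1) _ noise]]]) auto
  show ?thesis
    using integral_quadratic[OF model R j, of \<beta>] int integral_covariate_noise[OF model j int]
    by (simp add: distrib_left)
qed

text \<open>
  Bernstein's inequality for the products \<open>X\<^sub>j Y\<close> of the labelled observations that contain the modality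
  of \<open>j\<close>.
\<close>

lemma gamma_hat_deviation:
  assumes model: "linear_model p P \<sigma>" and pat: "patterns p K Ob" and mod: "modalities p K Ob L Md"
    and R: "psi2_norm_vec p P fst \<le> ereal R" "0 \<le> R" and noise: "sub_Gaussian P snd \<sigma>"
    and g: "g < L" "j \<in> Md g" and h: "0 < h_count K Ob n Md g" and x: "0 < x" "x \<le> 8"
  shows "with_prob_at_least (data_law p K Ob n N P \<beta>)
    (1 - 2 * exp (- (real (h_count K Ob n Md g) * x\<^sup>2 / 32)))
    (\<lambda>\<omega>. \<bar>gamma_hat K Ob n L Md \<omega> j - mult_mat p (second_moment P) \<beta> j\<bar> \<le>
      R * (2 * (\<sigma> + R * l2_norm p \<beta>)) * x)"
proof -
  define I' where "I' = {i\<in>lab_index K n. Md g \<subseteq> Ob (fst i)}"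
  define W where "W = (\<lambda>\<omega> :: (nat \<Rightarrow> real) \<times> real. fst \<omega> j * (dot p \<beta> (fst \<omega>) + snd \<omega>))"
  define f where "f = (\<lambda>(i :: nat \<times> nat) \<omega> :: (nat \<Rightarrow> real) \<times> real. fst \<omega> j * snd \<omega>)"
  have P: "prob_space P" "0 \<le> \<sigma>" using model by (auto simp: linear_model_def)
  have j: "j < p" using modalities_partition(1)[OF mod g(1)] g(2) by auto
  note [measurable] = linear_model_measurable(1)[OF model] linear_model_measurable(2,3)[OF model]
  have Xj [measurable]: "(\<lambda>\<omega>. fst \<omega> j) \<in> borel_measurable P" using j by measurable
  have W: "sub_exponential P W (R * (2 * (\<sigma> + R * l2_norm p \<beta>)))"
    unfolding W_def using R P
    by (intro sub_exponential_mult psi2_norm_coordinate[OF P(1) R j] psi2_norm_response[OF model R noise]) auto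
  have "card I' = h_count K Ob n Md g" unfolding I'_def h_count_def by (rule card_lab_index)
  then have card: "h_count K Ob n Md g = card I' + card ({} :: nat set)" by simp
  have Ob_j: "j \<in> Ob (fst i) \<longleftrightarrow> Md g \<subseteq> Ob (fst i)" if "i \<in> lab_index K n" for i
    using modalities_partition(6)[OF mod g] that by (auto simp: lab_index_def)
  have f: "f i \<in> borel_measurable (lab_law p P \<beta> (Ob (fst i)))"
    "distr (lab_law p P \<beta> (Ob (fst i))) borel (f i) = distr P borel W" if "i \<in> I'" for i
  proof -
    have i': "i \<in> lab_index K n" "Md g \<subseteq> Ob (fst i)" using that by (simp_all add: I'_def)
    note i = lab_index_pattern[OF pat i'(1)] subsetD[OF i'(2) g(2)]
    have *: "f i \<in> borel_measurable (Rvec (Ob (fst i)) \<Otimes>\<^sub>M borel)"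
      unfolding f_def using i by measurable
    show "f i \<in> borel_measurable (lab_law p P \<beta> (Ob (fst i)))"
      by (rule lab_law_distr(2)[OF model i(1) *])
    show "distr (lab_law p P \<beta> (Ob (fst i))) borel (f i) = distr P borel W"
      unfolding lab_law_distr(3)[OF model i(1) *] using i(2)
      by (simp add: f_def W_def dot_def mult.commute)
  qed
  \<comment> \<open>The responses of the unlabelled observations are unknown, so their part of the sum is empty.\<close>
  have bern: "with_prob_at_least (data_law p K Ob n N P \<beta>)
    (1 - 2 * exp (- (real (h_count K Ob n Md g) * x\<^sup>2 / 32)))
    (\<lambda>\<omega>. \<bar>(\<Sum>i\<in>I'. f i (fst \<omega> i)) + (\<Sum>j\<in>{}. (\<lambda>_ _. 0) j (snd \<omega> j)) -
        real (h_count K Ob n Md g) * (\<integral>\<omega>. W \<omega> \<partial>P)\<bar>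
      \<le> real (h_count K Ob n Md g) * (R * (2 * (\<sigma> + R * l2_norm p \<beta>)) * x))"
    unfolding data_law_def
  proof (rule two_sample_bernstein[OF P(1) W finite_lab_index _ _ f _ _ _ _ _ x card])
    fix i assume "i \<in> lab_index K n"
    then show "prob_space (lab_law p P \<beta> (Ob (fst i)))"
      by (intro lab_law_distr(1)[OF model] lab_index_pattern[OF pat])
  qed (auto simp: I'_def intro: covariate_law_distr(1)[OF model])
  have mean: "(\<integral>\<omega>. W \<omega> \<partial>P) = mult_mat p (second_moment P) \<beta> j"
    unfolding W_def by (rule integral_covariate_response[OF model R noise j])
  show ?thesis
  proof (rule with_prob_at_least_mono[OF bern order_refl])
    fix \<omega> :: sample
    assume close: "\<bar>(\<Sum>i\<in>I'. f i (fst \<omega> i)) + (\<Sum>j\<in>{}. (\<lambda>_ _. 0) j (snd \<omega> j)) -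
        real (h_count K Ob n Md g) * (\<integral>\<omega>. W \<omega> \<partial>P)\<bar>
      \<le> real (h_count K Ob n Md g) * (R * (2 * (\<sigma> + R * l2_norm p \<beta>)) * x)"
    have "(\<Sum>i\<in>lab_index K n. fst (fst \<omega> i) j * snd (fst \<omega> i) * of_bool (j \<in> Ob (fst i))) =
        (\<Sum>i\<in>I'. f i (fst \<omega> i))"
      by (intro sum.mono_neutral_cong_right finite_lab_index) (auto simp: I'_def f_def Ob_j)
    then have "gamma_hat K Ob n L Md \<omega> j = (\<Sum>i\<in>I'. f i (fst \<omega> i)) / real (h_count K Ob n Md g)"
      using modalities_partition(5)[OF mod g] by (simp add: gamma_hat_def)
    then show "\<bar>gamma_hat K Ob n L Md \<omega> j - mult_mat p (second_moment P) \<beta> j\<bar> \<le>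
        R * (2 * (\<sigma> + R * l2_norm p \<beta>)) * x"
      unfolding mean[symmetric] by (intro average_deviation[OF h close]) simp
  qed
qed

text \<open>
  Within the block of the modalities \<open>g\<close> and \<open>h\<close> all entries of \<open>Sigma_hat\<close> average over the same
  observations, so row \<open>j\<close> of the block applied to \<open>v\<close> is an average of copies of the products
  \<open>X\<^sub>j v\<^sup>T X\<close>, with \<open>v\<close> cut off outside \<open>L\<^sub>h\<close>.  With \<open>v = \<beta>\<close> this serves the feasibility
  of \<open>\<beta>\<close>, with a unit vector it controls a single entry.
\<close>

lemma Sigma_hat_deviation:
  assumes model: "linear_model p P \<sigma>" and pat: "patterns p K Ob" and mod: "modalities p K Ob L Md"
    and R: "psi2_norm_vec p P fst \<le> ereal R" "0 \<le> R"
    and g: "g < L" "j \<in> Md g" and h: "h < L"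
    and n: "0 < n_count K Ob n Md g h + N" and x: "0 < x" "x \<le> 8"
  shows "with_prob_at_least (data_law p K Ob n N P \<beta>)
    (1 - 2 * exp (- (real (n_count K Ob n Md g h + N) * x\<^sup>2 / 32)))
    (\<lambda>\<omega>. \<bar>\<Sum>i\<in>Md h. (Sigma_hat K Ob n N L Md \<omega> j i - second_moment P j i) * v i\<bar> \<le>
      R\<^sup>2 * L2_set v (Md h) * x)"
proof -
  define I' where "I' = {i\<in>lab_index K n. Md g \<union> Md h \<subseteq> Ob (fst i)}"
  \<comment> \<open>The block only sees the entries of \<open>v\<close> in \<open>L\<^sub>h\<close>.\<close>
  define u where "u i = (if i \<in> Md h then v i else 0)" for i
  define W where "W = (\<lambda>\<omega> :: (nat \<Rightarrow> real) \<times> real. fst \<omega> j * dot p u (fst \<omega>))"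
  define q where "q = (\<lambda>y :: nat \<Rightarrow> real. y j * (\<Sum>i\<in>Md h. y i * v i))"
  define m where "m = n_count K Ob n Md g h + N"
  have P: "prob_space P" "0 \<le> \<sigma>" using model by (auto simp: linear_model_def)
  have Mh: "Md h \<subseteq> {..<p}" by (rule modalities_partition(1)[OF mod h])
  have j: "j < p" using modalities_partition(1)[OF mod g(1)] g(2) by auto
  have sum_u: "(\<Sum>i<p. a i * u i) = (\<Sum>i\<in>Md h. a i * v i)" for a :: "nat \<Rightarrow> real"
    using Mh by (intro sum.mono_neutral_cong_right) (auto simp: u_def)
  have q: "q y = y j * dot p u y" for y
    by (simp add: q_def dot_def sum_u[symmetric] mult.commute)
  have "l2_norm p u = L2_set v (Md h)"
    unfolding L2_set_def using Mh by (intro arg_cong[where f = sqrt] sum.mono_neutral_cong_right) (auto simp: u_def)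
  then have W: "sub_exponential P W (R\<^sup>2 * L2_set v (Md h))"
    using sub_exponential_quadratic[OF model R j, of u] by (simp add: W_def power2_eq_square mult.assoc)
  have "card I' = n_count K Ob n Md g h"
    unfolding I'_def n_count_def by (rule card_lab_index[where Q = "\<lambda>k. Md g \<union> Md h \<subseteq> Ob k"])
  then have card: "m = card I' + card {..<N}" by (simp add: m_def)
  have Ob_ji: "{j, i} \<subseteq> Ob (fst k) \<longleftrightarrow> Md g \<union> Md h \<subseteq> Ob (fst k)" if "k \<in> lab_index K n" "i \<in> Md h" for k i
    using modalities_partition(6)[OF mod g] modalities_partition(6)[OF mod h that(2)] that(1)
    by (auto simp: lab_index_def)
  have q_meas: "q \<in> borel_measurable (Rvec J)" if "insert j (Md h) \<subseteq> J" for J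
    unfolding q_def using that
    by (intro borel_measurable_times borel_measurable_sum measurable_component_singleton) auto
  have f: "(\<lambda>\<omega>. q (fst \<omega>)) \<in> borel_measurable (lab_law p P \<beta> (Ob (fst k)))"
    "distr (lab_law p P \<beta> (Ob (fst k))) borel (\<lambda>\<omega>. q (fst \<omega>)) = distr P borel W" if "k \<in> I'" for k
  proof -
    have k': "k \<in> lab_index K n" "Md g \<union> Md h \<subseteq> Ob (fst k)" using that by (simp_all add: I'_def)
    note k = lab_index_pattern[OF pat k'(1)]
    have k'': "insert j (Md h) \<subseteq> Ob (fst k)" using k'(2) g(2) by auto
    have *: "(\<lambda>\<omega>. q (fst \<omega>)) \<in> borel_measurable (Rvec (Ob (fst k)) \<Otimes>\<^sub>M borel)"
      by (rule measurable_compose[OF measurable_fst q_meas[OF k'']])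
    have "q (restrict y (Ob (fst k))) = q y" for y
      unfolding q_def using k'' by (auto intro!: sum.cong)
    then have "(\<lambda>\<omega>. q (restrict (fst \<omega>) (Ob (fst k)))) = W" by (auto simp: W_def q)
    with lab_law_distr(2,3)[OF model k *]
    show "(\<lambda>\<omega>. q (fst \<omega>)) \<in> borel_measurable (lab_law p P \<beta> (Ob (fst k)))"
      "distr (lab_law p P \<beta> (Ob (fst k))) borel (\<lambda>\<omega>. q (fst \<omega>)) = distr P borel W"
      by simp_all
  qed
  have q_meas_p: "q \<in> borel_measurable (Rvec {..<p})" using Mh j by (intro q_meas) auto
  have "(\<lambda>\<omega>. q (fst \<omega>)) = W" by (auto simp: W_def q)
  note g' = covariate_law_distr(2,3)[OF model q_meas_p, unfolded this]
  have bern: "with_prob_at_least (data_law p K Ob n N P \<beta>) (1 - 2 * exp (- (real m * x\<^sup>2 / 32)))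
    (\<lambda>\<omega>. \<bar>(\<Sum>k\<in>I'. q (fst (fst \<omega> k))) + (\<Sum>k<N. q (snd \<omega> k)) - real m * (\<integral>\<omega>. W \<omega> \<partial>P)\<bar>
      \<le> real m * (R\<^sup>2 * L2_set v (Md h) * x))"
    unfolding data_law_def
  proof (rule two_sample_bernstein[OF P(1) W finite_lab_index _ _ f _ _ _ g' x card])
    fix i assume "i \<in> lab_index K n"
    then show "prob_space (lab_law p P \<beta> (Ob (fst i)))"
      by (intro lab_law_distr(1)[OF model] lab_index_pattern[OF pat])
  qed (auto simp: I'_def intro: covariate_law_distr(1)[OF model])
  have mean: "(\<integral>\<omega>. W \<omega> \<partial>P) = (\<Sum>i\<in>Md h. second_moment P j i * v i)"
    unfolding W_def integral_quadratic(2)[OF model R j] by (simp add: mult_mat_def sum_u)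
  show ?thesis
  proof (rule with_prob_at_least_mono[OF bern])
    fix \<omega> :: sample
    assume close: "\<bar>(\<Sum>k\<in>I'. q (fst (fst \<omega> k))) + (\<Sum>k<N. q (snd \<omega> k)) - real m * (\<integral>\<omega>. W \<omega> \<partial>P)\<bar>
      \<le> real m * (R\<^sup>2 * L2_set v (Md h) * x)"
    have "Sigma_hat K Ob n N L Md \<omega> j i = ((\<Sum>k<N. snd \<omega> k j * snd \<omega> k i) +
        (\<Sum>k\<in>I'. fst (fst \<omega> k) j * fst (fst \<omega> k) i)) / real m" if i: "i \<in> Md h" for i
    proof -
      have "(\<Sum>k\<in>lab_index K n. fst (fst \<omega> k) j * fst (fst \<omega> k) i * of_bool ({j, i} \<subseteq> Ob (fst k))) =
          (\<Sum>k\<in>I'. fst (fst \<omega> k) j * fst (fst \<omega> k) i)"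
        using Ob_ji[OF _ i]
        by (intro sum.mono_neutral_cong_right finite_lab_index) (auto simp: I'_def simp del: insert_subset)
      then show ?thesis
        using modalities_partition(5)[OF mod g] modalities_partition(5)[OF mod h i]
        by (simp add: Sigma_hat_def m_def)
    qed
    then have "(\<Sum>i\<in>Md h. Sigma_hat K Ob n N L Md \<omega> j i * v i) =
        (\<Sum>i\<in>Md h. ((\<Sum>k<N. snd \<omega> k j * snd \<omega> k i) + (\<Sum>k\<in>I'. fst (fst \<omega> k) j * fst (fst \<omega> k) i)) * v i) / real m"
      by (simp add: sum_divide_distrib)
    also have "(\<Sum>i\<in>Md h. ((\<Sum>k<N. snd \<omega> k j * snd \<omega> k i) + (\<Sum>k\<in>I'. fst (fst \<omega> k) j * fst (fst \<omega> k) i)) * v i) =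
        (\<Sum>i\<in>Md h. \<Sum>k<N. snd \<omega> k j * (snd \<omega> k i * v i)) +
        (\<Sum>i\<in>Md h. \<Sum>k\<in>I'. fst (fst \<omega> k) j * (fst (fst \<omega> k) i * v i))"
      by (simp add: distrib_right sum.distrib sum_distrib_right mult.assoc)
    also have "\<dots> = (\<Sum>k\<in>I'. q (fst (fst \<omega> k))) + (\<Sum>k<N. q (snd \<omega> k))"
      unfolding q_def sum_distrib_left
      using sum.swap[of "\<lambda>i k. snd \<omega> k j * (snd \<omega> k i * v i)" "{..<N}" "Md h"]
        sum.swap[of "\<lambda>i k. fst (fst \<omega> k) j * (fst (fst \<omega> k) i * v i)" I' "Md h"] by linarith
    finally show "\<bar>\<Sum>i\<in>Md h. (Sigma_hat K Ob n N L Md \<omega> j i - second_moment P j i) * v i\<bar> \<le>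
        R\<^sup>2 * L2_set v (Md h) * x"
      using average_deviation[OF _ close] n
      by (simp add: mean left_diff_distrib sum_subtractf m_def)
  qed (simp add: m_def)
qed

section \<open>The union bound over the modalities\<close>

lemma sum_over_modalities:
  fixes F :: "nat \<Rightarrow> real"
  assumes "modalities p K Ob L Md"
  shows "(\<Sum>j<p. F j) = (\<Sum>g<L. \<Sum>j\<in>Md g. F j)"
proof -
  note M = modalities_partition[OF assms]
  have "(\<Sum>j<p. F j) = (\<Sum>j\<in>(\<Union>g\<in>{..<L}. Md g). F j)" by (simp only: M(3))
  also have "\<dots> = (\<Sum>g<L. \<Sum>j\<in>Md g. F j)"
    using M(1,4) by (intro sum.UNION_disjoint) (auto intro: finite_subset)
  finally show ?thesis .
qed

text \<open>
  The inverse of the argument of the logarithm in \<open>lam\<close>: an exponent of \<open>- 4 log (2 L \<bar>L\<^sub>g\<bar>)\<close> in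
  Bernstein's inequality becomes the fourth power of this weight.
\<close>

definition union_weight :: "nat \<Rightarrow> (nat \<Rightarrow> nat set) \<Rightarrow> nat \<Rightarrow> real" where
  "union_weight L Md j = 1 / (2 * real L * real (card (Md (modality_of L Md j))))"

lemma modality_exists:
  assumes "modalities p K Ob L Md" "j < p"
  obtains g where "g < L" "j \<in> Md g"
  using modalities_partition(3)[OF assms(1)] assms(2) by (metis UN_E lessThan_iff)

lemma card_modality_pos:
  assumes "modalities p K Ob L Md" "g < L"
  shows "1 \<le> card (Md g)"
  using modalities_partition(1,2)[OF assms(1,2)] finite_subset[of "Md g" "{..<p}"]
  by (simp add: Suc_le_eq card_gt_0_iff)

lemma union_weight_bounds:
  assumes mod: "modalities p K Ob L Md" and j: "j < p"
  shows "0 < union_weight L Md j" "real L * union_weight L Md j \<le> 1/2" "union_weight L Md j \<le> 1/2"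
    "union_weight L Md j \<le> 1 / (2 * real L * real (MIN l\<in>{..<L}. card (Md l)))"
proof -
  obtain g where g: "g < L" "j \<in> Md g" using modality_exists[OF mod j] .
  have u: "union_weight L Md j = 1 / (2 * real L * real (card (Md g)))"
    by (simp add: union_weight_def modalities_partition(5)[OF mod g])
  have c: "1 \<le> real (card (Md g))" "1 \<le> real L" using card_modality_pos[OF mod g(1)] g(1) by auto
  then have "1 * 1 \<le> real L * real (card (Md g))" by (intro mult_mono) linarith+
  then show "union_weight L Md j \<le> 1/2" using c by (simp add: u field_simps)
  show "0 < union_weight L Md j" "real L * union_weight L Md j \<le> 1/2"
    using c by (simp_all add: u field_simps)
  have fin: "finite ((\<lambda>l. card (Md l)) ` {..<L})" "(\<lambda>l. card (Md l)) ` {..<L} \<noteq> {}" using g(1) by auto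
  have "(MIN l\<in>{..<L}. card (Md l)) \<in> (\<lambda>l. card (Md l)) ` {..<L}" using fin by (rule Min_in)
  then have pos: "0 < (MIN l\<in>{..<L}. card (Md l))"
    using card_modality_pos[OF mod] by (auto simp: Suc_le_eq)
  have "(MIN l\<in>{..<L}. card (Md l)) \<le> card (Md g)" using g(1) by (intro Min_le) auto
  then have "2 * real L * real (MIN l\<in>{..<L}. card (Md l)) \<le> 2 * real L * real (card (Md g))"
    by (intro mult_left_mono) auto
  moreover have "0 < 2 * real L * real (MIN l\<in>{..<L}. card (Md l))" using pos c by simp
  ultimately show "union_weight L Md j \<le> 1 / (2 * real L * real (MIN l\<in>{..<L}. card (Md l)))"
    unfolding u by (rule frac_le[OF zero_le_one order_refl, rotated])
qed

text \<open>
  Each modality contributes \<open>1 / (2 L)\<close>.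
\<close>

lemma sum_union_weight:
  assumes mod: "modalities p K Ob L Md" and "0 < p"
  shows "(\<Sum>j<p. union_weight L Md j) = 1/2"
proof -
  obtain g0 where "g0 < L" using modality_exists[OF mod assms(2)] .
  then have L: "0 < L" by simp
  have "(\<Sum>j<p. union_weight L Md j) = (\<Sum>g<L. \<Sum>j\<in>Md g. union_weight L Md j)"
    by (rule sum_over_modalities[OF mod])
  also have "\<dots> = (\<Sum>g<L. 1 / (2 * real L))"
  proof (rule sum.cong[OF refl])
    fix g assume "g \<in> {..<L}"
    then have g: "g < L" by simp
    have "(\<Sum>j\<in>Md g. union_weight L Md j) = (\<Sum>j\<in>Md g. 1 / (2 * real L * real (card (Md g))))"
      by (intro sum.cong) (simp_all add: union_weight_def modalities_partition(5)[OF mod g])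
    also have "\<dots> = 1 / (2 * real L)"
      using card_modality_pos[OF mod g] by simp
    finally show "(\<Sum>j\<in>Md g. union_weight L Md j) = 1 / (2 * real L)" .
  qed
  also have "\<dots> = 1/2" using L by simp
  finally show ?thesis .
qed

text \<open>
  With \<open>t\<close> half of the right-hand side, \<open>u j \<le> t\<close>, \<open>L u j \<le> 1/2\<close> and \<open>\<Sum> u j = 1/2\<close>: in the first
  two sums one factor \<open>u j\<close> is kept for the summation, one is bounded by \<open>t\<close>, and the others absorb
  the constants and the \<open>L\<close> choices of \<open>h\<close>.  The third sum is twice the square of
  \<open>\<Sum> (u j)\<^sup>2 \<le> t / 2\<close>.
\<close>

lemma union_bound_total:
  assumes mod: "modalities p K Ob L Md" and "0 < p"
  defines "u \<equiv> union_weight L Md"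
  shows "(\<Sum>j<p. 2 * u j ^ 4) + ((\<Sum>(j, h)\<in>{..<p} \<times> {..<L}. 2 * u j ^ 4) +
      (\<Sum>(i, j)\<in>{..<p} \<times> {..<p}. 2 * ((u i)\<^sup>2 * (u j)\<^sup>2)))
    \<le> 1 / (real L * real (MIN l\<in>{..<L}. card (Md l)))"
proof -
  define t where "t = 1 / (2 * real L * real (MIN l\<in>{..<L}. card (Md l)))"
  note b = union_weight_bounds[OF mod, folded u_def t_def]
  have total: "(\<Sum>j<p. u j) = 1/2" unfolding u_def by (rule sum_union_weight[OF mod \<open>0 < p\<close>])
  have t: "0 \<le> t" by (simp add: t_def)
  have le_half: "2 * real L * real (MIN l\<in>{..<L}. card (Md l)) \<noteq> 0 \<Longrightarrow> t \<le> 1/2"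
  proof -
    assume "2 * real L * real (MIN l\<in>{..<L}. card (Md l)) \<noteq> 0"
    then have "0 < L * (MIN l\<in>{..<L}. card (Md l))" by simp
    then have "1 \<le> real (L * (MIN l\<in>{..<L}. card (Md l)))" by linarith
    then show "t \<le> 1/2" by (simp add: t_def field_simps)
  qed
  have t2: "t \<le> 1/2" using le_half by (cases "2 * real L * real (MIN l\<in>{..<L}. card (Md l)) = 0") (auto simp: t_def)
  have first: "(\<Sum>j<p. 2 * u j ^ 4) \<le> (\<Sum>j<p. t / 2 * u j)"
  proof (rule sum_mono)
    fix j assume "j \<in> {..<p}"
    then have j: "j < p" by simp
    have "u j ^ 4 = (u j * u j) * (u j * u j)" by (simp add: power4_eq_xxxx mult.assoc)
    also have "\<dots> \<le> (1/2 * (1/2)) * (t * u j)"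
      using b[OF j] t by (intro mult_mono) auto
    finally show "2 * u j ^ 4 \<le> t / 2 * u j" by simp
  qed
  have "(\<Sum>(j, h)\<in>{..<p} \<times> {..<L}. 2 * u j ^ 4) = (\<Sum>j<p. \<Sum>h<L. 2 * u j ^ 4)"
    by (rule sum.cartesian_product[symmetric])
  also have "\<dots> \<le> (\<Sum>j<p. t / 2 * u j)"
  proof (rule sum_mono)
    fix j assume "j \<in> {..<p}"
    then have j: "j < p" by simp
    have "(\<Sum>h<L. 2 * u j ^ 4) = 2 * ((real L * u j) * (u j * (u j * u j)))"
      by (simp add: power4_eq_xxxx mult_ac)
    also have "\<dots> \<le> 2 * (1/2 * (1/2 * (t * u j)))"
      using b[OF j] t by (intro mult_left_mono mult_mono) auto
    finally show "(\<Sum>h<L. 2 * u j ^ 4) \<le> t / 2 * u j" by simp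
  qed
  finally have second: "(\<Sum>(j, h)\<in>{..<p} \<times> {..<L}. 2 * u j ^ 4) \<le> (\<Sum>j<p. t / 2 * u j)" .
  have sq: "(\<Sum>j<p. (u j)\<^sup>2) \<le> t / 2"
  proof -
    have "(\<Sum>j<p. (u j)\<^sup>2) \<le> (\<Sum>j<p. t * u j)"
      using b by (intro sum_mono) (auto simp: power2_eq_square intro!: mult_right_mono less_imp_le)
    also have "\<dots> = t / 2" by (simp add: sum_distrib_left[symmetric] total)
    finally show ?thesis .
  qed
  have "(\<Sum>(i, j)\<in>{..<p} \<times> {..<p}. 2 * ((u i)\<^sup>2 * (u j)\<^sup>2)) = (\<Sum>i<p. \<Sum>j<p. 2 * ((u i)\<^sup>2 * (u j)\<^sup>2))"
    by (rule sum.cartesian_product[symmetric])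
  also have "\<dots> = 2 * ((\<Sum>j<p. (u j)\<^sup>2) * (\<Sum>j<p. (u j)\<^sup>2))"
    unfolding sum_product by (simp only: sum_distrib_left)
  also have "\<dots> \<le> 2 * (t / 2 * (t / 2))"
    using sq t by (intro mult_left_mono mult_mono sum_nonneg) auto
  also have "\<dots> \<le> 2 * (t / 2 * (1 / 4))" using t t2 by (intro mult_left_mono) auto
  finally have third: "(\<Sum>(i, j)\<in>{..<p} \<times> {..<p}. 2 * ((u i)\<^sup>2 * (u j)\<^sup>2)) \<le> t / 4" by simp
  have "(\<Sum>j<p. t / 2 * u j) = t / 4" unfolding sum_distrib_left[symmetric] total by simp
  moreover have "1 / (real L * real (MIN l\<in>{..<L}. card (Md l))) = 2 * t" by (simp add: t_def)
  ultimately show ?thesis using first second third t by linarith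
qed

section \<open>The good event\<close>

lemma exp_log_size:
  assumes "modalities p K Ob L Md" "g < L" "j \<in> Md g"
  shows "exp (- ln (2 * real L * real (card (Md g)))) = union_weight L Md j"
    and "0 < ln (2 * real L * real (card (Md g)))"
proof -
  have c: "1 \<le> real (card (Md g))" "1 \<le> real L" using card_modality_pos[OF assms(1,2)] assms(2) by auto
  then have "1 * 1 \<le> real L * real (card (Md g))" by (intro mult_mono) auto
  then have "1 < 2 * real L * real (card (Md g))" by simp
  then show "0 < ln (2 * real L * real (card (Md g)))" by (rule ln_gt_zero)
  show "exp (- ln (2 * real L * real (card (Md g)))) = union_weight L Md j"
    using c by (simp add: union_weight_def modalities_partition(5)[OF assms] exp_minus inverse_eq_divide)
qed

text \<open>
  With this \<open>x\<close> the exponent of Bernstein's inequality is \<open>A\<^sup>2 l / 512\<close>, which \<open>A \<ge> 64\<close> makes larger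
  than \<open>4 l\<close>; the sample size condition keeps \<open>x\<close> in the range of that inequality.
\<close>

lemma bernstein_tail_at_rate:
  fixes n :: nat and A l :: real
  assumes "A\<^sup>2 * l \<le> real n" "64 \<le> A" "0 < l"
  defines "x \<equiv> A * sqrt (l / real n) / 4"
  shows "0 < x" "x \<le> 8" "2 * exp (- (real n * x\<^sup>2 / 32)) \<le> 2 * exp (- l) ^ 4"
proof -
  have A: "0 < A" using assms by simp
  have n: "0 < real n" using assms A by (smt (verit) mult_pos_pos zero_less_power)
  show "0 < x" using A n assms(3) by (simp add: x_def)
  have x2: "real n * x\<^sup>2 = A\<^sup>2 * l / 16"
    using n assms(3) by (simp add: x_def power_mult_distrib power_divide)
  have "real n * x\<^sup>2 \<le> real n * 8\<^sup>2" unfolding x2 using assms(1) n by simp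
  then have "x\<^sup>2 \<le> 8\<^sup>2" using n by (simp only: mult_le_cancel_left_pos)
  then show "x \<le> 8" by (rule power2_le_imp_le) simp
  have "64\<^sup>2 * l \<le> A\<^sup>2 * l" using assms(2,3) by (intro mult_right_mono power_mono) auto
  then have "4 * l \<le> real n * x\<^sup>2 / 32" unfolding x2 using assms(3) by simp
  then have "exp (- (real n * x\<^sup>2 / 32)) \<le> exp (4 * - l)" by simp
  also have "\<dots> = exp (- l) ^ 4" using exp_of_nat_mult[of 4 "- l"] by simp
  finally show "2 * exp (- (real n * x\<^sup>2 / 32)) \<le> 2 * exp (- l) ^ 4" by simp
qed

lemma Max_power2_le:
  fixes f :: "'a \<Rightarrow> real"
  assumes "finite S" "S \<noteq> {}"
  shows "(MAX x\<in>S. f x)\<^sup>2 \<le> (MAX x\<in>S. (f x)\<^sup>2)"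
proof -
  have "(MAX x\<in>S. f x) \<in> f ` S" using assms by (intro Max_in) auto
  then obtain x where "x \<in> S" "(MAX x\<in>S. f x) = f x" by auto
  then show ?thesis using assms by (auto intro!: Max_ge)
qed

lemma n_count_commute: "n_count K Ob n Md g h = n_count K Ob n Md h g"
  by (simp add: n_count_def Un_commute)

text \<open>
  The deviation \<open>R (2 (\<sigma> + R \<parallel>\<beta>\<parallel>)) x\<close> with \<open>x = A \<surd>(l / h) / 4\<close> is half of a lower bound for
  \<open>lam\<close>.
\<close>

lemma gamma_event:
  assumes model: "linear_model p P \<sigma>" and pat: "patterns p K Ob" and mod: "modalities p K Ob L Md"
    and R: "psi2_norm_vec p P fst \<le> ereal R" "0 \<le> R" and noise: "sub_Gaussian P snd \<sigma>"
    and A: "64 \<le> A" and j: "j < p"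
    and lam: "\<And>g. g < L \<Longrightarrow> A * sqrt (R\<^sup>2 * (\<sigma> + R * l2_norm p \<beta>)\<^sup>2 * ln (2 * real L * real (card (Md g)))
        / real (h_count K Ob n Md g)) \<le> lam"
    and h: "\<And>g. g < L \<Longrightarrow> A\<^sup>2 * ln (2 * real L * real (card (Md g))) \<le> real (h_count K Ob n Md g)"
  shows "with_prob_at_least (data_law p K Ob n N P \<beta>) (1 - 2 * union_weight L Md j ^ 4)
    (\<lambda>\<omega>. \<bar>gamma_hat K Ob n L Md \<omega> j - mult_mat p (second_moment P) \<beta> j\<bar> \<le> lam / 2)"
proof -
  obtain g where g: "g < L" "j \<in> Md g" using modality_exists[OF mod j] .
  define l where "l = ln (2 * real L * real (card (Md g)))"
  define m where "m = h_count K Ob n Md g"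
  define x where "x = A * sqrt (l / real m) / 4"
  define \<rho> where "\<rho> = \<sigma> + R * l2_norm p \<beta>"
  have "0 \<le> \<sigma>" using model by (simp add: linear_model_def)
  then have \<rho>: "0 \<le> \<rho>" using R(2) by (simp add: \<rho>_def)
  have l: "0 < l" "exp (- l) = union_weight L Md j"
    using exp_log_size[OF mod g] by (simp_all add: l_def)
  have level: "A\<^sup>2 * l \<le> real m" using h[OF g(1)] by (simp add: l_def m_def)
  note x = bernstein_tail_at_rate[OF level A l(1), folded x_def]
  have "0 < A\<^sup>2 * l" using A l(1) by simp
  then have m: "0 < m" using level by linarith
  have "sqrt (R\<^sup>2 * \<rho>\<^sup>2 * l / real m) = R * \<rho> * sqrt (l / real m)"
    using R(2) \<rho> by (simp add: real_sqrt_mult real_sqrt_divide)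
  then have "R * (2 * \<rho>) * x \<le> lam / 2"
    using lam[OF g(1), folded l_def m_def \<rho>_def] by (simp add: x_def mult_ac)
  moreover have "1 - 2 * union_weight L Md j ^ 4 \<le> 1 - 2 * exp (- (real m * x\<^sup>2 / 32))"
    using x(3) by (simp add: l(2))
  ultimately show ?thesis
    using gamma_hat_deviation[OF model pat mod R noise g m[unfolded m_def] x(1,2), where N = N and \<beta> = \<beta>]
    by (elim with_prob_at_least_mono) (auto simp: m_def \<rho>_def)
qed

text \<open>
  The logarithm belongs to the modality \<open>g\<close> of the row, over which the union bound runs, and not to the
  modality \<open>h\<close> of the block.  The symmetry of the sample sizes makes the term of \<open>lam\<close> for the
  modality \<open>g\<close> the right one: its minimum of sample sizes includes the block of \<open>g\<close> and \<open>h\<close>.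
\<close>

lemma Sigma_hat_row_event:
  assumes model: "linear_model p P \<sigma>" and pat: "patterns p K Ob" and mod: "modalities p K Ob L Md"
    and R: "psi2_norm_vec p P fst \<le> ereal R" "0 \<le> R"
    and A: "64 \<le> A" and j: "j < p" and h: "h < L"
    and lam: "\<And>g. g < L \<Longrightarrow> A * (real L * sqrt (R ^ 4 * (l2_norm p \<beta>)\<^sup>2 * ln (2 * real L * real (card (Md g)))
        / real (N + (MIN h\<in>{..<L}. n_count K Ob n Md h g)))) \<le> lam"
    and n: "\<And>g. g < L \<Longrightarrow> A\<^sup>2 * ln (2 * real L * real (card (Md g))) \<le> real (n_count K Ob n Md g h + N)"
    and pos: "\<And>g h. g < L \<Longrightarrow> h < L \<Longrightarrow> 0 < n_count K Ob n Md g h + N"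
  shows "with_prob_at_least (data_law p K Ob n N P \<beta>) (1 - 2 * union_weight L Md j ^ 4)
    (\<lambda>\<omega>. real L * \<bar>\<Sum>i\<in>Md h. (Sigma_hat K Ob n N L Md \<omega> j i - second_moment P j i) * \<beta> i\<bar> \<le> lam / 4)"
proof -
  obtain g where g: "g < L" "j \<in> Md g" using modality_exists[OF mod j] .
  define l where "l = ln (2 * real L * real (card (Md g)))"
  define m where "m = n_count K Ob n Md g h + N"
  define m0 where "m0 = N + (MIN h\<in>{..<L}. n_count K Ob n Md h g)"
  define x where "x = A * sqrt (l / real m) / 4"
  have l: "0 < l" "exp (- l) = union_weight L Md j"
    using exp_log_size[OF mod g] by (simp_all add: l_def)
  have level: "A\<^sup>2 * l \<le> real m" using n[OF g(1)] by (simp add: l_def m_def)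
  note x = bernstein_tail_at_rate[OF level A l(1), folded x_def]
  have "(MIN h\<in>{..<L}. n_count K Ob n Md h g) \<le> n_count K Ob n Md h g"
    using h by (intro Min_le) auto
  then have m0: "m0 \<le> m" by (simp add: m0_def m_def n_count_commute[of _ _ _ _ g])
  have "(MIN h\<in>{..<L}. n_count K Ob n Md h g) \<in> (\<lambda>h. n_count K Ob n Md h g) ` {..<L}"
    using h by (intro Min_in) auto
  then obtain h0 where h0: "h0 < L" "(MIN h\<in>{..<L}. n_count K Ob n Md h g) = n_count K Ob n Md h0 g" by auto
  then have m0_pos: "0 < m0" using pos[OF h0(1) g(1)] by (simp only: m0_def add.commute)
  have Mh: "Md h \<subseteq> {..<p}" by (rule modalities_partition(1)[OF mod h])
  have "L2_set \<beta> (Md h) \<le> l2_norm p \<beta>"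
    unfolding L2_set_def using Mh by (intro real_sqrt_le_mono sum_mono2) auto
  then have "R\<^sup>2 * L2_set \<beta> (Md h) * x \<le> R\<^sup>2 * l2_norm p \<beta> * x"
    using x(1) by (intro mult_right_mono mult_left_mono) auto
  also have "\<dots> \<le> R\<^sup>2 * l2_norm p \<beta> * (A * sqrt (l / real m0) / 4)"
    unfolding x_def using A l(1) m0 m0_pos
    by (intro mult_left_mono divide_right_mono real_sqrt_le_mono divide_left_mono) auto
  also have "\<dots> = A * sqrt (R ^ 4 * (l2_norm p \<beta>)\<^sup>2 * l / real m0) / 4"
  proof -
    have "R ^ 4 * (l2_norm p \<beta>)\<^sup>2 * l / real m0 = (R\<^sup>2 * l2_norm p \<beta>)\<^sup>2 * (l / real m0)"
      by (simp add: power_mult_distrib)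
    then have "sqrt (R ^ 4 * (l2_norm p \<beta>)\<^sup>2 * l / real m0) = \<bar>R\<^sup>2 * l2_norm p \<beta>\<bar> * sqrt (l / real m0)"
      by (simp only: real_sqrt_mult real_sqrt_abs)
    then have "sqrt (R ^ 4 * (l2_norm p \<beta>)\<^sup>2 * l / real m0) = R\<^sup>2 * l2_norm p \<beta> * sqrt (l / real m0)"
      by (simp only: abs_of_nonneg mult_nonneg_nonneg zero_le_power2 L2_set_nonneg)
    then show ?thesis by simp
  qed
  finally have "real L * (R\<^sup>2 * L2_set \<beta> (Md h) * x) \<le> real L * (A * sqrt (R ^ 4 * (l2_norm p \<beta>)\<^sup>2 * l / real m0) / 4)"
    by (intro mult_left_mono) auto
  also have "\<dots> \<le> lam / 4" using lam[OF g(1)] by (simp add: l_def m0_def mult_ac)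
  finally have small: "real L * (R\<^sup>2 * L2_set \<beta> (Md h) * x) \<le> lam / 4" .
  show ?thesis
  proof (rule with_prob_at_least_mono[OF Sigma_hat_deviation[OF model pat mod R g h pos[OF g(1) h] x(1,2)]])
    show "1 - 2 * union_weight L Md j ^ 4 \<le> 1 - 2 * exp (- (real (n_count K Ob n Md g h + N) * x\<^sup>2 / 32))"
      using x(3) by (simp add: l(2) m_def)
    fix \<omega>
    assume "\<bar>\<Sum>i\<in>Md h. (Sigma_hat K Ob n N L Md \<omega> j i - second_moment P j i) * \<beta> i\<bar> \<le> R\<^sup>2 * L2_set \<beta> (Md h) * x"
    then have "real L * \<bar>\<Sum>i\<in>Md h. (Sigma_hat K Ob n N L Md \<omega> j i - second_moment P j i) * \<beta> i\<bar> \<le>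
        real L * (R\<^sup>2 * L2_set \<beta> (Md h) * x)" by (intro mult_left_mono) auto
    with small show "real L * \<bar>\<Sum>i\<in>Md h. (Sigma_hat K Ob n N L Md \<omega> j i - second_moment P j i) * \<beta> i\<bar> \<le> lam / 4"
      by linarith
  qed
qed

text \<open>
  The deviation \<open>R\<^sup>2 x\<close> with \<open>x = \<Phi> / (8 R\<^sup>2 s)\<close> is allowed.  The two sample size conditions
  treat the cases that this \<open>x\<close> is at most 1 and that it is cut off at 1.  The larger of the two
  logarithms dominates their mean, which gives both coordinates the power \<open>2\<close> of their weights.
\<close>

lemma Sigma_hat_entry_event:
  assumes model: "linear_model p P \<sigma>" and pat: "patterns p K Ob" and mod: "modalities p K Ob L Md"
    and R: "psi2_norm_vec p P fst \<le> ereal R" "0 < R"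
    and A: "64 \<le> A" and i: "i < p" and j: "j < p" and \<Phi>: "0 < \<Phi>" and s: "0 < s"
    and n: "\<And>g h. g < L \<Longrightarrow> h < L \<Longrightarrow>
      8192 * A\<^sup>2 * max (ln (2 * real L * real (card (Md g)))) (ln (2 * real L * real (card (Md h)))) \<le>
        real (n_count K Ob n Md g h + N)"
    and n': "\<And>g h. g < L \<Longrightarrow> h < L \<Longrightarrow>
      8192 * (R ^ 4 * (real s)\<^sup>2 / \<Phi>\<^sup>2) *
        max (ln (2 * real L * real (card (Md g)))) (ln (2 * real L * real (card (Md h)))) \<le>
        real (n_count K Ob n Md g h + N)"
    and pos: "\<And>g h. g < L \<Longrightarrow> h < L \<Longrightarrow> 0 < n_count K Ob n Md g h + N"
  shows "with_prob_at_least (data_law p K Ob n N P \<beta>)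
    (1 - 2 * ((union_weight L Md i)\<^sup>2 * (union_weight L Md j)\<^sup>2))
    (\<lambda>\<omega>. \<bar>Sigma_hat K Ob n N L Md \<omega> i j - second_moment P i j\<bar> \<le> \<Phi> / (8 * real s))"
proof -
  obtain g where g: "g < L" "i \<in> Md g" using modality_exists[OF mod i] .
  obtain h where h: "h < L" "j \<in> Md h" using modality_exists[OF mod j] .
  define l where "l = ln (2 * real L * real (card (Md g)))"
  define l' where "l' = ln (2 * real L * real (card (Md h)))"
  define m where "m = n_count K Ob n Md g h + N"
  define y where "y = \<Phi> / (8 * R\<^sup>2 * real s)"
  define x where "x = min 1 y"
  have l: "0 < l" "exp (- l) = union_weight L Md i" "0 < l'" "exp (- l') = union_weight L Md j"
    using exp_log_size[OF mod g] exp_log_size[OF mod h] by (simp_all add: l_def l'_def)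
  have y: "0 < y" using \<Phi> R(2) s by (simp add: y_def)
  have x: "0 < x" "x \<le> 8" using y by (auto simp: x_def)
  have "4 * max l l' \<le> real m * x\<^sup>2 / 32"
  proof (cases "y \<le> 1")
    case True
    have "8192 * (R ^ 4 * (real s)\<^sup>2 / \<Phi>\<^sup>2) * max l l' * y\<^sup>2 \<le> real m * y\<^sup>2"
      using n'[OF g(1) h(1)] by (intro mult_right_mono) (auto simp: m_def l_def l'_def)
    moreover have "8192 * (R ^ 4 * (real s)\<^sup>2 / \<Phi>\<^sup>2) * max l l' * y\<^sup>2 = 128 * max l l'"
    proof -
      have "R ^ 4 = (R\<^sup>2)\<^sup>2" by simp
      then have unit: "(R ^ 4 * (real s)\<^sup>2 / \<Phi>\<^sup>2) * y\<^sup>2 = 1 / 64"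
        using \<Phi> R(2) s by (simp add: y_def power_divide power_mult_distrib)
      have "8192 * (R ^ 4 * (real s)\<^sup>2 / \<Phi>\<^sup>2) * max l l' * y\<^sup>2 =
          8192 * max l l' * ((R ^ 4 * (real s)\<^sup>2 / \<Phi>\<^sup>2) * y\<^sup>2)" by (simp only: mult_ac)
      then show ?thesis unfolding unit by simp
    qed
    ultimately show ?thesis using True by (simp add: x_def min_def)
  next
    case False
    have "64\<^sup>2 * max l l' \<le> A\<^sup>2 * max l l'" using A l by (intro mult_right_mono power_mono) auto
    moreover have "8192 * A\<^sup>2 * max l l' \<le> real m"
      using n[OF g(1) h(1)] by (simp add: m_def l_def l'_def)
    moreover have "0 < max l l'" using l by simp
    ultimately have "128 * max l l' \<le> real m" unfolding power2_eq_square mult.assoc by linarith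
    then show ?thesis using False by (simp add: x_def min_def)
  qed
  then have "2 * l + 2 * l' \<le> real m * x\<^sup>2 / 32" by linarith
  then have "exp (- (real m * x\<^sup>2 / 32)) \<le> exp (2 * - l + 2 * - l')" by simp
  also have "\<dots> = (exp (- l))\<^sup>2 * (exp (- l'))\<^sup>2"
    using exp_of_nat_mult[of 2 "- l"] exp_of_nat_mult[of 2 "- l'"] by (simp only: exp_add of_nat_numeral)
  finally have tail: "exp (- (real m * x\<^sup>2 / 32)) \<le> (union_weight L Md i)\<^sup>2 * (union_weight L Md j)\<^sup>2"
    by (simp only: l)
  define e where "e k = (if k = j then 1 else 0 :: real)" for k
  have fin: "finite (Md h)" using modalities_partition(1)[OF mod h(1)] finite_subset by blast
  have pick: "(\<Sum>k\<in>Md h. a k * e k) = a j" for a :: "nat \<Rightarrow> real"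
    using fin h(2) by (simp add: e_def if_distrib[of "\<lambda>x. _ * x"] sum.delta cong: if_cong)
  have e1: "L2_set e (Md h) = 1"
    using pick[of e] by (simp add: L2_set_def power2_eq_square e_def)
  have xy: "R\<^sup>2 * x \<le> \<Phi> / (8 * real s)"
  proof -
    have "R\<^sup>2 * x \<le> R\<^sup>2 * y" by (intro mult_left_mono) (auto simp: x_def)
    also have "\<dots> = \<Phi> / (8 * real s)" using R(2) by (simp add: y_def)
    finally show ?thesis .
  qed
  show ?thesis
  proof (rule with_prob_at_least_mono[OF Sigma_hat_deviation[OF model pat mod R(1) less_imp_le[OF R(2)] g h(1)
          pos[OF g(1) h(1)] x, where v = e]])
    show "1 - 2 * ((union_weight L Md i)\<^sup>2 * (union_weight L Md j)\<^sup>2) \<le>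
        1 - 2 * exp (- (real (n_count K Ob n Md g h + N) * x\<^sup>2 / 32))"
      using tail by (simp add: m_def)
  qed (use xy in \<open>simp add: pick e1\<close>)
qed

lemma prob_space_data_law:
  assumes "linear_model p P \<sigma>" "patterns p K Ob"
  shows "prob_space (data_law p K Ob n N P \<beta>)"
  unfolding data_law_def
  by (intro prob_space_pair prob_space_PiM lab_law_distr(1)[OF assms(1)] lab_index_pattern[OF assms(2)]
      covariate_law_distr(1)[OF assms(1)])

text \<open>
  The row is summed block by block, and each of the \<open>L\<close> blocks contributes at most \<open>c / L\<close>.
\<close>

lemma row_error_le:
  assumes mod: "modalities p K Ob L Md" and "j < p"
    and blocks: "\<And>h. h < L \<Longrightarrow> real L * \<bar>\<Sum>i\<in>Md h. (B j i - A j i) * \<beta> i\<bar> \<le> c"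
  shows "\<bar>mult_mat p B \<beta> j - mult_mat p A \<beta> j\<bar> \<le> c"
proof -
  obtain g where "g < L" using modality_exists[OF mod \<open>j < p\<close>] .
  then have L: "0 < real L" by simp
  have "mult_mat p B \<beta> j - mult_mat p A \<beta> j = (\<Sum>i<p. (B j i - A j i) * \<beta> i)"
    by (simp add: mult_mat_def sum_subtractf left_diff_distrib)
  also have "\<dots> = (\<Sum>h<L. \<Sum>i\<in>Md h. (B j i - A j i) * \<beta> i)" by (rule sum_over_modalities[OF mod])
  finally have "\<bar>mult_mat p B \<beta> j - mult_mat p A \<beta> j\<bar> \<le> (\<Sum>h<L. \<bar>\<Sum>i\<in>Md h. (B j i - A j i) * \<beta> i\<bar>)"
    by (simp only: sum_abs)
  then have "real L * \<bar>mult_mat p B \<beta> j - mult_mat p A \<beta> j\<bar> \<le>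
      real L * (\<Sum>h<L. \<bar>\<Sum>i\<in>Md h. (B j i - A j i) * \<beta> i\<bar>)"
    using L by (intro mult_left_mono) auto
  also have "\<dots> = (\<Sum>h<L. real L * \<bar>\<Sum>i\<in>Md h. (B j i - A j i) * \<beta> i\<bar>)" by (rule sum_distrib_left)
  also have "\<dots> \<le> (\<Sum>h<L. c)" by (intro sum_mono blocks) simp
  also have "\<dots> = real L * c" by simp
  finally show ?thesis using L by simp
qed

section \<open>The error bound\<close>

text \<open>
  On the good event the row errors of \<open>gamma_hat\<close> and \<open>Sigma_hat \<beta>\<close> add up to at most
  \<open>lam / 2 + lam / 4\<close>, so \<open>\<beta>\<close> is feasible and \<open>lp_solution_error\<close> applies.  The rate in the
  conclusion bounds \<open>lam\<^sup>2 / A\<^sup>2\<close>.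
\<close>

lemma estimation_error_bound:
  fixes P :: model_law and L :: nat and Md :: "nat \<Rightarrow> nat set"
  defines "l \<equiv> \<lambda>g. ln (2 * real L * real (card (Md g)))"
  assumes p: "0 < p" and model: "linear_model p P \<sigma>" and pat: "patterns p K Ob"
    and mod: "modalities p K Ob L Md"
    and pos: "\<forall>g<L. \<forall>h<L. n_count K Ob n Md g h + N > 0"
    and lam: "lam = A * max
        (MAX g\<in>{..<L}. sqrt (R\<^sup>2 * (\<sigma> + R * l2_norm p \<beta>)\<^sup>2 * l g / real (h_count K Ob n Md g)))
        (MAX h\<in>{..<L}. real L * sqrt (R ^ 4 * (l2_norm p \<beta>)\<^sup>2 * l h
                          / real (N + (MIN g\<in>{..<L}. n_count K Ob n Md g h))))"
    and est: "is_estimator p K Ob n N L Md lam \<beta>hat"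
    and sparse: "l0_norm p \<beta> \<le> s"
    and R: "0 < R" "psi2_norm_vec p P fst \<le> ereal R"
    and noise: "sub_Gaussian P snd \<sigma>"
    and Re: "0 < \<Phi>" "Re_cond p (second_moment P) s \<Phi>"
    and n_A: "\<And>g h. g < L \<Longrightarrow> h < L \<Longrightarrow>
      8192 * A\<^sup>2 * max (l g) (l h) \<le> real (n_count K Ob n Md g h + N)"
    and n_s: "\<And>g h. g < L \<Longrightarrow> h < L \<Longrightarrow>
      8192 * (R ^ 4 * (real s)\<^sup>2 / \<Phi>\<^sup>2) * max (l g) (l h) \<le> real (n_count K Ob n Md g h + N)"
    and h_A: "\<And>g. g < L \<Longrightarrow> A\<^sup>2 * l g \<le> real (h_count K Ob n Md g)"
    and A: "64 \<le> A"
  shows "with_prob_at_least (data_law p K Ob n N P \<beta>)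
    (1 - 1 / (real L * real (MIN l\<in>{..<L}. card (Md l))))
    (\<lambda>\<omega>. (l2_norm p (\<lambda>i. \<beta>hat \<omega> i - \<beta> i))\<^sup>2 \<le>
       128 * (real s * A\<^sup>2 / \<Phi>\<^sup>2) * max
         (MAX g\<in>{..<L}. R\<^sup>2 * (\<sigma> + R * l2_norm p \<beta>)\<^sup>2 * l g / real (h_count K Ob n Md g))
         (MAX h\<in>{..<L}. (real L)\<^sup>2 * R ^ 4 * (l2_norm p \<beta>)\<^sup>2 * l h
                          / real (N + (MIN g\<in>{..<L}. n_count K Ob n Md g h))))"
proof -
  define D where "D = data_law p K Ob n N P \<beta>"
  define S where "S = Sigma_hat K Ob n N L Md"
  define \<gamma> where "\<gamma> = gamma_hat K Ob n L Md"
  define M where "M = second_moment P"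
  define u where "u = union_weight L Md"
  define a where "a g = sqrt (R\<^sup>2 * (\<sigma> + R * l2_norm p \<beta>)\<^sup>2 * l g / real (h_count K Ob n Md g))" for g
  define b where "b h = real L * sqrt (R ^ 4 * (l2_norm p \<beta>)\<^sup>2 * l h
                          / real (N + (MIN g\<in>{..<L}. n_count K Ob n Md g h)))" for h
  have lam_eq: "lam = A * max (MAX g\<in>{..<L}. a g) (MAX h\<in>{..<L}. b h)" by (simp only: lam a_def b_def)
  obtain g0 where "g0 < L" using modality_exists[OF mod p] .
  then have L: "finite {..<L}" "{..<L} \<noteq> {}" by auto
  have l_pos: "0 < l g" if "g < L" for g
    using modalities_partition(2)[OF mod that] exp_log_size(2)[OF mod that] unfolding l_def by blast
  have a_lam: "A * a g \<le> lam" if "g < L" for g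
    unfolding lam_eq using that A by (intro mult_left_mono max.coboundedI1 Max_ge) auto
  have b_lam: "A * b g \<le> lam" if "g < L" for g
    unfolding lam_eq using that A by (intro mult_left_mono max.coboundedI2 Max_ge) auto
  have a_sq: "(a g)\<^sup>2 = R\<^sup>2 * (\<sigma> + R * l2_norm p \<beta>)\<^sup>2 * l g / real (h_count K Ob n Md g)" if "g < L" for g
    unfolding a_def using l_pos[OF that] by simp
  have b_sq: "(b h)\<^sup>2 = (real L)\<^sup>2 * R ^ 4 * (l2_norm p \<beta>)\<^sup>2 * l h
                          / real (N + (MIN g\<in>{..<L}. n_count K Ob n Md g h))" if "h < L" for h
    unfolding b_def power_mult_distrib using l_pos[OF that] R(1) by simp
  define rate where "rate = max (MAX g\<in>{..<L}. (a g)\<^sup>2) (MAX h\<in>{..<L}. (b h)\<^sup>2)"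
  have "lam\<^sup>2 \<le> A\<^sup>2 * rate"
  proof -
    have "(max (MAX g\<in>{..<L}. a g) (MAX h\<in>{..<L}. b h))\<^sup>2 \<le> rate"
      using Max_power2_le[OF L, of a] Max_power2_le[OF L, of b] by (simp add: rate_def max_def)
    then show ?thesis unfolding lam_eq power_mult_distrib by (intro mult_left_mono) auto
  qed
  interpret D: prob_space D unfolding D_def by (rule prob_space_data_law[OF model pat])
  have A_l: "A\<^sup>2 * l g \<le> real (n_count K Ob n Md g h + N)" if "g < L" "h < L" for g h
  proof -
    have "A\<^sup>2 * l g \<le> A\<^sup>2 * max (l g) (l h)" by (intro mult_left_mono) auto
    also have "\<dots> \<le> 8192 * (A\<^sup>2 * max (l g) (l h))"
      using l_pos[OF that(1)] by simp
    also have "\<dots> \<le> real (n_count K Ob n Md g h + N)" using n_A[OF that] by (simp only: mult.assoc)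
    finally show ?thesis .
  qed
  have pos': "0 < n_count K Ob n Md g h + N" if "g < L" "h < L" for g h using pos that by blast
  define good where "good = (\<lambda>\<omega>. (\<forall>j\<in>{..<p}. \<bar>\<gamma> \<omega> j - mult_mat p M \<beta> j\<bar> \<le> lam / 2) \<and>
      (\<forall>z\<in>{..<p} \<times> {..<L}. real L * \<bar>\<Sum>i\<in>Md (snd z). (S \<omega> (fst z) i - M (fst z) i) * \<beta> i\<bar> \<le> lam / 4) \<and>
      (\<forall>z\<in>{..<p} \<times> {..<p}. 0 < s \<longrightarrow> \<bar>S \<omega> (fst z) (snd z) - M (fst z) (snd z)\<bar> \<le> \<Phi> / (8 * real s)))"
  have "with_prob_at_least D (1 - ((\<Sum>j<p. 2 * u j ^ 4) + ((\<Sum>z\<in>{..<p} \<times> {..<L}. 2 * u (fst z) ^ 4) +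
      (\<Sum>z\<in>{..<p} \<times> {..<p}. 2 * ((u (fst z))\<^sup>2 * (u (snd z))\<^sup>2))))) good"
    unfolding good_def
  proof (intro with_prob_at_least_conj with_prob_at_least_ball D.prob_space_axioms)
    fix j assume "j \<in> {..<p}"
    then have j: "j < p" by simp
    show "with_prob_at_least D (1 - 2 * u j ^ 4) (\<lambda>\<omega>. \<bar>\<gamma> \<omega> j - mult_mat p M \<beta> j\<bar> \<le> lam / 2)"
      unfolding D_def u_def \<gamma>_def M_def
      by (rule gamma_event[OF model pat mod R(2) less_imp_le[OF R(1)] noise A j
            a_lam[unfolded a_def l_def] h_A[unfolded l_def]])
  next
    fix z assume "z \<in> {..<p} \<times> {..<L}"
    then have z: "fst z < p" "snd z < L" by auto
    show "with_prob_at_least D (1 - 2 * u (fst z) ^ 4)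
      (\<lambda>\<omega>. real L * \<bar>\<Sum>i\<in>Md (snd z). (S \<omega> (fst z) i - M (fst z) i) * \<beta> i\<bar> \<le> lam / 4)"
      unfolding D_def u_def S_def M_def
      by (rule Sigma_hat_row_event[OF model pat mod R(2) less_imp_le[OF R(1)] A z
            b_lam[unfolded b_def l_def] A_l[OF _ z(2), unfolded l_def] pos'])
  next
    fix z assume "z \<in> {..<p} \<times> {..<p}"
    then have z: "fst z < p" "snd z < p" by auto
    show "with_prob_at_least D (1 - 2 * ((u (fst z))\<^sup>2 * (u (snd z))\<^sup>2))
      (\<lambda>\<omega>. 0 < s \<longrightarrow> \<bar>S \<omega> (fst z) (snd z) - M (fst z) (snd z)\<bar> \<le> \<Phi> / (8 * real s))"
    proof (cases "0 < s")
      case True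
      show ?thesis
        using Sigma_hat_entry_event[OF model pat mod R(2) R(1) A z Re(1) True
            n_A[unfolded l_def] n_s[unfolded l_def] pos', of \<beta>]
        unfolding D_def u_def S_def M_def by (rule with_prob_at_least_mono) auto
    next
      case False
      then show ?thesis unfolding with_prob_at_least_def
        by (intro bexI[of _ "space D"]) (auto simp: D.prob_space)
    qed
  qed auto
  then show ?thesis
    unfolding D_def[symmetric]
  proof (rule with_prob_at_least_mono)
    show "1 - 1 / (real L * real (MIN l\<in>{..<L}. card (Md l))) \<le>
        1 - ((\<Sum>j<p. 2 * u j ^ 4) + ((\<Sum>z\<in>{..<p} \<times> {..<L}. 2 * u (fst z) ^ 4) +
          (\<Sum>z\<in>{..<p} \<times> {..<p}. 2 * ((u (fst z))\<^sup>2 * (u (snd z))\<^sup>2))))"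
      using union_bound_total[OF mod p] by (simp add: u_def case_prod_beta)
    fix \<omega> assume "good \<omega>"
    then have \<gamma>: "\<bar>\<gamma> \<omega> j - mult_mat p M \<beta> j\<bar> \<le> lam / 2" if "j < p" for j
      using that unfolding good_def by simp
    have rows: "real L * \<bar>\<Sum>i\<in>Md h. (S \<omega> j i - M j i) * \<beta> i\<bar> \<le> lam / 4" if "j < p" "h < L" for j h
    proof -
      have "(j, h) \<in> {..<p} \<times> {..<L}" using that by simp
      with \<open>good \<omega>\<close> show ?thesis unfolding good_def by fastforce
    qed
    have entries: "\<bar>S \<omega> i j - M i j\<bar> \<le> \<Phi> / (8 * real s)" if "0 < s" "i < p" "j < p" for i j
    proof -
      have "(i, j) \<in> {..<p} \<times> {..<p}" using that by simp
      with \<open>good \<omega>\<close> \<open>0 < s\<close> show ?thesis unfolding good_def by fastforce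
    qed
    have "\<bar>mult_mat p (S \<omega>) \<beta> j - \<gamma> \<omega> j\<bar> \<le> lam" if j: "j < p" for j
    proof -
      have "\<bar>mult_mat p (S \<omega>) \<beta> j - mult_mat p M \<beta> j\<bar> \<le> lam / 4"
        by (rule row_error_le[OF mod j, where B = "S \<omega>" and A = M, OF rows[OF j]])
      with \<gamma>[OF j] show ?thesis by linarith
    qed
    then have feasible: "linf_norm p (\<lambda>j. mult_mat p (S \<omega>) \<beta> j - \<gamma> \<omega> j) \<le> lam"
      by (simp add: linf_norm_le_iff[OF p])
    have "lp_solutions p (S \<omega>) (\<gamma> \<omega>) lam \<noteq> {}" by (rule lp_solutions_nonempty[OF feasible p])
    then have "\<beta>hat \<omega> \<in> lp_solutions p (S \<omega>) (\<gamma> \<omega>) lam"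
      using est unfolding is_estimator_def S_def \<gamma>_def Let_def by blast
    from lp_solution_error[OF this feasible sparse Re(2)[folded M_def] Re(1) entries]
    have "(l2_norm p (\<lambda>i. \<beta>hat \<omega> i - \<beta> i))\<^sup>2 \<le> 128 * (real s / \<Phi>\<^sup>2) * lam\<^sup>2" .
    also have "\<dots> \<le> 128 * (real s / \<Phi>\<^sup>2) * (A\<^sup>2 * rate)"
      using \<open>lam\<^sup>2 \<le> A\<^sup>2 * rate\<close> by (intro mult_left_mono) auto
    also have "\<dots> = 128 * (real s * A\<^sup>2 / \<Phi>\<^sup>2) * rate" by simp
    also have "rate = max
         (MAX g\<in>{..<L}. R\<^sup>2 * (\<sigma> + R * l2_norm p \<beta>)\<^sup>2 * l g / real (h_count K Ob n Md g))
         (MAX h\<in>{..<L}. (real L)\<^sup>2 * R ^ 4 * (l2_norm p \<beta>)\<^sup>2 * l h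
                          / real (N + (MIN g\<in>{..<L}. n_count K Ob n Md g h)))"
      unfolding rate_def by (intro arg_cong2[where f = max] arg_cong[where f = Max] image_cong refl) (auto simp: a_sq b_sq)
    finally show "(l2_norm p (\<lambda>i. \<beta>hat \<omega> i - \<beta> i))\<^sup>2 \<le>
       128 * (real s * A\<^sup>2 / \<Phi>\<^sup>2) * max
         (MAX g\<in>{..<L}. R\<^sup>2 * (\<sigma> + R * l2_norm p \<beta>)\<^sup>2 * l g / real (h_count K Ob n Md g))
         (MAX h\<in>{..<L}. (real L)\<^sup>2 * R ^ 4 * (l2_norm p \<beta>)\<^sup>2 * l h
                          / real (N + (MIN g\<in>{..<L}. n_count K Ob n Md g h)))" .
  qed
qed

theorem theorem8:
  shows "\<exists>F A0 C :: real. F > 0 \<and> A0 > 0 \<and> C > 0 \<and>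
    (\<forall>(p::nat) (K::nat) (Ob :: nat \<Rightarrow> nat set) (n :: nat \<Rightarrow> nat) (N::nat)
      (L::nat) (Md :: nat \<Rightarrow> nat set) (P :: model_law) (\<beta> :: nat \<Rightarrow> real) (\<sigma>::real)
      (R::real) (s::nat) (\<Phi>::real) (A::real) (lam::real) (\<beta>hat :: sample \<Rightarrow> nat \<Rightarrow> real).
      0 < p \<longrightarrow>
      linear_model p P \<sigma> \<longrightarrow>
      patterns p K Ob \<longrightarrow>
      modalities p K Ob L Md \<longrightarrow>
      (\<forall>g<L. \<forall>h<L. n_count K Ob n Md g h + N > 0) \<longrightarrow>
      A > 0 \<longrightarrow>
      lam = A * max
        (MAX l\<in>{..<L}. sqrt (R\<^sup>2 * (\<sigma> + R * l2_norm p \<beta>)\<^sup>2 * ln (2 * real L * real (card (Md l)))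
                          / real (h_count K Ob n Md l)))
        (MAX h\<in>{..<L}. real L * sqrt (R ^ 4 * (l2_norm p \<beta>)\<^sup>2 * ln (2 * real L * real (card (Md h)))
                          / real (N + (MIN g\<in>{..<L}. n_count K Ob n Md g h)))) \<longrightarrow>
      is_estimator p K Ob n N L Md lam \<beta>hat \<longrightarrow>
      s \<le> p \<longrightarrow>
      l0_norm p \<beta> \<le> s \<longrightarrow>
      (\<forall>j<p. (\<integral>\<omega>. fst \<omega> j \<partial>P) = 0) \<longrightarrow>
      R > 0 \<longrightarrow>
      psi2_norm_vec p P fst \<le> ereal R \<longrightarrow>
      sub_Gaussian P snd \<sigma> \<longrightarrow>
      \<Phi> > 0 \<longrightarrow>
      Re_cond p (second_moment P) s \<Phi> \<longrightarrow>
      (\<forall>g<L. \<forall>h<L. real (n_count K Ob n Md g h + N) \<ge>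
         F * Max {R ^ 4 * (real s)\<^sup>2 / \<Phi>\<^sup>2, R\<^sup>2 * real s / \<Phi>, A\<^sup>2,
                  A\<^sup>2 * (real L)\<^sup>2 * R\<^sup>2 * (l2_norm p \<beta>)\<^sup>2 / (\<sigma> + R * l2_norm p \<beta>)\<^sup>2} *
         max (ln (2 * real L * real (card (Md g)))) (ln (2 * real L * real (card (Md h))))) \<longrightarrow>
      (\<forall>g<L. real (h_count K Ob n Md g) \<ge>
         F * max (A\<^sup>2) (A\<^sup>2 * (\<sigma> + R * l2_norm p \<beta>)\<^sup>2 / (R\<^sup>2 * (real L)\<^sup>2 * (l2_norm p \<beta>)\<^sup>2)) *
         ln (2 * real L * real (card (Md g)))) \<longrightarrow>
      A \<ge> A0 \<longrightarrow>
      with_prob_at_least (data_law p K Ob n N P \<beta>)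
        (1 - 1 / (real L * real (MIN l\<in>{..<L}. card (Md l))))
        (\<lambda>\<omega>. (l2_norm p (\<lambda>i. \<beta>hat \<omega> i - \<beta> i))\<^sup>2 \<le>
           C * (real s * A\<^sup>2 / \<Phi>\<^sup>2) * max
             (MAX l\<in>{..<L}. R\<^sup>2 * (\<sigma> + R * l2_norm p \<beta>)\<^sup>2 * ln (2 * real L * real (card (Md l)))
                          / real (h_count K Ob n Md l))
             (MAX h\<in>{..<L}. (real L)\<^sup>2 * R ^ 4 * (l2_norm p \<beta>)\<^sup>2 * ln (2 * real L * real (card (Md h)))
                          / real (N + (MIN g\<in>{..<L}. n_count K Ob n Md g h)))))"
\<comment> \<open>The constant \<open>8192 = 4 * 32 * 64\<close> makes the exponent \<open>n x\<^sup>2 / 32\<close> for \<open>x = \<Phi> / (8 R\<^sup>2 s)\<close> at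
  least four times the logarithm.\<close>
proof (rule exI[of _ 8192], rule exI[of _ 64], rule exI[of _ 128], intro conjI allI impI)
  fix p K :: nat and Ob :: "nat \<Rightarrow> nat set" and n :: "nat \<Rightarrow> nat" and N L :: nat
    and Md :: "nat \<Rightarrow> nat set" and P :: model_law and \<beta> :: "nat \<Rightarrow> real" and \<sigma> R :: real
    and s :: nat and \<Phi> A lam :: real and \<beta>hat :: "sample \<Rightarrow> nat \<Rightarrow> real"
  define l where "l g = ln (2 * real L * real (card (Md g)))" for g
  \<comment> \<open>Only lower bounds on the maximum matter, one for each of its arguments.\<close>
  define T where "T = {R ^ 4 * (real s)\<^sup>2 / \<Phi>\<^sup>2, R\<^sup>2 * real s / \<Phi>, A\<^sup>2,
      A\<^sup>2 * (real L)\<^sup>2 * R\<^sup>2 * (l2_norm p \<beta>)\<^sup>2 / (\<sigma> + R * l2_norm p \<beta>)\<^sup>2}"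
  assume mod: "modalities p K Ob L Md"
    and n_cond: "\<forall>g<L. \<forall>h<L. real (n_count K Ob n Md g h + N) \<ge>
         8192 * Max {R ^ 4 * (real s)\<^sup>2 / \<Phi>\<^sup>2, R\<^sup>2 * real s / \<Phi>, A\<^sup>2,
                  A\<^sup>2 * (real L)\<^sup>2 * R\<^sup>2 * (l2_norm p \<beta>)\<^sup>2 / (\<sigma> + R * l2_norm p \<beta>)\<^sup>2} *
         max (ln (2 * real L * real (card (Md g)))) (ln (2 * real L * real (card (Md h))))"
    and h_cond: "\<forall>g<L. real (h_count K Ob n Md g) \<ge>
         8192 * max (A\<^sup>2) (A\<^sup>2 * (\<sigma> + R * l2_norm p \<beta>)\<^sup>2 / (R\<^sup>2 * (real L)\<^sup>2 * (l2_norm p \<beta>)\<^sup>2)) *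
         ln (2 * real L * real (card (Md g)))"
  have l_pos: "0 < l g" if "g < L" for g
    using modalities_partition(2)[OF mod that] exp_log_size(2)[OF mod that] unfolding l_def by blast
  have n_le: "8192 * t * max (l g) (l h) \<le> real (n_count K Ob n Md g h + N)" if "t \<in> T" "g < L" "h < L" for t g h
  proof -
    have "t \<le> Max T" using that(1) by (intro Max_ge) (simp_all add: T_def)
    then have "8192 * t * max (l g) (l h) \<le> 8192 * Max T * max (l g) (l h)"
      using l_pos[OF that(2)] by (intro mult_right_mono mult_left_mono) auto
    also have "\<dots> \<le> real (n_count K Ob n Md g h + N)"
      using n_cond that(2,3) unfolding T_def l_def by blast
    finally show ?thesis .
  qed
  have n_A: "8192 * A\<^sup>2 * max (l g) (l h) \<le> real (n_count K Ob n Md g h + N)" if "g < L" "h < L" for g h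
    using that by (intro n_le) (simp_all add: T_def)
  have n_s: "8192 * (R ^ 4 * (real s)\<^sup>2 / \<Phi>\<^sup>2) * max (l g) (l h) \<le> real (n_count K Ob n Md g h + N)"
    if "g < L" "h < L" for g h
    using that by (intro n_le) (simp_all add: T_def)
  have h_A: "A\<^sup>2 * l g \<le> real (h_count K Ob n Md g)" if g: "g < L" for g
  proof -
    define t where "t = max (A\<^sup>2) (A\<^sup>2 * (\<sigma> + R * l2_norm p \<beta>)\<^sup>2 / (R\<^sup>2 * (real L)\<^sup>2 * (l2_norm p \<beta>)\<^sup>2))"
    have "A\<^sup>2 \<le> t" by (simp add: t_def)
    then have "A\<^sup>2 \<le> 8192 * t" using zero_le_power2[of A] by linarith
    then have "A\<^sup>2 * l g \<le> 8192 * t * l g" using l_pos[OF g] by (intro mult_right_mono) auto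
    also have "\<dots> \<le> real (h_count K Ob n Md g)" using h_cond g unfolding t_def l_def by blast
    finally show ?thesis .
  qed
  assume *: "0 < p" "linear_model p P \<sigma>" "patterns p K Ob"
    "\<forall>g<L. \<forall>h<L. n_count K Ob n Md g h + N > 0"
    "lam = A * max
        (MAX l\<in>{..<L}. sqrt (R\<^sup>2 * (\<sigma> + R * l2_norm p \<beta>)\<^sup>2 * ln (2 * real L * real (card (Md l)))
                          / real (h_count K Ob n Md l)))
        (MAX h\<in>{..<L}. real L * sqrt (R ^ 4 * (l2_norm p \<beta>)\<^sup>2 * ln (2 * real L * real (card (Md h)))
                          / real (N + (MIN g\<in>{..<L}. n_count K Ob n Md g h))))"
    "is_estimator p K Ob n N L Md lam \<beta>hat" "l0_norm p \<beta> \<le> s" "R > 0"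
    "psi2_norm_vec p P fst \<le> ereal R" "sub_Gaussian P snd \<sigma>" "\<Phi> > 0"
    "Re_cond p (second_moment P) s \<Phi>" "A \<ge> 64"
  show "with_prob_at_least (data_law p K Ob n N P \<beta>)
        (1 - 1 / (real L * real (MIN l\<in>{..<L}. card (Md l))))
        (\<lambda>\<omega>. (l2_norm p (\<lambda>i. \<beta>hat \<omega> i - \<beta> i))\<^sup>2 \<le>
           128 * (real s * A\<^sup>2 / \<Phi>\<^sup>2) * max
             (MAX l\<in>{..<L}. R\<^sup>2 * (\<sigma> + R * l2_norm p \<beta>)\<^sup>2 * ln (2 * real L * real (card (Md l)))
                          / real (h_count K Ob n Md l))
             (MAX h\<in>{..<L}. (real L)\<^sup>2 * R ^ 4 * (l2_norm p \<beta>)\<^sup>2 * ln (2 * real L * real (card (Md h)))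
                          / real (N + (MIN g\<in>{..<L}. n_count K Ob n Md g h))))"
    by (rule estimation_error_bound[OF *(1-3) mod *(4-12) n_A[unfolded l_def] n_s[unfolded l_def]
          h_A[unfolded l_def] *(13)])
qed simp_all

end
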